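(* Let $A(\cdot):[0,\tau]\to\mathcal{L}(D,X)$ be a strongly measurable and bounded function such that $A(t)\in\mathscr{MR}$ for every $t\in[0,\tau]$ and such that $A(\cdot)$ satisfies the relative $\nu$-Dini condition for some $\nu\in(1,\infty)$. Let $U=(U(t,s))_{0\le s\le t\le\tau}$ be the evolution family on $X$ associated with $A(\cdot)$. Let $P(\cdot):[0,\tau]\to\mathcal{L}(D,X)$ be a strongly measurable and bounded function for which there exist $\mu\in(1,\infty)$ and a constant $c>0$ such that, for all $0\le s<\tau'<\tau$, $$\left(\int_s^{\tau'}\|P(t)U(t,s)x\|^{\mu}\,dt\right)^{1/\mu}\le c\,\|x\|\qquad(x\in D).$$ Define $A^P(t):=A(t)+P(t)$ for $t\in[0,\tau]$. Then $$\mathscr{O}^\theta_Y(A(\cdot))=\mathscr{O}^\theta_Y(A^P(\cdot))\qquad\text{for all }1<\theta\le\mu,$$ where $\mathscr{O}^\theta_Y(A(\cdot))$ and $\mathscr{O}^\theta_Y(A^P(\cdot))$ denote the sets of all $L^\theta$-admissible observation operators $C\in\mathcal{L}(D,Y)$ for $A(\cdot)$ and for $A^P(\cdot)$, respectively.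
   Context: $(X,\|\cdot\|)$, $(D,\|\cdot\|_D)$ and $(Y,\|\cdot\|_Y)$ are Banach spaces with $D$ continuously and densely embedded in $X$, and $\tau>0$ is fixed. Maximal regularity space: for $p\in(1,\infty)$ and $a<b$, $\mathrm{MR}_p(a,b):=W^{1,p}(a,b;X)\cap L^p(a,b;D)$ with norm $\|u\|_{W^{1,p}(a,b;X)}+\|u\|_{L^p(a,b;D)}$. Trace space: $\mathrm{Tr}_p:=\{u(a):u\in\mathrm{MR}_p(a,b)\}$ with norm $\|x\|_{\mathrm{Tr}_p}:=\inf\{\|u\|_{\mathrm{MR}_p(a,b)}:u(a)=x\}$; it does not depend on $(a,b)$ (up to equivalent norms), is isomorphic to the real interpolation space $(X,D)_{1-1/p,p}$, and $D\hookrightarrow\mathrm{Tr}_p\hookrightarrow X$ continuously and densely. Single operators: $A\in\mathcal{L}(D,X)$ has maximal $L^p$-regularity if for every bounded interval $(a,b)$ and every $f\in L^p(a,b;X)$ there is a unique $u\in\mathrm{MR}_p(a,b)$ with $\dot u(t)+Au(t)=f(t)$ for a.e. $t\in[a,b]$ and $u(a)=0$. This property is independent of $p\in(1,\infty)$, and one writes $A\in\mathscr{MR}$. Relative $\nu$-Dini condition: there exist $\eta\ge0$ and a continuous $\omega:[0,\tau]\to[0,\infty)$ with $\omega(0)=0$ and $\int_0^\tau(\omega(t)/t)^\nu\,dt<\infty$ such that $\|A(t)x-A(s)x\|\le\omega(|t-s|)\|x\|_D+\eta\|x\|$ for all $x\in D$, $s,t\in[0,\tau]$. Evolution family on a Banach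 space: a family $(U(t,s))_{0\le s\le t\le\tau}$ of bounded operators with $U(s,s)=I$, $U(t,s)=U(t,r)U(r,s)$ for $0\le s\le r\le t\le\tau$, and $(t,s)\mapsto U(t,s)$ strongly continuous. Evolution family associated with $A(\cdot)$: under the stated assumptions on $A(\cdot)$ it is known that there is a unique bounded evolution family $U$ on $X$ such that, for all $p\in(1,\infty)$, $s\in[0,\tau)$ and $x\in\mathrm{Tr}_p$, $U(\cdot,s)x$ is the unique $u\in\mathrm{MR}_p(s,\tau)$ with $\dot u(t)+A(t)u(t)=0$ for a.e. $t\in[s,\tau]$ and $u(s)=x$. In particular $U(t,s)x\in D$ for a.e. $t\in[s,\tau]$. Evolution family associated with $A^P(\cdot)$: under the stated assumptions on $A(\cdot)$ and $P(\cdot)$ there is a unique evolution family $V=(V(t,s))_{0\le s\le t\le\tau}$ on $X$ such that for every $q\in(1,\mu]$, $s\in[0,\tau)$ and $x\in\mathrm{Tr}_q$, $V(\cdot,s)x$ is the unique $u\in\mathrm{MR}_q(s,\tau)$ with $\dot u(t)+A^P(t)u(t)=0$ for a.e. $t\in[s,\tau]$ and $u(s)=x$. Admissibility: for $\theta\in(1,\infty)$, $C\in\mathcal{L}(D,Y)$ is $L^\theta$-admissible for $A(\cdot)$ if there exist constants $\gamma,\alpha>0$ such that for all $s\in[0,\tau)$ and $x\in D$, $$\left(\int_s^{\min\{s+\alpha,\tau\}}\|CU(t,s)x\|_Y^\theta\,dt\right)^{1/\theta}\le\gamma\|x\|.$$ $L^\theta$-admissibility for $A^P(\cdot)$ (with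 $1<\theta\le\mu$) is defined in the same way with $V$ in place of $U$. *)

theory Defs
  imports "HOL-Analysis.Analysis"
begin

text \<open>
  The Banach spaces are the types \<open>'x\<close>, \<open>'d\<close>, \<open>'y\<close>. They are not assumed separable, so the
  library's Bochner integral, which needs second countability, is used for real functions only.
  The embedding of D into X is an explicit bounded linear map \<open>j :: 'd \<Rightarrow>\<^sub>L 'x\<close>; thus
  \<open>j x\<close> is x seen in X, and \<open>inv j y\<close> is y seen in D, which is meaningful for
  \<open>y \<in> range j\<close> only.
\<close>

definition dense_embedding :: "('d::banach \<Rightarrow>\<^sub>L 'x::banach) \<Rightarrow> bool" where
  "dense_embedding j \<longleftrightarrow> inj (blinfun_apply j) \<and> closure (range (blinfun_apply j)) = UNIV"

definition strongly_measurable :: "'a measure \<Rightarrow> ('a \<Rightarrow> 'b::real_normed_vector) \<Rightarrow> bool" where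
  "strongly_measurable M f \<longleftrightarrow>
    (\<exists>s :: nat \<Rightarrow> 'a \<Rightarrow> 'b. (\<forall>n. simple_function M (s n)) \<and>
      (AE t in M. (\<lambda>n. s n t) \<longlonglongrightarrow> f t))"

text \<open>For operator-valued functions, strong measurability refers to the strong operator topology.
  This is implied by strong measurability with respect to the operator norm.\<close>

definition strongly_measurable_bounded_on ::
    "real \<Rightarrow> (real \<Rightarrow> ('d::banach \<Rightarrow>\<^sub>L 'x::banach)) \<Rightarrow> bool" where
  "strongly_measurable_bounded_on \<tau> A \<longleftrightarrow>
    (\<forall>x. strongly_measurable (lebesgue_on {0..\<tau>}) (\<lambda>t. A t x)) \<and> bounded (A ` {0..\<tau>})"

definition Lp_fun :: "real \<Rightarrow> real \<Rightarrow> real \<Rightarrow> (real \<Rightarrow> 'b::real_normed_vector) \<Rightarrow> bool" where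
  "Lp_fun p a b f \<longleftrightarrow>
    strongly_measurable (lebesgue_on {a..b}) f \<and>
    integrable (lebesgue_on {a..b}) (\<lambda>t. norm (f t) powr p)"

text \<open>\<open>W1p_deriv p a b u g\<close>: u belongs to \<open>W\<^sup>1\<^sup>,\<^sup>p(a,b;X)\<close>, is given by its continuous
  representative on \<open>[a,b]\<close>, and has (distributional) derivative g; that is, u is a primitive
  of the \<open>L\<^sup>p\<close> function g. For such g the Henstock-Kurzweil integral of the library is
  the Bochner integral.\<close>

definition W1p_deriv ::
    "real \<Rightarrow> real \<Rightarrow> real \<Rightarrow> (real \<Rightarrow> 'x::banach) \<Rightarrow> (real \<Rightarrow> 'x) \<Rightarrow> bool" where
  "W1p_deriv p a b u g \<longleftrightarrow>
    Lp_fun p a b u \<and> Lp_fun p a b g \<and>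
    (\<forall>t\<in>{a..b}. (g has_integral (u t - u a)) {a..t})"

definition MR_space ::
    "('d::banach \<Rightarrow>\<^sub>L 'x::banach) \<Rightarrow> real \<Rightarrow> real \<Rightarrow> real \<Rightarrow> (real \<Rightarrow> 'x) set" where
  "MR_space j p a b =
    {u. (\<exists>g. W1p_deriv p a b u g) \<and>
        (AE t in lebesgue_on {a..b}. u t \<in> range (blinfun_apply j)) \<and>
        Lp_fun p a b (\<lambda>t. inv (blinfun_apply j) (u t))}"

definition trace_space ::
    "('d::banach \<Rightarrow>\<^sub>L 'x::banach) \<Rightarrow> real \<Rightarrow> real \<Rightarrow> real \<Rightarrow> 'x set" where
  "trace_space j p a b = {u a | u. u \<in> MR_space j p a b}"

definition cauchy_solution ::
    "('d::banach \<Rightarrow>\<^sub>L 'x::banach) \<Rightarrow> real \<Rightarrow> real \<Rightarrow> real \<Rightarrow> (real \<Rightarrow> ('d \<Rightarrow>\<^sub>L 'x)) \<Rightarrow>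
      (real \<Rightarrow> 'x) \<Rightarrow> 'x \<Rightarrow> (real \<Rightarrow> 'x) \<Rightarrow> bool" where
  "cauchy_solution j p a b A f x u \<longleftrightarrow>
    u \<in> MR_space j p a b \<and> u a = x \<and>
    (\<exists>g. W1p_deriv p a b u g \<and>
      (AE t in lebesgue_on {a..b}. g t + A t (inv (blinfun_apply j) (u t)) = f t))"

text \<open>Elements of the function spaces over \<open>(a,b)\<close> are identified when they agree on
  \<open>[a,b]\<close>; this is why \<open>\<exists>!\<close> is not used.\<close>

definition unique_cauchy_solution ::
    "('d::banach \<Rightarrow>\<^sub>L 'x::banach) \<Rightarrow> real \<Rightarrow> real \<Rightarrow> real \<Rightarrow> (real \<Rightarrow> ('d \<Rightarrow>\<^sub>L 'x)) \<Rightarrow>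
      (real \<Rightarrow> 'x) \<Rightarrow> 'x \<Rightarrow> (real \<Rightarrow> 'x) \<Rightarrow> bool" where
  "unique_cauchy_solution j p a b A f x u \<longleftrightarrow>
    cauchy_solution j p a b A f x u \<and>
    (\<forall>w. cauchy_solution j p a b A f x w \<longrightarrow> (\<forall>t\<in>{a..b}. w t = u t))"

definition maximal_Lp_regularity ::
    "('d::banach \<Rightarrow>\<^sub>L 'x::banach) \<Rightarrow> real \<Rightarrow> ('d \<Rightarrow>\<^sub>L 'x) \<Rightarrow> bool" where
  "maximal_Lp_regularity j p A \<longleftrightarrow>
    (\<forall>a b f. a < b \<longrightarrow> Lp_fun p a b f \<longrightarrow>
      (\<exists>u. unique_cauchy_solution j p a b (\<lambda>_. A) f 0 u))"

text \<open>Maximal \<open>L\<^sup>p\<close>-regularity does not depend on the exponent p in \<open>(1,\<infinity>)\<close>.\<close>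

definition MR_ops :: "('d::banach \<Rightarrow>\<^sub>L 'x::banach) \<Rightarrow> ('d \<Rightarrow>\<^sub>L 'x) set" where
  "MR_ops j = {A. \<forall>p>1. maximal_Lp_regularity j p A}"

definition relative_Dini ::
    "('d::banach \<Rightarrow>\<^sub>L 'x::banach) \<Rightarrow> real \<Rightarrow> real \<Rightarrow> (real \<Rightarrow> ('d \<Rightarrow>\<^sub>L 'x)) \<Rightarrow> bool" where
  "relative_Dini j \<tau> \<nu> A \<longleftrightarrow>
    (\<exists>\<eta> \<omega>. \<eta> \<ge> 0 \<and> continuous_on {0..\<tau>} \<omega> \<and> (\<forall>t\<in>{0..\<tau>}. \<omega> t \<ge> 0) \<and> \<omega> 0 = 0 \<and>
      integrable (lebesgue_on {0..\<tau>}) (\<lambda>t. (\<omega> t / t) powr \<nu>) \<and>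
      (\<forall>x. \<forall>s\<in>{0..\<tau>}. \<forall>t\<in>{0..\<tau>}.
        norm (A t x - A s x) \<le> \<omega> \<bar>t - s\<bar> * norm x + \<eta> * norm (j x)))"

definition evolution_family ::
    "real \<Rightarrow> (real \<Rightarrow> real \<Rightarrow> ('x::banach \<Rightarrow>\<^sub>L 'x)) \<Rightarrow> bool" where
  "evolution_family \<tau> U \<longleftrightarrow>
    (\<forall>s\<in>{0..\<tau>}. U s s = id_blinfun) \<and>
    (\<forall>s r t. 0 \<le> s \<and> s \<le> r \<and> r \<le> t \<and> t \<le> \<tau> \<longrightarrow> U t s = U t r o\<^sub>L U r s) \<and>
    (\<forall>x. continuous_on {(t, s). 0 \<le> s \<and> s \<le> t \<and> t \<le> \<tau>} (\<lambda>(t, s). U t s x))"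

definition solves_homogeneous ::
    "('d::banach \<Rightarrow>\<^sub>L 'x::banach) \<Rightarrow> real \<Rightarrow> real \<Rightarrow> (real \<Rightarrow> ('d \<Rightarrow>\<^sub>L 'x)) \<Rightarrow>
      (real \<Rightarrow> real \<Rightarrow> ('x \<Rightarrow>\<^sub>L 'x)) \<Rightarrow> bool" where
  "solves_homogeneous j \<tau> p A U \<longleftrightarrow>
    (\<forall>s\<in>{0..<\<tau>}. \<forall>x\<in>trace_space j p s \<tau>.
      unique_cauchy_solution j p s \<tau> A (\<lambda>_. 0) x (\<lambda>t. U t s x))"

text \<open>The evolution family associated with \<open>A(\<cdot>)\<close> (all exponents), and the one associated with
  the perturbed function (exponents up to \<mu> only). Each is determined uniquely on
  \<open>0 \<le> s \<le> t \<le> \<tau>\<close> by the respective predicate.\<close>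

definition associated_evolution_family ::
    "('d::banach \<Rightarrow>\<^sub>L 'x::banach) \<Rightarrow> real \<Rightarrow> (real \<Rightarrow> ('d \<Rightarrow>\<^sub>L 'x)) \<Rightarrow>
      (real \<Rightarrow> real \<Rightarrow> ('x \<Rightarrow>\<^sub>L 'x)) \<Rightarrow> bool" where
  "associated_evolution_family j \<tau> A U \<longleftrightarrow>
    evolution_family \<tau> U \<and> bounded {U t s | s t. 0 \<le> s \<and> s \<le> t \<and> t \<le> \<tau>} \<and>
    (\<forall>p>1. solves_homogeneous j \<tau> p A U)"

definition associated_evolution_family_upto ::
    "('d::banach \<Rightarrow>\<^sub>L 'x::banach) \<Rightarrow> real \<Rightarrow> real \<Rightarrow> (real \<Rightarrow> ('d \<Rightarrow>\<^sub>L 'x)) \<Rightarrow>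
      (real \<Rightarrow> real \<Rightarrow> ('x \<Rightarrow>\<^sub>L 'x)) \<Rightarrow> bool" where
  "associated_evolution_family_upto j \<tau> \<mu> B V \<longleftrightarrow>
    evolution_family \<tau> V \<and> (\<forall>q\<in>{1<..\<mu>}. solves_homogeneous j \<tau> q B V)"

text \<open>Here U is the evolution family associated with the operator function in question.\<close>

definition admissible_ops ::
    "('d::banach \<Rightarrow>\<^sub>L 'x::banach) \<Rightarrow> real \<Rightarrow> real \<Rightarrow> (real \<Rightarrow> real \<Rightarrow> ('x \<Rightarrow>\<^sub>L 'x)) \<Rightarrow>
      ('d \<Rightarrow>\<^sub>L 'y::banach) set" where
  "admissible_ops j \<tau> \<theta> U =
    {C :: 'd \<Rightarrow>\<^sub>L 'y. \<exists>\<gamma> \<alpha>. \<gamma> > 0 \<and> \<alpha> > 0 \<and>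
      (\<forall>s\<in>{0..<\<tau>}. \<forall>x.
        integrable (lebesgue_on {s..min (s + \<alpha>) \<tau>})
          (\<lambda>t. norm (C (inv (blinfun_apply j) (U t s (j x)))) powr \<theta>) \<and>
        (integral\<^sup>L (lebesgue_on {s..min (s + \<alpha>) \<tau>})
          (\<lambda>t. norm (C (inv (blinfun_apply j) (U t s (j x)))) powr \<theta>)) powr (1 / \<theta>)
          \<le> \<gamma> * norm (j x))}"

end

theory Submission
  imports Defs
begin

text \<open>
  Write \<open>u\<close> and \<open>v\<close> for the orbits \<open>U(\<cdot>,s)x\<close> and \<open>V(\<cdot>,s)x\<close> of some \<open>x \<in> D\<close>, regarded as
  D-valued functions. The two admissibility conditions bound \<open>C u\<close> and \<open>C v\<close> in \<open>L\<^sup>\<theta>(s,b;Y)\<close> by a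
  multiple of the norm of \<open>x\<close> in X, where \<open>b - s\<close> may be taken as small as we please, uniformly in \<open>s\<close>. As C is
  bounded on D, they are equivalent as soon as the norm of \<open>v - u\<close> in \<open>L\<^sup>\<theta>(s,b;D)\<close> is bounded by a
  multiple of the norm of \<open>x\<close> in X (\<open>admissible_ops_subset\<close>). This is what is proved. The difference
  \<open>w = v - u\<close> vanishes at \<open>s\<close> and solves \<open>w' + A(t) w = - P(t) v\<close>. Two facts about functions w with
  \<open>w(s) = 0\<close> and \<open>f = w' + A(t) w\<close> give the bound, both on intervals \<open>[s,b]\<close> of a uniformly small
  length and with the norms of \<open>L\<^sup>\<theta>(s,b)\<close>:

  \<^item> \<open>\<parallel>w\<parallel>\<^sub>D \<le> M \<parallel>f\<parallel>\<close> (\<open>uniform_regularity_bound\<close>);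
  \<^item> \<open>\<parallel>P w\<parallel> \<le> 1/2 \<parallel>f\<parallel>\<close> (\<open>observation_half_bound\<close>).

  Indeed, the second one with \<open>f = - P v\<close> yields \<open>\<parallel>P v\<parallel> \<le> \<parallel>P u\<parallel> + 1/2 \<parallel>P v\<parallel>\<close>, so \<open>\<parallel>P v\<parallel> \<le> 2 \<parallel>P u\<parallel>\<close>,
  which is at most a multiple of the norm of \<open>x\<close> by the hypothesis on P, and then the first one
  bounds w. Nothing is lost in passing from the exponent \<open>\<mu>\<close> to \<open>\<theta>\<close>, as the intervals are bounded.

  The first fact is maximal regularity, made quantitative and uniform. For a single operator the
  existence of solutions for all right-hand sides already implies the bound on short intervals
  (\<open>autonomous_regularity_bound\<close>): otherwise there are bad right-hand sides on arbitrarily short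
  intervals, and by causality one can add up infinitely many of them on consecutive intervals to a right-hand
  side in \<open>L\<^sup>p\<close> whose solution is not in \<open>L\<^sup>p(D)\<close>. The relative Dini condition makes \<open>A(t)\<close>, up to
  a term that is bounded on X, a small perturbation of \<open>A(t\<^sub>0)\<close> near \<open>t\<^sub>0\<close>, and compactness of \<open>[0,\<tau>]\<close> makes the constants uniform.

  The second fact is a discrete form of the variation of constants formula. On a fine grid
  \<open>r\<^sub>0 < r\<^sub>1 < \<dots>\<close> the function w is the sum of the orbits \<open>U(\<cdot>,r\<^sub>k\<^sub>+\<^sub>1)d\<^sub>k\<close>, where \<open>d\<^sub>k\<close> is what the
  right-hand side creates during \<open>[r\<^sub>k,r\<^sub>k\<^sub>+\<^sub>1]\<close>, and of a remainder that starts from zero on each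
  grid interval. The hypothesis on P estimates the orbits by the sum of the \<open>\<parallel>d\<^sub>k\<parallel>\<close>, hence by a
  small multiple of \<open>\<parallel>f\<parallel>\<close>; the remainder tends to zero in \<open>L\<^sup>\<theta>(D)\<close> as the grid is refined, because f can
  be approximated by simple functions with values in D
  (\<open>observation_of_inhomogeneous_solution\<close>).

  As X and D need not be separable, strong measurability and the \<open>L\<^sup>p\<close> estimates are
  developed for functions with values in arbitrary normed spaces.
\<close>

section \<open>Strongly measurable functions\<close>

lemma lebesgue_on_complete:
  assumes "S \<in> sets lebesgue"
  shows "complete_measure (lebesgue_on S)"
proof
  fix A B assume "B \<subseteq> A" "A \<in> null_sets (lebesgue_on S)"
  then show "B \<in> sets (lebesgue_on S)"
    using assms by (metis completion.complete2 null_setsD2 null_sets_restrict_space order_trans)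
qed

lemma borel_measurable_AE_eq:
  fixes f g :: "'a \<Rightarrow> 'b::topological_space"
  assumes M: "complete_measure M" and f: "f \<in> borel_measurable M" and eq: "AE t in M. f t = g t"
  shows "g \<in> borel_measurable M"
proof (rule measurableI)
  fix A :: "'b set" assume A: "A \<in> sets borel"
  show "g -` A \<inter> space M \<in> sets M"
  proof (rule complete_measure.in_sets_AE[OF M])
    show "AE t in M. t \<in> f -` A \<inter> space M \<longleftrightarrow> t \<in> g -` A \<inter> space M"
      using eq by eventually_elim auto
    show "f -` A \<inter> space M \<in> sets M" using f A by (rule measurable_sets)
  qed auto
qed auto

lemma borel_measurable_AE_LIMSEQ:
  fixes f :: "nat \<Rightarrow> 'a \<Rightarrow> 'b::metric_space"
  assumes M: "complete_measure M" and f: "\<And>n. f n \<in> borel_measurable M"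
    and lim: "AE t in M. (\<lambda>n. f n t) \<longlonglongrightarrow> g t"
  shows "g \<in> borel_measurable M"
proof -
  obtain N where N: "{t \<in> space M. \<not> (\<lambda>n. f n t) \<longlonglongrightarrow> g t} \<subseteq> N" "N \<in> null_sets M"
    using lim by (auto simp: eventually_ae_filter)
  have "(\<lambda>t. if t \<in> N then undefined else g t) \<in> borel_measurable M"
  proof (rule borel_measurable_LIMSEQ_metric)
    show "(\<lambda>t. if t \<in> N then undefined else f n t) \<in> borel_measurable M" for n
      using N(2) f by (intro measurable_If_set) auto
    show "(\<lambda>n. if t \<in> N then undefined else f n t) \<longlonglongrightarrow> (if t \<in> N then undefined else g t)" if "t \<in> space M" for t
      using that N(1) by auto
  qed
  moreover have "AE t in M. (if t \<in> N then undefined else g t) = g t"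
    using AE_not_in[OF N(2)] by eventually_elim auto
  ultimately show ?thesis by (rule borel_measurable_AE_eq[OF M])
qed

lemma strongly_measurable_simple: "simple_function M f \<Longrightarrow> strongly_measurable M f"
  unfolding strongly_measurable_def by (auto intro!: exI[of _ "\<lambda>_. f"])

lemma strongly_measurable_AE_cong:
  assumes "strongly_measurable M f" "AE t in M. f t = g t"
  shows "strongly_measurable M g"
proof -
  obtain s where s: "\<And>n. simple_function M (s n)" "AE t in M. (\<lambda>n. s n t) \<longlonglongrightarrow> f t"
    using assms(1) unfolding strongly_measurable_def by auto
  have "AE t in M. (\<lambda>n. s n t) \<longlonglongrightarrow> g t" using s(2) assms(2) by eventually_elim auto
  then show ?thesis using s(1) unfolding strongly_measurable_def by auto
qed

lemma strongly_measurable_compose2: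
  assumes f: "strongly_measurable M f" and g: "strongly_measurable M g"
    and H: "continuous_on UNIV (\<lambda>(x, y). H x y)"
  shows "strongly_measurable M (\<lambda>t. H (f t) (g t))"
proof -
  obtain r where r: "\<And>n. simple_function M (r n)" "AE t in M. (\<lambda>n. r n t) \<longlonglongrightarrow> f t"
    using f unfolding strongly_measurable_def by auto
  obtain s where s: "\<And>n. simple_function M (s n)" "AE t in M. (\<lambda>n. s n t) \<longlonglongrightarrow> g t"
    using g unfolding strongly_measurable_def by auto
  have "AE t in M. (\<lambda>n. H (r n t) (s n t)) \<longlonglongrightarrow> H (f t) (g t)"
    using r(2) s(2)
  proof eventually_elim
    fix t assume "(\<lambda>n. r n t) \<longlonglongrightarrow> f t" "(\<lambda>n. s n t) \<longlonglongrightarrow> g t"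
    then have "(\<lambda>n. (r n t, s n t)) \<longlonglongrightarrow> (f t, g t)" by (rule tendsto_Pair)
    then show "(\<lambda>n. H (r n t) (s n t)) \<longlonglongrightarrow> H (f t) (g t)"
      using continuous_on_tendsto_compose[OF H] by fastforce
  qed
  then show ?thesis unfolding strongly_measurable_def
    using simple_function_compose2[OF r(1) s(1), of H] by (intro exI[of _ "\<lambda>n t. H (r n t) (s n t)"]) auto
qed

lemma strongly_measurable_compose:
  assumes "strongly_measurable M f" "continuous_on UNIV H"
  shows "strongly_measurable M (\<lambda>t. H (f t))"
  by (rule strongly_measurable_compose2[OF assms(1,1), of "\<lambda>x y. H x"])
     (auto simp: case_prod_unfold intro!: continuous_on_compose2[OF assms(2)] continuous_intros)

lemma strongly_measurable_add:
  "strongly_measurable M f \<Longrightarrow> strongly_measurable M g \<Longrightarrow> strongly_measurable M (\<lambda>t. f t + g t)"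
  by (rule strongly_measurable_compose2) (auto simp: case_prod_unfold intro!: continuous_intros)

lemma strongly_measurable_diff:
  "strongly_measurable M f \<Longrightarrow> strongly_measurable M g \<Longrightarrow> strongly_measurable M (\<lambda>t. f t - g t)"
  by (rule strongly_measurable_compose2) (auto simp: case_prod_unfold intro!: continuous_intros)

lemma strongly_measurable_scaleR:
  "strongly_measurable M f \<Longrightarrow> strongly_measurable M g \<Longrightarrow> strongly_measurable M (\<lambda>t. f t *\<^sub>R g t)"
  by (rule strongly_measurable_compose2) (auto simp: case_prod_unfold intro!: continuous_intros)

lemma strongly_measurable_const: "strongly_measurable M (\<lambda>_. c)"
  by (rule strongly_measurable_simple) simp

lemma strongly_measurable_sum:
  "(\<And>i. i \<in> I \<Longrightarrow> strongly_measurable M (f i)) \<Longrightarrow> strongly_measurable M (\<lambda>t. \<Sum>i\<in>I. f i t)"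
  by (induction I rule: infinite_finite_induct)
     (auto intro: strongly_measurable_const strongly_measurable_add)

lemma strongly_measurable_blinfun:
  "strongly_measurable M f \<Longrightarrow> strongly_measurable M (\<lambda>t. blinfun_apply T (f t))"
  by (erule strongly_measurable_compose) (intro continuous_intros)

lemma strongly_measurable_imp_borel:
  fixes f :: "'a \<Rightarrow> 'b::real_normed_vector" and \<phi> :: "'b \<Rightarrow> real"
  assumes M: "complete_measure M" and f: "strongly_measurable M f" and \<phi>: "continuous_on UNIV \<phi>"
  shows "(\<lambda>t. \<phi> (f t)) \<in> borel_measurable M"
proof -
  obtain s where s0: "\<And>n. simple_function M (s n)" "AE t in M. (\<lambda>n. s n t) \<longlonglongrightarrow> f t"
    using f unfolding strongly_measurable_def by auto
  have s: "AE t in M. (\<lambda>n. \<phi> (s n t)) \<longlonglongrightarrow> \<phi> (f t)"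
    using s0(2) by eventually_elim (rule continuous_on_tendsto_compose[OF \<phi>], auto)
  show ?thesis
  proof (rule borel_measurable_AE_LIMSEQ[OF M _ s])
    show "(\<lambda>t. \<phi> (s n t)) \<in> borel_measurable M" for n
      by (rule borel_measurable_simple_function[OF simple_function_compose1[OF s0(1)]])
  qed
qed

text \<open>The n-th approximant takes the value among \<open>d 0, \<dots>, d n\<close> that is nearest to \<open>f t\<close>. Together with
  \<open>strongly_measurable_AE_separable\<close> this is the part of Pettis' theorem that is needed to pass to limits.\<close>

lemma strongly_measurable_if_separably_valued:
  fixes d :: "nat \<Rightarrow> 'b::real_normed_vector"
  assumes meas: "\<And>i. (\<lambda>t. norm (f t - d i)) \<in> borel_measurable M"
    and sep: "AE t in M. f t \<in> closure (range d)"
  shows "strongly_measurable M f"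
proof -
  define best where "best n t i \<longleftrightarrow> i \<le> n \<and> (\<forall>k\<in>{..n}. norm (f t - d i) \<le> norm (f t - d k))" for n t and i::nat
  define \<kappa> where "\<kappa> n t = (LEAST i. best n t i)" for n t
  have ex: "\<exists>i. best n t i" for n t
  proof -
    have "Min ((\<lambda>i. norm (f t - d i)) ` {..n}) \<in> (\<lambda>i. norm (f t - d i)) ` {..n}"
      by (rule Min_in) auto
    then obtain i where i: "i \<le> n" "norm (f t - d i) = Min ((\<lambda>i. norm (f t - d i)) ` {..n})" by fastforce
    have "norm (f t - d i) \<le> norm (f t - d k)" if "k \<le> n" for k
      unfolding i(2) by (rule Min_le) (use that in auto)
    with i(1) show ?thesis unfolding best_def by auto
  qed
  have \<kappa>: "best n t (\<kappa> n t)" for n t unfolding \<kappa>_def using ex by (rule LeastI_ex)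
  have "\<kappa> n \<in> measurable M (count_space UNIV)" for n
    unfolding \<kappa>_def best_def
    by (rule measurable_Least) (use meas in \<open>measurable\<close>)
  moreover have "finite (\<kappa> n ` space M)" for n
    by (rule finite_subset[of _ "{..n}"]) (use \<kappa> in \<open>auto simp: best_def\<close>)
  ultimately have "simple_function M (\<kappa> n)" for n
    by (simp add: simple_function_eq_measurable)
  then have "simple_function M (\<lambda>t. d (\<kappa> n t))" for n by (rule simple_function_compose1)
  moreover have "AE t in M. (\<lambda>n. d (\<kappa> n t)) \<longlonglongrightarrow> f t"
    using sep
  proof eventually_elim
    fix t assume t: "f t \<in> closure (range d)"
    show "(\<lambda>n. d (\<kappa> n t)) \<longlonglongrightarrow> f t"
    proof (rule LIMSEQ_I)
      fix e :: real assume "e > 0"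
      then obtain i where i: "norm (f t - d i) < e"
        using t unfolding closure_approachable by (auto simp: dist_norm norm_minus_commute)
      have "norm (d (\<kappa> n t) - f t) < e" if "n \<ge> i" for n
        using \<kappa>[of n t] i that unfolding best_def by (auto simp: norm_minus_commute intro: le_less_trans)
      then show "\<exists>no. \<forall>n\<ge>no. norm (d (\<kappa> n t) - f t) < e" by blast
    qed
  qed
  ultimately show ?thesis unfolding strongly_measurable_def by (intro exI[of _ "\<lambda>n t. d (\<kappa> n t)"]) auto
qed

lemma strongly_measurable_AE_separable:
  assumes "strongly_measurable M f"
  obtains D where "countable D" "AE t in M. f t \<in> closure D"
proof -
  obtain s where s: "\<And>n. simple_function M (s n)" "AE t in M. (\<lambda>n. s n t) \<longlonglongrightarrow> f t"
    using assms unfolding strongly_measurable_def by auto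
  define D where "D = (\<Union>n. s n ` space M)"
  have "countable D" unfolding D_def
    using simple_functionD(1)[OF s(1)] by (auto intro: countable_finite)
  moreover have "AE t in M. f t \<in> closure D"
    using s(2) AE_space
  proof eventually_elim
    fix t assume t: "(\<lambda>n. s n t) \<longlonglongrightarrow> f t" "t \<in> space M"
    then show "f t \<in> closure D" unfolding closure_sequential D_def
      by (intro exI[of _ "\<lambda>n. s n t"]) auto
  qed
  ultimately show thesis by (rule that)
qed

text \<open>Separability of the values and measurability of the distances to given points both survive pointwise
  limits, which takes the place of a diagonal argument with simple functions.\<close>

lemma strongly_measurable_LIMSEQ:
  fixes f :: "nat \<Rightarrow> 'a \<Rightarrow> 'b::real_normed_vector"
  assumes M: "complete_measure M" and f: "\<And>n. strongly_measurable M (f n)"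
    and lim: "AE t in M. (\<lambda>n. f n t) \<longlonglongrightarrow> g t"
  shows "strongly_measurable M g"
proof -
  have "\<exists>D. countable D \<and> (AE t in M. f n t \<in> closure D)" for n
    using strongly_measurable_AE_separable[OF f[of n]] by metis
  then obtain D where D: "\<And>n. countable (D n)" "\<And>n. AE t in M. f n t \<in> closure (D n)" by metis
  define E where "E = insert 0 (\<Union>n. D n)"
  have "countable E" "E \<noteq> {}" unfolding E_def using D(1) by auto
  then have d: "range (from_nat_into E) = E" by (simp add: range_from_nat_into)
  show ?thesis
  proof (rule strongly_measurable_if_separably_valued[where d = "from_nat_into E"])
    show "(\<lambda>t. norm (g t - from_nat_into E i)) \<in> borel_measurable M" for i
    proof (rule borel_measurable_AE_LIMSEQ[OF M])
      show "(\<lambda>t. norm (f n t - from_nat_into E i)) \<in> borel_measurable M" for n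
        by (rule strongly_measurable_imp_borel[OF M f]) (intro continuous_intros)
      show "AE t in M. (\<lambda>n. norm (f n t - from_nat_into E i)) \<longlonglongrightarrow> norm (g t - from_nat_into E i)"
        using lim by eventually_elim (intro tendsto_intros)
    qed
    have "AE t in M. \<forall>n. f n t \<in> closure (D n)" using D(2) by (simp add: AE_all_countable)
    then show "AE t in M. g t \<in> closure (range (from_nat_into E))"
      using lim
    proof eventually_elim
      fix t assume t: "\<forall>n. f n t \<in> closure (D n)" "(\<lambda>n. f n t) \<longlonglongrightarrow> g t"
      have "f n t \<in> closure E" for n
        using t(1) closure_mono[of "D n" E] unfolding E_def by auto
      then show "g t \<in> closure (range (from_nat_into E))"
        unfolding d using t(2) by (intro Lim_in_closed_set[OF closed_closure]) auto
    qed
  qed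
qed

text \<open>Extension by zero reduces restriction to subintervals, gluing and translation to
  statements about the whole line.\<close>

lemma strongly_measurable_lebesgue_on:
  assumes "S \<in> sets lebesgue"
  shows "strongly_measurable (lebesgue_on S) f \<longleftrightarrow> strongly_measurable lebesgue (\<lambda>t. indicator S t *\<^sub>R f t)"
proof
  assume "strongly_measurable (lebesgue_on S) f"
  then obtain s where s: "\<And>n. simple_function (lebesgue_on S) (s n)"
      "AE t in lebesgue_on S. (\<lambda>n. s n t) \<longlonglongrightarrow> f t"
    unfolding strongly_measurable_def by auto
  have "AE t in lebesgue. t \<in> S \<longrightarrow> (\<lambda>n. s n t) \<longlonglongrightarrow> f t"
    using s(2) assms by (simp add: AE_restrict_space_iff)
  then have "AE t in lebesgue. (\<lambda>n. indicator S t *\<^sub>R s n t) \<longlonglongrightarrow> indicator S t *\<^sub>R f t"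
    by eventually_elim (auto simp: indicator_def)
  moreover have "simple_function lebesgue (\<lambda>t. indicator S t *\<^sub>R s n t)" for n
    using s(1) simple_function_restrict_space[of S lebesgue "s n"] assms by auto
  ultimately show "strongly_measurable lebesgue (\<lambda>t. indicator S t *\<^sub>R f t)"
    unfolding strongly_measurable_def by (intro exI[of _ "\<lambda>n t. indicator S t *\<^sub>R s n t"]) auto
next
  assume "strongly_measurable lebesgue (\<lambda>t. indicator S t *\<^sub>R f t)"
  then obtain s where s: "\<And>n. simple_function lebesgue (s n)"
      "AE t in lebesgue. (\<lambda>n. s n t) \<longlonglongrightarrow> indicator S t *\<^sub>R f t"
    unfolding strongly_measurable_def by auto
  have "AE t in lebesgue. t \<in> S \<longrightarrow> (\<lambda>n. s n t) \<longlonglongrightarrow> f t"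
    using s(2) by eventually_elim auto
  then have "AE t in lebesgue_on S. (\<lambda>n. s n t) \<longlonglongrightarrow> f t"
    using assms by (simp add: AE_restrict_space_iff)
  moreover have "simple_function (lebesgue_on S) (s n)" for n
  proof -
    have "simple_function lebesgue (\<lambda>t. indicator S t *\<^sub>R s n t)"
      by (rule simple_function_compose2[OF simple_function_indicator s(1)]) (use assms in auto)
    then show ?thesis using simple_function_restrict_space[of S lebesgue "s n"] assms by auto
  qed
  ultimately show "strongly_measurable (lebesgue_on S) f" unfolding strongly_measurable_def by auto
qed

lemma AE_lebesgue_on_subset:
  assumes "AE t in lebesgue_on S. Q t" "T \<subseteq> S" "S \<in> sets lebesgue" "T \<in> sets lebesgue"
  shows "AE t in lebesgue_on T. Q t"
proof -
  have "AE t in lebesgue. t \<in> S \<longrightarrow> Q t" using assms by (simp add: AE_restrict_space_iff)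
  then have "AE t in lebesgue. t \<in> T \<longrightarrow> Q t" by eventually_elim (use assms in auto)
  then show ?thesis using assms by (simp add: AE_restrict_space_iff)
qed

lemma strongly_measurable_indicator:
  assumes "strongly_measurable lebesgue f" "S \<in> sets lebesgue"
  shows "strongly_measurable lebesgue (\<lambda>t. indicator S t *\<^sub>R f t)"
proof (rule strongly_measurable_scaleR[OF _ assms(1)])
  show "strongly_measurable lebesgue (indicator S :: _ \<Rightarrow> real)"
    by (rule strongly_measurable_simple) (use assms(2) in auto)
qed

lemma strongly_measurable_subset:
  assumes "strongly_measurable (lebesgue_on S) f" "T \<subseteq> S" "S \<in> sets lebesgue" "T \<in> sets lebesgue"
  shows "strongly_measurable (lebesgue_on T) f"
proof -
  have "(\<lambda>t. indicator T t *\<^sub>R (indicator S t *\<^sub>R f t)) = (\<lambda>t. indicator T t *\<^sub>R f t)"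
    using assms(2) by (auto simp: indicator_def fun_eq_iff)
  then show ?thesis
    using strongly_measurable_indicator[of "\<lambda>t. indicator S t *\<^sub>R f t" T] assms
    by (simp add: strongly_measurable_lebesgue_on)
qed

lemma strongly_measurable_shift:
  fixes f :: "real \<Rightarrow> 'b::real_normed_vector"
  assumes "strongly_measurable lebesgue f"
  shows "strongly_measurable lebesgue (\<lambda>t. f (t + d))"
proof -
  obtain s where s: "\<And>n. simple_function lebesgue (s n)" "AE t in lebesgue. (\<lambda>n. s n t) \<longlonglongrightarrow> f t"
    using assms unfolding strongly_measurable_def by auto
  have shift: "(\<lambda>t::real. t + d) \<in> measurable lebesgue lebesgue"
    using lebesgue_measurable_scaling[of 1] lebesgue_affine_measurable[of "\<lambda>_. 1" d] by (simp add: add.commute)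
  have dist: "lebesgue = distr lebesgue lebesgue (\<lambda>t::real. t + d)"
    using lebesgue_affine_euclidean[of "\<lambda>_. 1::real" d] by (simp add: add.commute density_1)
  have "AE t in lebesgue. (\<lambda>n. s n (t + d)) \<longlonglongrightarrow> f (t + d)"
    using s(2) by (subst (asm) dist) (rule AE_distrD[OF shift])
  moreover have "simple_function lebesgue (\<lambda>t. s n (t + d))" for n
    using simple_function_comp[OF shift s(1)] .
  ultimately show ?thesis
    unfolding strongly_measurable_def by (intro exI[of _ "\<lambda>n t. s n (t + d)"]) auto
qed

text \<open>For simple v this is a finite sum of orbits \<open>A(\<cdot>)y\<close> times indicators, and each \<open>A t\<close> is
  continuous.\<close>

lemma strongly_measurable_operator_apply:
  assumes S: "S \<in> sets lebesgue" and T: "T \<in> sets lebesgue" "T \<subseteq> S"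
    and A: "\<And>x. strongly_measurable (lebesgue_on S) (\<lambda>t. blinfun_apply (A t) x)"
    and v: "strongly_measurable (lebesgue_on T) v"
  shows "strongly_measurable (lebesgue_on T) (\<lambda>t. blinfun_apply (A t) (v t))"
proof -
  let ?M = "lebesgue_on T"
  obtain s where s: "\<And>n. simple_function ?M (s n)" "AE t in ?M. (\<lambda>n. s n t) \<longlonglongrightarrow> v t"
    using v unfolding strongly_measurable_def by auto
  have AT: "strongly_measurable ?M (\<lambda>t. A t x)" for x
    using strongly_measurable_subset[OF A T(2) S T(1)] .
  show ?thesis
  proof (rule strongly_measurable_LIMSEQ[OF lebesgue_on_complete[OF T(1)]])
    show "AE t in ?M. (\<lambda>n. A t (s n t)) \<longlonglongrightarrow> A t (v t)"
      using s(2) by eventually_elim (intro tendsto_intros)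
    fix n
    let ?R = "s n ` space ?M"
    have "strongly_measurable ?M (\<lambda>t. \<Sum>y\<in>?R. indicator (s n -` {y} \<inter> space ?M) t *\<^sub>R A t y)"
    proof (intro strongly_measurable_sum strongly_measurable_scaleR AT)
      show "strongly_measurable ?M (indicator (s n -` {y} \<inter> space ?M) :: _ \<Rightarrow> real)" for y
        by (rule strongly_measurable_simple, rule simple_function_indicator)
           (use simple_functionD(2)[OF s(1)] in auto)
    qed
    moreover have "(\<Sum>y\<in>?R. indicator (s n -` {y} \<inter> space ?M) t *\<^sub>R A t y) = A t (s n t)"
      if "t \<in> space ?M" for t
    proof -
      have "(\<Sum>y\<in>?R. indicator (s n -` {y} \<inter> space ?M) t *\<^sub>R A t y) = (\<Sum>y\<in>?R. if y = s n t then A t y else 0)"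
        using that by (intro sum.cong) (auto simp: indicator_def)
      also have "\<dots> = A t (s n t)" using that simple_functionD(1)[OF s(1)] by (subst sum.delta) auto
      finally show ?thesis .
    qed
    ultimately show "strongly_measurable ?M (\<lambda>t. A t (s n t))"
      by (elim strongly_measurable_AE_cong) (auto intro!: AE_I2)
  qed
qed

section \<open>\<open>L\<^sup>p\<close> norms of vector-valued functions\<close>

text \<open>The p-th power of the \<open>L\<^sup>p\<close> norm; unlike the norm itself it is additive over intervals.\<close>

definition Lp_mass :: "real \<Rightarrow> real \<Rightarrow> real \<Rightarrow> (real \<Rightarrow> 'b::real_normed_vector) \<Rightarrow> real" where
  "Lp_mass p a b f = integral {a..b} (\<lambda>t. norm (f t) powr p)"

definition Lp_norm :: "real \<Rightarrow> real \<Rightarrow> real \<Rightarrow> (real \<Rightarrow> 'b::real_normed_vector) \<Rightarrow> real" where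
  "Lp_norm p a b f = Lp_mass p a b f powr (1 / p)"

lemma integrable_lebesgue_on_iff_nonneg:
  fixes f :: "real \<Rightarrow> real"
  assumes "\<And>t. f t \<ge> 0"
  shows "integrable (lebesgue_on {a..b}) f \<longleftrightarrow> f integrable_on {a..b}"
  using integrable_on_lebesgue_on[of "{a..b}" f] nonnegative_absolutely_integrable_1[where f = f and A = "{a..b}"]
    absolutely_integrable_imp_integrable[where f = f and S = "{a..b}"] assms by auto

lemma Lp_fun_iff:
  "Lp_fun p a b f \<longleftrightarrow> strongly_measurable (lebesgue_on {a..b}) f \<and>
    (\<lambda>t. norm (f t) powr p) integrable_on {a..b}"
  unfolding Lp_fun_def by (subst integrable_lebesgue_on_iff_nonneg) auto

lemma Lp_fun_sm: "Lp_fun p a b f \<Longrightarrow> strongly_measurable (lebesgue_on {a..b}) f"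
  by (simp add: Lp_fun_def)

lemma Lp_mass_lebesgue:
  "Lp_fun p a b f \<Longrightarrow> Lp_mass p a b f = integral\<^sup>L (lebesgue_on {a..b}) (\<lambda>t. norm (f t) powr p)"
  unfolding Lp_mass_def Lp_fun_def by (simp add: lebesgue_integral_eq_integral)

lemma Lp_mass_nonneg [simp]: "Lp_mass p a b f \<ge> 0"
  unfolding Lp_mass_def by (cases "(\<lambda>t. norm (f t) powr p) integrable_on {a..b}")
    (auto intro: integral_nonneg simp: not_integrable_integral)

lemma Lp_norm_nonneg [simp]: "Lp_norm p a b f \<ge> 0"
  by (simp add: Lp_norm_def)

lemma Lp_norm_powr: "p > 0 \<Longrightarrow> Lp_norm p a b f powr p = Lp_mass p a b f"
  by (simp add: Lp_norm_def powr_powr)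

lemma Lp_norm_le_iff: "p > 0 \<Longrightarrow> K \<ge> 0 \<Longrightarrow> Lp_norm p a b f \<le> K \<longleftrightarrow> Lp_mass p a b f \<le> K powr p"
  using powr_mono2[of p "Lp_norm p a b f" K] powr_mono2[of "1/p" "Lp_mass p a b f" "K powr p"]
  by (auto simp: Lp_norm_powr powr_powr) (simp add: Lp_norm_def)

lemma sm_norm_powr_measurable:
  fixes f :: "real \<Rightarrow> 'b::real_normed_vector"
  assumes "strongly_measurable (lebesgue_on {a..b}) f" "p > 0"
  shows "(\<lambda>t. norm (f t) powr p) \<in> borel_measurable (lebesgue_on {a..b})"
proof -
  have "(\<lambda>t. norm (f t)) \<in> borel_measurable (lebesgue_on {a..b})"
    by (rule strongly_measurable_imp_borel[OF lebesgue_on_complete assms(1)])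
       (auto intro!: continuous_intros)
  then show ?thesis by measurable
qed

lemma Lp_fun_dominated:
  assumes "p > 0" and h: "strongly_measurable (lebesgue_on {a..b}) h"
    and \<phi>: "integrable (lebesgue_on {a..b}) \<phi>"
    and le: "AE t in lebesgue_on {a..b}. norm (h t) powr p \<le> \<phi> t"
  shows "Lp_fun p a b h" "Lp_mass p a b h \<le> integral {a..b} \<phi>"
proof -
  have int: "integrable (lebesgue_on {a..b}) (\<lambda>t. norm (h t) powr p)"
    by (rule Bochner_Integration.integrable_bound[OF \<phi> sm_norm_powr_measurable[OF h \<open>p > 0\<close>]])
       (use le in \<open>eventually_elim, auto\<close>)
  then show Lp: "Lp_fun p a b h" using h by (simp add: Lp_fun_def)
  show "Lp_mass p a b h \<le> integral {a..b} \<phi>"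
    unfolding Lp_mass_lebesgue[OF Lp] using integral_mono_AE[OF int \<phi> le] \<phi>
    by (simp add: lebesgue_integral_eq_integral)
qed

lemma convex_powr_le:
  fixes u v s p :: real
  assumes "p \<ge> 1" "u \<ge> 0" "v \<ge> 0" "0 < s" "s < 1"
  shows "(s * u + (1 - s) * v) powr p \<le> s * u powr p + (1 - s) * v powr p"
proof -
  have small: "(r * w) powr p \<le> r * w powr p" if "0 < r" "r < 1" for r w :: real
  proof -
    have "r powr p \<le> r powr 1" by (rule powr_mono') (use that assms in auto)
    then show ?thesis using that by (simp add: powr_mult mult_right_mono)
  qed
  show ?thesis
  proof (cases "u = 0 \<or> v = 0")
    case True
    then show ?thesis using small[of s u] small[of "1 - s" v] assms by auto
  next
    case False
    then show ?thesis
      using convex_onD[OF powr_convex[OF assms(1)], of s v u] assms by (simp add: algebra_simps)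
  qed
qed

text \<open>Convexity of the power with weights proportional to \<open>c\<close> and \<open>d\<close>. When these numbers bound the norms of
  two functions, integrating the inequality gives Minkowski's inequality.\<close>

lemma add_powr_le:
  fixes x y c d p :: real
  assumes "p \<ge> 1" "x \<ge> 0" "y \<ge> 0" "c > 0" "d > 0"
  shows "(x + y) powr p \<le> (c + d) powr p * (c / (c + d) * (x / c) powr p + d / (c + d) * (y / d) powr p)"
proof -
  have "(x + y) powr p = (c + d) powr p * ((x + y) / (c + d)) powr p"
    using assms by (simp add: powr_divide)
  also have "(x + y) / (c + d) = c / (c + d) * (x / c) + (1 - c / (c + d)) * (y / d)"
  proof -
    have "1 - c / (c + d) = d / (c + d)" using assms by (simp add: field_simps)
    then show ?thesis using assms by (simp add: add_divide_distrib)
  qed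
  also have "\<dots> powr p \<le> c / (c + d) * (x / c) powr p + (1 - c / (c + d)) * (y / d) powr p"
    by (rule convex_powr_le) (use assms in \<open>auto simp: field_simps\<close>)
  also have "1 - c / (c + d) = d / (c + d)" using assms by (simp add: field_simps)
  finally show ?thesis by (simp add: mult_left_mono)
qed

text \<open>Minkowski's inequality in a form that allows three different value spaces, so that it covers sums,
  operators applied to functions, and domination alike.\<close>

lemma Lp_fun_triangle:
  fixes f :: "real \<Rightarrow> 'b::real_normed_vector" and g :: "real \<Rightarrow> 'c::real_normed_vector"
    and h :: "real \<Rightarrow> 'e::real_normed_vector"
  assumes p: "p \<ge> 1" and h: "strongly_measurable (lebesgue_on {a..b}) h"
    and f: "Lp_fun p a b f" and g: "Lp_fun p a b g"
    and le: "AE t in lebesgue_on {a..b}. norm (h t) \<le> norm (f t) + norm (g t)"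
  shows "Lp_fun p a b h" "Lp_norm p a b h \<le> Lp_norm p a b f + Lp_norm p a b g"
proof -
  have bound: "Lp_fun p a b h \<and> Lp_norm p a b h \<le> c + d"
    if c: "c > Lp_norm p a b f" and d: "d > Lp_norm p a b g" for c d
  proof -
    have cd: "c > 0" "d > 0" using c d Lp_norm_nonneg[of p a b f] Lp_norm_nonneg[of p a b g] by linarith+
    define \<phi> where "\<phi> t = (c + d) powr p * (c / (c + d) * (norm (f t) / c) powr p + d / (c + d) * (norm (g t) / d) powr p)" for t
    have \<phi>: "\<phi> t = (c + d) powr p * (c / (c + d) / c powr p * norm (f t) powr p + d / (c + d) / d powr p * norm (g t) powr p)" for t
      by (simp add: \<phi>_def powr_divide)
    have ff: "integrable (lebesgue_on {a..b}) (\<lambda>t. norm (f t) powr p)" and gg: "integrable (lebesgue_on {a..b}) (\<lambda>t. norm (g t) powr p)"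
      using f g by (auto simp: Lp_fun_def)
    have int: "integrable (lebesgue_on {a..b}) \<phi>"
      unfolding \<phi> by (intro integrable_mult_right Bochner_Integration.integrable_add ff gg)
    have le': "AE t in lebesgue_on {a..b}. norm (h t) powr p \<le> \<phi> t"
      using le
    proof eventually_elim
      fix t assume "norm (h t) \<le> norm (f t) + norm (g t)"
      then have "norm (h t) powr p \<le> (norm (f t) + norm (g t)) powr p" by (rule powr_mono2[rotated 2]) (use p in auto)
      also have "\<dots> \<le> \<phi> t" unfolding \<phi>_def by (rule add_powr_le) (use p cd in auto)
      finally show "norm (h t) powr p \<le> \<phi> t" .
    qed
    have "p > 0" using p by simp
    note dom = Lp_fun_dominated[OF \<open>p > 0\<close> h int le']
    have "integral {a..b} \<phi> = (c + d) powr p * (c / (c + d) / c powr p * Lp_mass p a b f + d / (c + d) / d powr p * Lp_mass p a b g)"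
      unfolding \<phi> using f g
      by (intro integral_unique has_integral_mult_right has_integral_add)
        (auto simp: Lp_mass_def Lp_fun_iff intro: integrable_integral)
    also have "\<dots> \<le> (c + d) powr p * (c / (c + d) / c powr p * c powr p + d / (c + d) / d powr p * d powr p)"
      using c d cd \<open>p > 0\<close> Lp_norm_le_iff[of p c a b f] Lp_norm_le_iff[of p d a b g]
      by (intro mult_left_mono add_mono) auto
    also have "\<dots> = (c + d) powr p" using cd by (simp add: add_divide_distrib[symmetric])
    finally have "Lp_mass p a b h \<le> (c + d) powr p" using dom(2) by linarith
    then show ?thesis using dom(1) Lp_norm_le_iff[of p "c + d" a b h] cd \<open>p > 0\<close> by auto
  qed
  show "Lp_fun p a b h" using bound[of "Lp_norm p a b f + 1" "Lp_norm p a b g + 1"] by auto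
  show "Lp_norm p a b h \<le> Lp_norm p a b f + Lp_norm p a b g"
  proof (rule field_le_epsilon)
    fix e :: real assume "e > 0"
    then show "Lp_norm p a b h \<le> Lp_norm p a b f + Lp_norm p a b g + e"
      using bound[of "Lp_norm p a b f + e / 2" "Lp_norm p a b g + e / 2"] by (auto simp: algebra_simps)
  qed
qed

lemma Lp_fun_zero: "Lp_fun p a b (\<lambda>_. 0)"
  using integrable_0[of "{a..b}"] by (simp add: Lp_fun_iff strongly_measurable_const)

lemma Lp_norm_zero: "Lp_norm p a b (\<lambda>_. 0) = 0"
  by (simp add: Lp_norm_def Lp_mass_def)

lemma Lp_fun_const: "Lp_fun p a b (\<lambda>_. c)"
  by (simp add: Lp_fun_iff strongly_measurable_const integrable_const_ivl)

lemma Lp_norm_const: "p > 0 \<Longrightarrow> a \<le> b \<Longrightarrow> Lp_norm p a b (\<lambda>_. c) = (b - a) powr (1 / p) * norm c"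
  by (simp add: Lp_norm_def Lp_mass_def powr_mult powr_powr)

lemma Lp_fun_scaleR:
  assumes "Lp_fun p a b f" shows "Lp_fun p a b (\<lambda>t. c *\<^sub>R f t)"
  using assms strongly_measurable_scaleR[OF strongly_measurable_const Lp_fun_sm[OF assms]]
  by (auto simp: Lp_fun_iff powr_mult intro: integrable_on_mult_right)

lemma Lp_norm_scaleR: "p > 0 \<Longrightarrow> Lp_norm p a b (\<lambda>t. c *\<^sub>R f t) = \<bar>c\<bar> * Lp_norm p a b f"
  by (simp add: Lp_norm_def Lp_mass_def powr_mult powr_powr)

lemma Lp_fun_le:
  assumes p: "p \<ge> 1" and h: "strongly_measurable (lebesgue_on {a..b}) h" and f: "Lp_fun p a b f" and "K \<ge> 0"
    and le: "AE t in lebesgue_on {a..b}. norm (h t) \<le> K * norm (f t)"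
  shows "Lp_fun p a b h" "Lp_norm p a b h \<le> K * Lp_norm p a b f"
proof -
  have *: "AE t in lebesgue_on {a..b}. norm (h t) \<le> norm (K *\<^sub>R f t) + norm (0::real)"
    using le \<open>K \<ge> 0\<close> by simp
  show "Lp_fun p a b h" "Lp_norm p a b h \<le> K * Lp_norm p a b f"
    using Lp_fun_triangle[OF p h Lp_fun_scaleR[OF f] Lp_fun_zero *] p \<open>K \<ge> 0\<close>
    by (auto simp: Lp_norm_zero Lp_norm_scaleR)
qed

lemma Lp_fun_bounded:
  assumes "p \<ge> 1" "strongly_measurable (lebesgue_on {a..b}) h" "K \<ge> 0" "a \<le> b"
    and "AE t in lebesgue_on {a..b}. norm (h t) \<le> K"
  shows "Lp_fun p a b h" "Lp_norm p a b h \<le> K * (b - a) powr (1 / p)"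
  using Lp_fun_le[OF assms(1,2) Lp_fun_const[of p a b "1::real"] assms(3)] assms
  by (auto simp: Lp_norm_const)

lemma Lp_norm_cong:
  assumes "p \<ge> 1" "Lp_fun p a b f" "strongly_measurable (lebesgue_on {a..b}) h"
    and "AE t in lebesgue_on {a..b}. norm (h t) = norm (f t)"
  shows "Lp_fun p a b h" "Lp_norm p a b h = Lp_norm p a b f"
proof -
  have eq: "AE t in lebesgue_on {a..b}. norm (h t) \<le> 1 * norm (f t)"
    "AE t in lebesgue_on {a..b}. norm (f t) \<le> 1 * norm (h t)"
    using assms(4) by (auto elim: eventually_mono)
  show h: "Lp_fun p a b h" using Lp_fun_le[OF assms(1,3,2) _ eq(1)] by simp
  show "Lp_norm p a b h = Lp_norm p a b f"
    using Lp_fun_le(2)[OF assms(1,3,2) _ eq(1)] Lp_fun_le(2)[OF assms(1) Lp_fun_sm[OF assms(2)] h _ eq(2)] by simp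
qed

lemma Lp_fun_AE_cong:
  assumes "Lp_fun p a b f" "AE t in lebesgue_on {a..b}. f t = h t" "p \<ge> 1"
  shows "Lp_fun p a b h" "Lp_norm p a b h = Lp_norm p a b f"
proof -
  have "AE t in lebesgue_on {a..b}. norm (h t) = norm (f t)" using assms(2) by eventually_elim simp
  then show "Lp_fun p a b h" "Lp_norm p a b h = Lp_norm p a b f"
    using Lp_norm_cong[OF assms(3,1) strongly_measurable_AE_cong[OF Lp_fun_sm[OF assms(1)] assms(2)]] by auto
qed

lemma Lp_fun_add:
  assumes "p \<ge> 1" "Lp_fun p a b f" "Lp_fun p a b g"
  shows "Lp_fun p a b (\<lambda>t. f t + g t)" "Lp_norm p a b (\<lambda>t. f t + g t) \<le> Lp_norm p a b f + Lp_norm p a b g"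
  using Lp_fun_triangle[OF assms(1) strongly_measurable_add[OF assms(2,3)[THEN Lp_fun_sm]] assms(2,3)]
  by (auto simp: norm_triangle_ineq)

lemma Lp_fun_diff:
  assumes "p \<ge> 1" "Lp_fun p a b f" "Lp_fun p a b g"
  shows "Lp_fun p a b (\<lambda>t. f t - g t)" "Lp_norm p a b (\<lambda>t. f t - g t) \<le> Lp_norm p a b f + Lp_norm p a b g"
  using Lp_fun_triangle[OF assms(1) strongly_measurable_diff[OF assms(2,3)[THEN Lp_fun_sm]] assms(2,3)]
  by (auto simp: norm_triangle_ineq4)

lemma Lp_fun_blinfun:
  assumes "p \<ge> 1" "Lp_fun p a b f"
  shows "Lp_fun p a b (\<lambda>t. blinfun_apply T (f t))"
    "Lp_norm p a b (\<lambda>t. blinfun_apply T (f t)) \<le> norm T * Lp_norm p a b f"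
  using Lp_fun_le[OF assms(1) strongly_measurable_blinfun[OF Lp_fun_sm[OF assms(2)]] assms(2), of "norm T" T]
  by (auto simp: norm_blinfun)

lemma Lp_fun_operator:
  assumes "p \<ge> 1" "strongly_measurable_bounded_on \<tau> A" "0 \<le> a" "b \<le> \<tau>"
    and K: "\<And>t. t \<in> {0..\<tau>} \<Longrightarrow> norm (A t) \<le> K" "K \<ge> 0" and v: "Lp_fun p a b v"
  shows "Lp_fun p a b (\<lambda>t. blinfun_apply (A t) (v t))"
    "Lp_norm p a b (\<lambda>t. blinfun_apply (A t) (v t)) \<le> K * Lp_norm p a b v"
proof -
  have sm: "strongly_measurable (lebesgue_on {a..b}) (\<lambda>t. A t (v t))"
    by (rule strongly_measurable_operator_apply[of "{0..\<tau>}"])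
       (use assms in \<open>auto simp: strongly_measurable_bounded_on_def Lp_fun_def\<close>)
  have "norm (A t (v t)) \<le> K * norm (v t)" if "t \<in> {a..b}" for t
    using norm_blinfun[of "A t" "v t"] K(1)[of t] that assms(3,4)
    by (smt (verit, best) atLeastAtMost_iff mult_right_mono norm_ge_zero)
  then have "AE t in lebesgue_on {a..b}. norm (A t (v t)) \<le> K * norm (v t)"
    by (auto intro!: AE_I2)
  then show "Lp_fun p a b (\<lambda>t. A t (v t))" "Lp_norm p a b (\<lambda>t. A t (v t)) \<le> K * Lp_norm p a b v"
    using Lp_fun_le[OF assms(1) sm v K(2)] by auto
qed

lemma Lp_fun_subinterval:
  assumes "Lp_fun p a b f" "a \<le> c" "d \<le> b"
  shows "Lp_fun p c d f"
  using assms strongly_measurable_subset[of "{a..b}" f "{c..d}"]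
  by (auto simp: Lp_fun_iff intro: integrable_subinterval_real)

lemma Lp_mass_combine:
  assumes "Lp_fun p a b f" "a \<le> c" "c \<le> b"
  shows "Lp_mass p a c f + Lp_mass p c b f = Lp_mass p a b f"
  unfolding Lp_mass_def
  by (rule Henstock_Kurzweil_Integration.integral_combine) (use assms in \<open>auto simp: Lp_fun_iff\<close>)

lemma Lp_mass_mono:
  assumes "Lp_fun p a b f" "a \<le> c" "d \<le> b"
  shows "Lp_mass p c d f \<le> Lp_mass p a b f"
  unfolding Lp_mass_def using Lp_fun_subinterval[OF assms] assms
  by (intro integral_subset_le) (auto simp: Lp_fun_iff)

lemma Lp_norm_mono:
  assumes "Lp_fun p a b f" "a \<le> c" "d \<le> b" "p > 0"
  shows "Lp_norm p c d f \<le> Lp_norm p a b f"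
  unfolding Lp_norm_def by (rule powr_mono2) (use assms Lp_mass_mono[OF assms(1-3)] in auto)

lemma Lp_norm_limit_right:
  assumes f: "Lp_fun p a b f" and "a < b" "p > 0"
    and le: "\<And>d. a < d \<Longrightarrow> d < b \<Longrightarrow> Lp_norm p a d f \<le> K"
  shows "Lp_norm p a b f \<le> K"
proof -
  obtain m where m: "a < m" "m < b" using dense[OF \<open>a < b\<close>] by auto
  have K: "K \<ge> 0" using le[OF m] Lp_norm_nonneg[of p a m f] by linarith
  have "continuous_on {a..b} (\<lambda>d. Lp_mass p a d f)"
    unfolding Lp_mass_def by (rule indefinite_integral_continuous_1) (use f in \<open>simp add: Lp_fun_iff\<close>)
  then have "((\<lambda>d. Lp_mass p a d f) \<longlongrightarrow> Lp_mass p a b f) (at b within {a..b})"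
    using \<open>a < b\<close> by (auto simp: continuous_on_def)
  then have lim: "((\<lambda>d. Lp_mass p a d f) \<longlongrightarrow> Lp_mass p a b f) (at_left b)"
    using \<open>a < b\<close> by (simp add: at_within_Icc_at_left)
  have "\<forall>\<^sub>F d in at_left b. Lp_mass p a d f \<le> K powr p"
    using eventually_at_left_real[OF \<open>a < b\<close>] by eventually_elim (use le K \<open>p > 0\<close> in \<open>auto simp: Lp_norm_le_iff\<close>)
  then have "Lp_mass p a b f \<le> K powr p"
    by (intro tendsto_upperbound[OF lim]) auto
  then show ?thesis using K \<open>p > 0\<close> by (simp add: Lp_norm_le_iff)
qed

text \<open>It suffices to control almost all left endpoints; this is what one has when the point from which an
  orbit restarts must lie in D.\<close>

lemma Lp_norm_limit_left:
  assumes f: "Lp_fun p a b f" and "a < b" "p > 0"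
    and le: "AE c in lebesgue_on {a..b}. Lp_norm p c b f \<le> K"
  shows "Lp_norm p a b f \<le> K"
proof -
  have ae: "AE c in lebesgue. c \<in> {a..b} \<longrightarrow> Lp_norm p c b f \<le> K" using le by (simp add: AE_restrict_space_iff)
  have ex: "\<exists>c\<in>{a<..<d}. Lp_norm p c b f \<le> K" if "a < d" "d < b" for d
  proof (rule ccontr)
    assume "\<not> ?thesis"
    then have "{a<..<d} \<subseteq> {c \<in> space lebesgue. \<not> (c \<in> {a..b} \<longrightarrow> Lp_norm p c b f \<le> K)}" using that by auto
    then have "negligible {a<..<d}"
      using ae unfolding completion.AE_iff_null_sets negligible_iff_null_sets
      using completion.complete2 by blast
    then show False using \<open>a < d\<close> open_not_negligible[of "{a<..<d}"] by auto
  qed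
  obtain m where m: "a < m" "m < b" using dense[OF \<open>a < b\<close>] by auto
  have K: "K \<ge> 0" using ex[OF m] order_trans[OF Lp_norm_nonneg] by auto
  have "Lp_mass p d b f \<le> K powr p" if "a < d" "d < b" for d
  proof -
    obtain c where c: "c \<in> {a<..<d}" "Lp_norm p c b f \<le> K" using ex[of d] \<open>a < d\<close> \<open>d < b\<close> by auto
    have "Lp_mass p d b f \<le> Lp_mass p c b f"
      by (rule Lp_mass_mono[OF Lp_fun_subinterval[OF f]]) (use c that in auto)
    also have "\<dots> \<le> K powr p" using c(2) K \<open>p > 0\<close> by (simp add: Lp_norm_le_iff)
    finally show ?thesis .
  qed
  moreover have "continuous_on {a..b} (\<lambda>d. Lp_mass p a d f)"
    unfolding Lp_mass_def by (rule indefinite_integral_continuous_1) (use f in \<open>simp add: Lp_fun_iff\<close>)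
  ultimately have "Lp_mass p a b f - Lp_mass p a d f \<le> K powr p" if "a < d" "d < b" for d
    using Lp_mass_combine[OF f, of d] that by (smt (verit))
  then have ev: "\<forall>\<^sub>F d in at_right a. Lp_mass p a b f - Lp_mass p a d f \<le> K powr p"
    using eventually_at_right_real[OF \<open>a < b\<close>] by (auto elim: eventually_mono)
  have "((\<lambda>d. Lp_mass p a d f) \<longlongrightarrow> Lp_mass p a a f) (at a within {a..b})"
    using \<open>continuous_on {a..b} _\<close> \<open>a < b\<close> by (auto simp: continuous_on_def)
  then have "((\<lambda>d. Lp_mass p a d f) \<longlongrightarrow> Lp_mass p a a f) (at_right a)"
    using \<open>a < b\<close> by (simp add: at_within_Icc_at_right)
  moreover have "Lp_mass p a a f = 0" by (simp add: Lp_mass_def)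
  ultimately have "((\<lambda>d. Lp_mass p a b f - Lp_mass p a d f) \<longlongrightarrow> Lp_mass p a b f - 0) (at_right a)"
    by (intro tendsto_intros) auto
  then have "Lp_mass p a b f - 0 \<le> K powr p" by (rule tendsto_upperbound[OF _ ev]) auto
  then show ?thesis using K \<open>p > 0\<close> by (simp add: Lp_norm_le_iff)
qed

text \<open>From \<open>x \<le> l + l\<^sup>1\<^sup>-\<^sup>p x\<^sup>p\<close>, in place of Hoelder's inequality. With \<open>l\<close> left free the bound is additive over
  intervals, and a suitable choice of \<open>l\<close> recovers Hoelder's inequality up to a factor 2.\<close>

lemma norm_integrable_Lp:
  assumes p: "p \<ge> 1" and f: "Lp_fun p a b f" and "a \<le> b" "l > 0"
  shows "(\<lambda>t. norm (f t)) integrable_on {a..b}"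
    "integral {a..b} (\<lambda>t. norm (f t)) \<le> l * (b - a) + l powr (1 - p) * Lp_mass p a b f"
proof -
  have le: "x \<le> l + l powr (1 - p) * x powr p" if "x \<ge> 0" for x :: real
  proof (cases "x \<le> l")
    case True then show ?thesis by (simp add: add_increasing2)
  next
    case False
    then have "x = x powr (1 - p) * x powr p" using \<open>l > 0\<close> by (simp flip: powr_add)
    also have "\<dots> \<le> l powr (1 - p) * x powr p"
      by (intro mult_right_mono powr_mono2') (use False \<open>l > 0\<close> p in auto)
    finally show ?thesis using \<open>l > 0\<close> by simp
  qed
  let ?\<phi> = "\<lambda>t. l + l powr (1 - p) * norm (f t) powr p"
  have \<phi>: "?\<phi> integrable_on {a..b}"
    using f by (auto simp: Lp_fun_iff intro!: integrable_add integrable_on_mult_right integrable_const_ivl)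
  have "(\<lambda>t. norm (f t)) \<in> borel_measurable (lebesgue_on {a..b})"
    by (rule strongly_measurable_imp_borel[OF lebesgue_on_complete Lp_fun_sm[OF f]]) (auto intro: continuous_intros)
  then have "(\<lambda>t. norm (f t)) absolutely_integrable_on {a..b}"
    by (rule measurable_bounded_by_integrable_imp_absolutely_integrable[OF _ _ \<phi>]) (use le in auto)
  then show int: "(\<lambda>t. norm (f t)) integrable_on {a..b}" by (rule set_lebesgue_integral_eq_integral(1))
  have "integral {a..b} (\<lambda>t. norm (f t)) \<le> integral {a..b} ?\<phi>"
    by (rule integral_le[OF int \<phi>]) (use le in auto)
  also have "\<dots> = l * (b - a) + l powr (1 - p) * Lp_mass p a b f"
    using f \<open>a \<le> b\<close> unfolding Lp_mass_def Lp_fun_iff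
    by (subst integral_add) (auto intro!: integrable_on_mult_right integrable_const_ivl)
  finally show "integral {a..b} (\<lambda>t. norm (f t)) \<le> l * (b - a) + l powr (1 - p) * Lp_mass p a b f" .
qed

lemma Lp_fun_shift:
  assumes "Lp_fun p a b f"
  shows "Lp_fun p (a - d) (b - d) (\<lambda>t. f (t + d))" "Lp_mass p (a - d) (b - d) (\<lambda>t. f (t + d)) = Lp_mass p a b f"
proof -
  have "strongly_measurable lebesgue (\<lambda>t. indicator {a..b} (t + d) *\<^sub>R f (t + d))"
    using strongly_measurable_shift[of "\<lambda>t. indicator {a..b} t *\<^sub>R f t" d] Lp_fun_sm[OF assms]
    by (simp add: strongly_measurable_lebesgue_on)
  moreover have "(\<lambda>t. indicator {a..b} (t + d) *\<^sub>R f (t + d)) = (\<lambda>t. indicator {a - d..b - d} t *\<^sub>R f (t + d))"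
    by (auto simp: indicator_def fun_eq_iff algebra_simps)
  ultimately have sm: "strongly_measurable (lebesgue_on {a - d..b - d}) (\<lambda>t. f (t + d))"
    by (simp add: strongly_measurable_lebesgue_on)
  have "((\<lambda>t. norm (f t) powr p) has_integral Lp_mass p a b f) {a..b}"
    using assms unfolding Lp_mass_def Lp_fun_iff by (auto intro: integrable_integral)
  then have "((\<lambda>t. norm (f (t + d)) powr p) has_integral Lp_mass p a b f) {a - d..b - d}"
    using has_integral_affinity'[of "\<lambda>t. norm (f t) powr p" "Lp_mass p a b f" a b 1 d] by simp
  then show "Lp_fun p (a - d) (b - d) (\<lambda>t. f (t + d))" "Lp_mass p (a - d) (b - d) (\<lambda>t. f (t + d)) = Lp_mass p a b f"
    using sm by (auto simp: Lp_fun_iff Lp_mass_def)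
qed

lemma continuous_on_strongly_measurable:
  fixes f :: "real \<Rightarrow> 'b::real_normed_vector"
  assumes "continuous_on {a..b} f"
  shows "strongly_measurable (lebesgue_on {a..b}) f"
proof (cases "a \<le> b")
  case True
  obtain T where T: "countable T" "T \<subseteq> {a..b}" "{a..b} \<subseteq> closure T" using separable[of "{a..b}"] by auto
  have "T \<noteq> {}" using T(3) True by auto
  then have R: "range (from_nat_into T) = T" using T(1) by (simp add: range_from_nat_into)
  show ?thesis
  proof (rule strongly_measurable_if_separably_valued[where d = "\<lambda>n. f (from_nat_into T n)"])
    show "(\<lambda>t. norm (f t - f (from_nat_into T i))) \<in> borel_measurable (lebesgue_on {a..b})" for i
      by (rule continuous_imp_measurable_on_sets_lebesgue) (intro continuous_intros assms, simp)
    have "f t \<in> closure (range (\<lambda>n. f (from_nat_into T n)))" if t: "t \<in> {a..b}" for t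
    proof -
      obtain r where r: "\<And>n. r n \<in> T" "r \<longlonglongrightarrow> t" using T(3) t by (meson closure_sequential subsetD)
      have "(\<lambda>n. f (r n)) \<longlonglongrightarrow> f t"
        by (rule continuous_on_tendsto_compose[OF assms r(2) t])
             (use r(1) T(2) in \<open>blast intro: always_eventually\<close>)
      moreover have "f (r n) \<in> range (\<lambda>n. f (from_nat_into T n))" for n
        using r(1)[of n] R by (metis (full_types) image_iff rangeI)
      ultimately show ?thesis unfolding closure_sequential by (intro exI[of _ "\<lambda>n. f (r n)"]) auto
    qed
    then show "AE t in lebesgue_on {a..b}. f t \<in> closure (range (\<lambda>n. f (from_nat_into T n)))"
      by (auto intro!: AE_I2)
  qed
next
  case False
  then show ?thesis by (auto simp: strongly_measurable_lebesgue_on strongly_measurable_const)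
qed

text \<open>Minkowski's inequality in the plane with the p-norm, for the vectors \<open>(\<rho>, Q)\<close> and \<open>(0, D)\<close>.\<close>

lemma powr_add_le_powr_sum:
  fixes \<rho> Q D p :: real
  assumes p: "p \<ge> 1" and nn: "\<rho> \<ge> 0" "Q \<ge> 0" "D \<ge> 0"
  shows "\<rho> powr p + (Q + D) powr p \<le> ((\<rho> powr p + Q powr p) powr (1 / p) + D) powr p"
proof -
  define T where "T = (\<rho> powr p + Q powr p) powr (1 / p)"
  have Tp: "T powr p = \<rho> powr p + Q powr p" using p by (simp add: T_def powr_powr)
  have T0: "T \<ge> 0" by (simp add: T_def)
  consider "T = 0" | "D = 0" | "T > 0" "D > 0" using T0 nn by linarith
  then show ?thesis
  proof cases
    case 1
    then have "\<rho> powr p = 0" "Q powr p = 0" using Tp p by (auto simp: add_nonneg_eq_0_iff)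
    then show ?thesis using p by (simp add: powr_eq_0_iff)
  next
    case 2
    then show ?thesis using Tp by (simp flip: T_def)
  next
    case 3
    let ?s = "T / (T + D)"
    have "(Q + D) powr p \<le> (T + D) powr p * (?s * (Q / T) powr p + D / (T + D) * (D / D) powr p)"
      by (rule add_powr_le) (use p nn 3 in auto)
    moreover have "\<rho> powr p \<le> (T + D) powr p * (?s * (\<rho> / T) powr p)"
    proof -
      have "T powr p \<le> (T + D) powr p * ?s"
      proof -
        have "?s powr p \<le> ?s powr 1" by (rule powr_mono') (use p 3 in auto)
        then show ?thesis using 3 by (simp add: powr_divide field_simps)
      qed
      then have "T powr p * (\<rho> / T) powr p \<le> (T + D) powr p * ?s * (\<rho> / T) powr p" by (rule mult_right_mono) simp
      then show ?thesis using 3 by (simp add: powr_divide mult.assoc)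
    qed
    ultimately have "\<rho> powr p + (Q + D) powr p \<le> (T + D) powr p * (?s * ((\<rho> / T) powr p + (Q / T) powr p) + D / (T + D))"
      using 3 by (simp add: algebra_simps)
    also have "(\<rho> / T) powr p + (Q / T) powr p = 1"
    proof -
      have "T powr p \<noteq> 0" using 3 by simp
      then show ?thesis using Tp by (simp add: powr_divide flip: add_divide_distrib)
    qed
    also have "?s * 1 + D / (T + D) = 1" using 3 by (simp flip: add_divide_distrib)
    finally show ?thesis by (simp flip: T_def)
  qed
qed

section \<open>The maximal regularity space\<close>

text \<open>An element of \<open>MR\<^sub>p(a,b)\<close> with its derivative \<open>g\<close> and with itself as a D-valued function \<open>v\<close>. Carrying
  both along makes sums and restrictions immediate and avoids having to prove that they are unique.\<close>

definition MR_triple ::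
    "('d::banach \<Rightarrow>\<^sub>L 'x::banach) \<Rightarrow> real \<Rightarrow> real \<Rightarrow> real \<Rightarrow> (real \<Rightarrow> 'x) \<Rightarrow> (real \<Rightarrow> 'x) \<Rightarrow> (real \<Rightarrow> 'd) \<Rightarrow> bool"
  where "MR_triple j p a b u g v \<longleftrightarrow>
    W1p_deriv p a b u g \<and> Lp_fun p a b v \<and> (AE t in lebesgue_on {a..b}. j (v t) = u t)"

lemma MR_tripleD:
  assumes "MR_triple j p a b u g v"
  shows "Lp_fun p a b u" "Lp_fun p a b g" "Lp_fun p a b v" "AE t in lebesgue_on {a..b}. j (v t) = u t"
    "\<And>t. t \<in> {a..b} \<Longrightarrow> (g has_integral (u t - u a)) {a..t}"
  using assms by (auto simp: MR_triple_def W1p_deriv_def)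

lemma MR_triple_AE_inv:
  assumes "inj (blinfun_apply j)" "MR_triple j p a b u g v"
  shows "AE t in lebesgue_on {a..b}. inv (blinfun_apply j) (u t) = v t"
  using MR_tripleD(4)[OF assms(2)] by eventually_elim (metis assms(1) inv_f_f)

lemma MR_triple_in_space:
  assumes "inj (blinfun_apply j)" "MR_triple j p a b u g v" "p \<ge> 1"
  shows "u \<in> MR_space j p a b"
proof -
  have "Lp_fun p a b (\<lambda>t. inv (blinfun_apply j) (u t))"
    by (rule Lp_fun_AE_cong(1)[OF MR_tripleD(3)[OF assms(2)] _ assms(3)])
       (use MR_triple_AE_inv[OF assms(1,2)] in \<open>auto elim: eventually_mono\<close>)
  moreover have "AE t in lebesgue_on {a..b}. u t \<in> range (blinfun_apply j)"
    using MR_tripleD(4)[OF assms(2)] by eventually_elim (metis rangeI)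
  ultimately show ?thesis using assms(2) by (auto simp: MR_space_def MR_triple_def)
qed

lemma MR_triple_inv:
  assumes "u \<in> MR_space j p a b" "W1p_deriv p a b u g"
  shows "MR_triple j p a b u g (\<lambda>t. inv (blinfun_apply j) (u t))"
  using assms unfolding MR_triple_def MR_space_def
  by (auto elim!: eventually_mono simp: f_inv_into_f)

text \<open>In the definition of a solution membership in the maximal regularity space and the equation may use different
  derivatives; one triple serves for both.\<close>

lemma cauchy_solution_iff:
  assumes j: "inj (blinfun_apply j)" and p: "p \<ge> 1"
  shows "cauchy_solution j p a b A f x u \<longleftrightarrow>
    (\<exists>g v. MR_triple j p a b u g v \<and> u a = x \<and> (AE t in lebesgue_on {a..b}. g t + A t (v t) = f t))"
proof
  assume "cauchy_solution j p a b A f x u"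
  then show "\<exists>g v. MR_triple j p a b u g v \<and> u a = x \<and> (AE t in lebesgue_on {a..b}. g t + A t (v t) = f t)"
    unfolding cauchy_solution_def using MR_triple_inv by blast
next
  assume "\<exists>g v. MR_triple j p a b u g v \<and> u a = x \<and> (AE t in lebesgue_on {a..b}. g t + A t (v t) = f t)"
  then obtain g v where gv: "MR_triple j p a b u g v" "u a = x"
      "AE t in lebesgue_on {a..b}. g t + A t (v t) = f t" by auto
  have "AE t in lebesgue_on {a..b}. g t + A t (inv (blinfun_apply j) (u t)) = f t"
    using gv(3) MR_triple_AE_inv[OF j gv(1)] by eventually_elim simp
  then show "cauchy_solution j p a b A f x u"
    unfolding cauchy_solution_def using MR_triple_in_space[OF j gv(1) p] gv by (auto simp: MR_triple_def)
qed

lemma MR_triple_diff: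
  assumes p: "p \<ge> 1" and 1: "MR_triple j p a b u1 g1 v1" and 2: "MR_triple j p a b u2 g2 v2"
  shows "MR_triple j p a b (\<lambda>t. u1 t - u2 t) (\<lambda>t. g1 t - g2 t) (\<lambda>t. v1 t - v2 t)"
proof -
  have "AE t in lebesgue_on {a..b}. j (v1 t - v2 t) = u1 t - u2 t"
    using MR_tripleD(4)[OF 1] MR_tripleD(4)[OF 2] by eventually_elim (simp add: blinfun.diff_right)
  moreover have "((\<lambda>t. g1 t - g2 t) has_integral (u1 t - u2 t - (u1 a - u2 a))) {a..t}" if "t \<in> {a..b}" for t
    using has_integral_diff[OF MR_tripleD(5)[OF 1 that] MR_tripleD(5)[OF 2 that]] by (simp add: algebra_simps)
  ultimately show ?thesis
    using MR_tripleD(1-3)[OF 1] MR_tripleD(1-3)[OF 2]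
    by (auto simp: MR_triple_def W1p_deriv_def intro: Lp_fun_diff(1)[OF p])
qed

lemma MR_triple_scaleR:
  assumes "MR_triple j p a b u g v"
  shows "MR_triple j p a b (\<lambda>t. c *\<^sub>R u t) (\<lambda>t. c *\<^sub>R g t) (\<lambda>t. c *\<^sub>R v t)"
proof -
  have "AE t in lebesgue_on {a..b}. j (c *\<^sub>R v t) = c *\<^sub>R u t"
    using MR_tripleD(4)[OF assms] by eventually_elim (simp add: blinfun.scaleR_right)
  moreover have "((\<lambda>t. c *\<^sub>R g t) has_integral (c *\<^sub>R u t - c *\<^sub>R u a)) {a..t}" if "t \<in> {a..b}" for t
    using has_integral_cmul[OF MR_tripleD(5)[OF assms that], of c] by (simp add: scaleR_diff_right)
  ultimately show ?thesis
    using MR_tripleD(1-3)[OF assms] by (auto simp: MR_triple_def W1p_deriv_def intro: Lp_fun_scaleR)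
qed

lemma MR_triple_add:
  assumes p: "p \<ge> 1" and 1: "MR_triple j p a b u1 g1 v1" and 2: "MR_triple j p a b u2 g2 v2"
  shows "MR_triple j p a b (\<lambda>t. u1 t + u2 t) (\<lambda>t. g1 t + g2 t) (\<lambda>t. v1 t + v2 t)"
  using MR_triple_diff[OF p 1 MR_triple_scaleR[OF 2, of "-1"]] by simp

lemma MR_triple_subinterval:
  assumes "MR_triple j p a b u g v" "a \<le> c" "c \<le> d" "d \<le> b"
  shows "MR_triple j p c d u g v"
proof -
  have "(g has_integral (u t - u c)) {c..t}" if t: "t \<in> {c..d}" for t
  proof -
    have a: "(g has_integral (u t - u a)) {a..t}" and c: "(g has_integral (u c - u a)) {a..c}"
      using MR_tripleD(5)[OF assms(1)] t assms by auto
    have "g integrable_on {c..t}"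
      by (rule integrable_subinterval_real[OF has_integral_integrable[OF a]]) (use assms t in auto)
    then obtain i where i: "(g has_integral i) {c..t}" by auto
    have "(g has_integral (u c - u a) + i) {a..t}"
      by (rule has_integral_combine[OF _ _ c i]) (use assms t in auto)
    then have "u t - u a = (u c - u a) + i" using has_integral_unique[OF a] by blast
    then show ?thesis using i by (simp add: algebra_simps)
  qed
  moreover have "AE t in lebesgue_on {c..d}. j (v t) = u t"
    by (rule AE_lebesgue_on_subset[OF MR_tripleD(4)[OF assms(1)]]) (use assms in auto)
  ultimately show ?thesis
    using MR_tripleD(1-3)[OF assms(1)] assms(2,4)
    by (auto simp: MR_triple_def W1p_deriv_def intro: Lp_fun_subinterval)
qed

lemma AE_lebesgue_on_shift:
  fixes Q :: "real \<Rightarrow> bool"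
  assumes "AE t in lebesgue_on {a..b}. Q t"
  shows "AE t in lebesgue_on {a - d..b - d}. Q (t + d)"
proof -
  have shift: "(\<lambda>t::real. t + d) \<in> measurable lebesgue lebesgue"
    using lebesgue_affine_measurable[of "\<lambda>_. 1" d] by (simp add: add.commute)
  have dist: "lebesgue = distr lebesgue lebesgue (\<lambda>t::real. t + d)"
    using lebesgue_affine_euclidean[of "\<lambda>_. 1::real" d] by (simp add: add.commute density_1)
  have "AE t in lebesgue. t \<in> {a..b} \<longrightarrow> Q t" using assms by (simp add: AE_restrict_space_iff)
  then have "AE t in lebesgue. t + d \<in> {a..b} \<longrightarrow> Q (t + d)"
    by (subst (asm) dist) (rule AE_distrD[OF shift])
  then have "AE t in lebesgue. t \<in> {a - d..b - d} \<longrightarrow> Q (t + d)"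
    by eventually_elim (auto simp: algebra_simps)
  then show ?thesis by (simp add: AE_restrict_space_iff)
qed

lemma MR_triple_shift:
  assumes "MR_triple j p a b u g v"
  shows "MR_triple j p (a - d) (b - d) (\<lambda>t. u (t + d)) (\<lambda>t. g (t + d)) (\<lambda>t. v (t + d))"
proof -
  have "((\<lambda>t. g (t + d)) has_integral (u (t + d) - u (a - d + d))) {a - d..t}" if "t \<in> {a - d..b - d}" for t
    using has_integral_affinity'[of g "u (t + d) - u a" a "t + d" 1 d] MR_tripleD(5)[OF assms, of "t + d"] that
    by auto
  then show ?thesis
    unfolding MR_triple_def W1p_deriv_def
    using MR_tripleD(1-3)[OF assms, THEN Lp_fun_shift(1)] AE_lebesgue_on_shift[OF MR_tripleD(4)[OF assms]]
    by auto
qed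

lemma MR_triple_growth:
  assumes p: "p \<ge> 1" and M: "MR_triple j p a b u g v" and t: "t \<in> {a..b}" and l: "l > 0"
  shows "norm (u t - u a) \<le> l * (b - a) + l powr (1 - p) * Lp_mass p a b g"
proof -
  have g: "Lp_fun p a b g" and gt: "Lp_fun p a t g"
    using MR_tripleD(2)[OF M] Lp_fun_subinterval[of p a b g a t] t by auto
  have int: "(\<lambda>s. norm (g s)) integrable_on {a..t}" by (rule norm_integrable_Lp[OF p gt _ l]) (use t in auto)
  have "norm (u t - u a) = norm (integral {a..t} g)"
    using MR_tripleD(5)[OF M t] by (simp add: integral_unique)
  also have "\<dots> \<le> integral {a..t} (\<lambda>s. norm (g s))"
    by (rule integral_norm_bound_integral[OF _ int]) (use MR_tripleD(5)[OF M t] in auto)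
  also have "\<dots> \<le> integral {a..b} (\<lambda>s. norm (g s))"
    by (rule integral_subset_le) (use t int norm_integrable_Lp(1)[OF p g _ l] in auto)
  also have "\<dots> \<le> l * (b - a) + l powr (1 - p) * Lp_mass p a b g"
    by (rule norm_integrable_Lp[OF p g _ l]) (use t in auto)
  finally show ?thesis .
qed

lemma MR_triple_const:
  assumes "a \<le> b" "x = blinfun_apply j y"
  shows "MR_triple j p a b (\<lambda>_. x) (\<lambda>_. 0) (\<lambda>_. y)"
  using assms by (auto simp: MR_triple_def W1p_deriv_def Lp_fun_const)

text \<open>The values of a function in the maximal regularity space are admissible initial values at every time.\<close>

lemma MR_triple_start_in_trace_space:
  assumes "inj (blinfun_apply j)" "p \<ge> 1" "MR_triple j p a b u g v" "r \<in> {a..<b}"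
  shows "u r \<in> trace_space j p r b"
  using MR_triple_in_space[OF assms(1) MR_triple_subinterval[OF assms(3), of r b] assms(2)] assms(4)
  by (auto simp: trace_space_def)

section \<open>The regularity bound for a single operator\<close>

lemma AE_lebesgue_on_neq: "AE t in lebesgue_on {a..b::real}. t \<noteq> c"
proof -
  have "AE t in lebesgue. t \<noteq> c" by (rule AE_completion[OF AE_lborel_singleton])
  then show ?thesis by (auto simp: AE_restrict_space_iff elim: eventually_mono)
qed

lemma Lp_fun_zero_extension:
  fixes f :: "real \<Rightarrow> 'b::real_normed_vector"
  assumes "Lp_fun p c d f" "a \<le> c" "d \<le> b" "p \<ge> 1"
  shows "Lp_fun p a b (\<lambda>t. indicator {c<..<d} t *\<^sub>R f t)"
    "Lp_norm p a b (\<lambda>t. indicator {c<..<d} t *\<^sub>R f t) = Lp_norm p c d f"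
proof -
  have "strongly_measurable lebesgue (\<lambda>t. indicator {c..d} t *\<^sub>R f t)"
    using Lp_fun_sm[OF assms(1)] by (simp add: strongly_measurable_lebesgue_on)
  then have "strongly_measurable lebesgue (\<lambda>t. indicator {c<..<d} t *\<^sub>R (indicator {c..d} t *\<^sub>R f t))"
    by (rule strongly_measurable_indicator) simp
  moreover have "(\<lambda>t. indicator {c<..<d} t *\<^sub>R (indicator {c..d} t *\<^sub>R f t)) = (\<lambda>t. indicator {a..b} t *\<^sub>R (indicator {c<..<d} t *\<^sub>R f t))"
    using assms(2,3) by (auto simp: indicator_def fun_eq_iff)
  ultimately have sm: "strongly_measurable (lebesgue_on {a..b}) (\<lambda>t. indicator {c<..<d} t *\<^sub>R f t)"
    by (simp add: strongly_measurable_lebesgue_on)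
  have "((\<lambda>t. norm (f t) powr p) has_integral Lp_mass p c d f) {c..d}"
    using assms(1) unfolding Lp_mass_def Lp_fun_iff by (auto intro: integrable_integral)
  then have "((\<lambda>t. norm (f t) powr p) has_integral Lp_mass p c d f) {c<..<d}"
    by (simp add: has_integral_open_interval[of _ _ c d, unfolded box_real])
  then have "((\<lambda>t. if t \<in> {c<..<d} then norm (f t) powr p else 0) has_integral Lp_mass p c d f) {a..b}"
    by (subst has_integral_restrict) (use assms in auto)
  moreover have "(\<lambda>t. if t \<in> {c<..<d} then norm (f t) powr p else 0) = (\<lambda>t. norm (indicator {c<..<d} t *\<^sub>R f t) powr p)"
    using assms(4) by (auto simp: indicator_def fun_eq_iff)
  ultimately have "((\<lambda>t. norm (indicator {c<..<d} t *\<^sub>R f t) powr p) has_integral Lp_mass p c d f) {a..b}" by simp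
  then show "Lp_fun p a b (\<lambda>t. indicator {c<..<d} t *\<^sub>R f t)"
    "Lp_norm p a b (\<lambda>t. indicator {c<..<d} t *\<^sub>R f t) = Lp_norm p c d f"
    using sm unfolding Lp_norm_def Lp_mass_def Lp_fun_iff by (auto simp: integral_unique)
qed

lemma maximal_regularity_unique:
  assumes j: "inj (blinfun_apply j)" and p: "p \<ge> 1" and A: "maximal_Lp_regularity j p A0" and "a < b"
    and 1: "MR_triple j p a b u1 g1 v1" and 2: "MR_triple j p a b u2 g2 v2" and "u1 a = u2 a"
    and eq: "AE t in lebesgue_on {a..b}. g1 t + A0 (v1 t) = g2 t + A0 (v2 t)"
  shows "\<And>t. t \<in> {a..b} \<Longrightarrow> u1 t = u2 t" "AE t in lebesgue_on {a..b}. v1 t = v2 t"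
proof -
  let ?sol = "cauchy_solution j p a b (\<lambda>_. A0) (\<lambda>_. 0) 0"
  obtain w where w: "unique_cauchy_solution j p a b (\<lambda>_. A0) (\<lambda>_. 0) 0 w"
    using A Lp_fun_zero[of p a b] \<open>a < b\<close> unfolding maximal_Lp_regularity_def by blast
  have "?sol (\<lambda>_. 0)"
    unfolding cauchy_solution_iff[OF j p]
    using MR_triple_const[of a b 0 j 0] \<open>a < b\<close> by (intro exI[of _ "\<lambda>_. 0"]) (auto simp: blinfun.zero_right)
  moreover have "AE t in lebesgue_on {a..b}. (g1 t - g2 t) + A0 (v1 t - v2 t) = 0"
    using eq by eventually_elim (simp add: blinfun.diff_right algebra_simps)
  then have "?sol (\<lambda>t. u1 t - u2 t)"
    unfolding cauchy_solution_iff[OF j p] using MR_triple_diff[OF p 1 2] \<open>u1 a = u2 a\<close>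
    by (intro exI[of _ "\<lambda>t. g1 t - g2 t"] exI[of _ "\<lambda>t. v1 t - v2 t"]) auto
  ultimately have "\<forall>t\<in>{a..b}. u1 t - u2 t = 0"
    using w unfolding unique_cauchy_solution_def by metis
  then show u: "u1 t = u2 t" if "t \<in> {a..b}" for t using that by simp
  have "AE t in lebesgue_on {a..b}. t \<in> {a..b}" by (rule AE_I2) simp
  then show "AE t in lebesgue_on {a..b}. v1 t = v2 t"
    using MR_tripleD(4)[OF 1] MR_tripleD(4)[OF 2]
  proof eventually_elim
    fix t assume "t \<in> {a..b}" "j (v1 t) = u1 t" "j (v2 t) = u2 t"
    then have "j (v1 t) = j (v2 t)" using u by simp
    then show "v1 t = v2 t" using j by (simp add: inj_eq)
  qed
qed

lemma maximal_regularity_exists: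
  assumes j: "inj (blinfun_apply j)" and p: "p \<ge> 1" and A: "maximal_Lp_regularity j p A0" and "a < b"
    and f: "Lp_fun p a b f"
  obtains u g v where "MR_triple j p a b u g v" "u a = 0" "AE t in lebesgue_on {a..b}. g t + A0 (v t) = f t"
proof -
  obtain u where "unique_cauchy_solution j p a b (\<lambda>_. A0) f 0 u"
    using A f \<open>a < b\<close> unfolding maximal_Lp_regularity_def by blast
  then show thesis
    using that unfolding unique_cauchy_solution_def cauchy_solution_iff[OF j p] by blast
qed

text \<open>The quantitative form of maximal regularity on one interval: the D-valued part of a function that starts at
  zero is bounded by the right-hand side that it produces.\<close>

definition regularity_bound ::
    "('d::banach \<Rightarrow>\<^sub>L 'x::banach) \<Rightarrow> real \<Rightarrow> (real \<Rightarrow> ('d \<Rightarrow>\<^sub>L 'x)) \<Rightarrow> real \<Rightarrow> real \<Rightarrow> real \<Rightarrow> bool" where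
  "regularity_bound j p A a b M \<longleftrightarrow> (\<forall>u g v. MR_triple j p a b u g v \<longrightarrow> u a = 0 \<longrightarrow>
     Lp_norm p a b v \<le> M * Lp_norm p a b (\<lambda>t. g t + A t (v t)))"

text \<open>One building block for the construction below: if the regularity bound fails on short intervals with
  every constant, a right-hand side as small as we please, supported in a prescribed slot \<open>[s,s']\<close>, produces a
  solution as large as we please already within that slot. The equation is autonomous, so the failure may be
  translated into the slot; scaling trades the size of the right-hand side against that of the solution.\<close>

lemma steep_solution_on_slot:
  assumes j: "inj (blinfun_apply j)" and p: "p > 1" and A: "maximal_Lp_regularity j p A0"
    and no: "\<And>h M. h > 0 \<Longrightarrow> M \<ge> 0 \<Longrightarrow> \<not> (\<forall>a b. a < b \<and> b - a \<le> h \<longrightarrow> regularity_bound j p (\<lambda>_. A0) a b M)"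
    and s: "0 \<le> s" "s < s'" "s' \<le> 1" and e: "e > 0" and K: "K > 0"
  shows "\<exists>u g v f. MR_triple j p 0 1 u g v \<and> u 0 = 0 \<and> Lp_fun p 0 1 f \<and>
    (AE t in lebesgue_on {0..1}. g t + A0 (v t) = f t) \<and> (\<forall>t. t \<le> s \<or> t \<ge> s' \<longrightarrow> f t = 0) \<and>
    Lp_norm p 0 1 f \<le> e \<and> Lp_norm p s s' v \<ge> K"
proof -
  have p1: "p \<ge> 1" and p0: "p > 0" using p by auto
  have "s' - s > 0" "K / e \<ge> 0" using s e K by auto
  from no[OF this] obtain a b u g v where
    w: "a < b" "b - a \<le> s' - s" "MR_triple j p a b u g v" "u a = 0"
       "Lp_norm p a b v > K / e * Lp_norm p a b (\<lambda>t. g t + A0 (v t))"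
    unfolding regularity_bound_def by (auto simp: not_le)
  define N where "N = Lp_norm p a b v"
  have "K / e * Lp_norm p a b (\<lambda>t. g t + A0 (v t)) \<ge> 0" using K e by simp
  then have "N > 0" using w(5) unfolding N_def by linarith
  define f where "f t = (K / N) *\<^sub>R (g t + A0 (v t))" for t
  have tr: "MR_triple j p a b (\<lambda>t. (K / N) *\<^sub>R u t) (\<lambda>t. (K / N) *\<^sub>R g t) (\<lambda>t. (K / N) *\<^sub>R v t)"
    by (rule MR_triple_scaleR[OF w(3)])
  have fLp: "Lp_fun p a b f"
    unfolding f_def using MR_tripleD(2,3)[OF w(3)]
    by (intro Lp_fun_scaleR Lp_fun_add p1 Lp_fun_blinfun)
  have "Lp_norm p a b f = K / N * Lp_norm p a b (\<lambda>t. g t + A0 (v t))"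
    unfolding f_def using K \<open>N > 0\<close> p0 by (simp add: Lp_norm_scaleR)
  also have "\<dots> \<le> K / N * (e / K * N)"
    using w(5) K e \<open>N > 0\<close> unfolding N_def[symmetric] by (intro mult_left_mono) (auto simp: field_simps)
  finally have fe: "Lp_norm p a b f \<le> e" using K \<open>N > 0\<close> by simp
  define d where "d = a - s"
  define b' where "b' = b - d"
  have b': "s < b'" "b' \<le> s'" "a - d = s" using w(1,2) by (auto simp: b'_def d_def)
  define us gs vs fs where "us t = (K / N) *\<^sub>R u (t + d)" and "gs t = (K / N) *\<^sub>R g (t + d)"
    and "vs t = (K / N) *\<^sub>R v (t + d)" and "fs t = f (t + d)" for t
  have trs: "MR_triple j p s b' us gs vs"
    using MR_triple_shift[OF tr, of d] unfolding b'(3) b'_def[symmetric] us_def[abs_def] gs_def[abs_def] vs_def[abs_def] .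
  have us: "us s = 0" using w(4) by (simp add: us_def d_def)
  have fsLp: "Lp_fun p s b' fs" and fsm: "Lp_norm p s b' fs = Lp_norm p a b f"
    using Lp_fun_shift[OF fLp, of d] unfolding b'(3) b'_def[symmetric] fs_def[abs_def] Lp_norm_def by auto
  have vsN: "Lp_norm p s b' vs = K"
    using Lp_fun_shift(2)[OF MR_tripleD(3)[OF tr], of d] Lp_norm_scaleR[OF p0, of a b "K / N" v] K \<open>N > 0\<close>
    unfolding b'(3) b'_def[symmetric] vs_def[abs_def] Lp_norm_def N_def by auto
  have eqs: "gs t + A0 (vs t) = fs t" for t
    by (simp add: gs_def vs_def fs_def f_def blinfun.scaleR_right scaleR_add_right)
  define F where "F t = indicator {s<..<b'} t *\<^sub>R fs t" for t
  have F: "Lp_fun p 0 1 F" "Lp_norm p 0 1 F \<le> e"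
    using Lp_fun_zero_extension[OF fsLp, of 0 1] s b' p1 fsm fe by (auto simp: F_def[abs_def])
  obtain x y z where xyz: "MR_triple j p 0 1 x y z" "x 0 = 0" "AE t in lebesgue_on {0..1}. y t + A0 (z t) = F t"
    using maximal_regularity_exists[OF j p1 A _ F(1)] by auto
  \<comment> \<open>Before \<open>s\<close> the right-hand side vanishes, hence so does the solution.\<close>
  have "x s = 0"
  proof (cases "s = 0")
    case False
    then have "s > 0" using s by simp
    have "AE t in lebesgue_on {0..s}. y t + A0 (z t) = F t"
      by (rule AE_lebesgue_on_subset[OF xyz(3)]) (use s in auto)
    moreover have "AE t in lebesgue_on {0..s}. F t = 0" by (rule AE_I2) (simp add: F_def)
    ultimately have "AE t in lebesgue_on {0..s}. y t + A0 (z t) = 0 + A0 0"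
      by eventually_elim (simp add: blinfun.zero_right)
    then show ?thesis
      using maximal_regularity_unique(1)[OF j p1 A \<open>s > 0\<close> MR_triple_subinterval[OF xyz(1), of 0 s]
          MR_triple_const[of 0 s 0 j 0], of s] xyz(2) s
      by (simp add: blinfun.zero_right)
  qed (use xyz in simp)
  have "AE t in lebesgue_on {s..b'}. t \<in> {s..b'}" by (rule AE_I2) simp
  moreover have "AE t in lebesgue_on {s..b'}. y t + A0 (z t) = F t"
    by (rule AE_lebesgue_on_subset[OF xyz(3)]) (use s b' in auto)
  ultimately have "AE t in lebesgue_on {s..b'}. y t + A0 (z t) = gs t + A0 (vs t)"
    using AE_lebesgue_on_neq[where a = s and b = b' and c = s] AE_lebesgue_on_neq[where a = s and b = b' and c = b']
    by eventually_elim (auto simp: F_def eqs)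
  then have "AE t in lebesgue_on {s..b'}. z t = vs t"
    using maximal_regularity_unique(2)[OF j p1 A b'(1) MR_triple_subinterval[OF xyz(1), of s b'] trs]
      us \<open>x s = 0\<close> s b' by auto
  then have "Lp_norm p s b' z = Lp_norm p s b' vs"
    by (intro Lp_fun_AE_cong(2)[OF MR_tripleD(3)[OF trs] _ p1]) (auto elim: eventually_mono)
  moreover have "Lp_norm p s b' z \<le> Lp_norm p s s' z"
    by (rule Lp_norm_mono[OF Lp_fun_subinterval[OF MR_tripleD(3)[OF xyz(1)]]]) (use s b' p0 in auto)
  ultimately have "Lp_norm p s s' z \<ge> K" using vsN by simp
  moreover have "\<forall>t. t \<le> s \<or> t \<ge> s' \<longrightarrow> F t = 0" using b' by (auto simp: F_def indicator_def)
  ultimately show ?thesis using xyz F by blast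
qed

text \<open>A gliding hump argument that replaces the closed graph theorem. Right-hand sides that violate the bound are placed
  one after the other in the slots \<open>[s n, s (n + 1)]\<close> with \<open>s n = 1 - 2\<^sup>-\<^sup>n\<close>, each small enough for
  the sum to be in \<open>L\<^sup>p\<close>, but with a solution so large on its own slot that the earlier
  solutions cannot cancel it. Later ones have no influence on that slot. So the solution for the
  sum has an \<open>L\<^sup>p\<close> norm of at least \<open>n\<close> on the n-th slot, for every n.\<close>

lemma autonomous_regularity_bound:
  fixes j :: "'d::banach \<Rightarrow>\<^sub>L 'x::banach"
  assumes j: "inj (blinfun_apply j)" and p: "p > 1" and A: "maximal_Lp_regularity j p A0"
  shows "\<exists>h>0. \<exists>M\<ge>0. (\<forall>a b. a < b \<and> b - a \<le> h \<longrightarrow> regularity_bound j p (\<lambda>_. A0) a b M)"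
proof (rule ccontr)
  assume "\<not> ?thesis"
  then have no: "\<not> (\<forall>a b. a < b \<and> b - a \<le> h \<longrightarrow> regularity_bound j p (\<lambda>_. A0) a b M)" if "h > 0" "M \<ge> 0" for h M using that by blast
  have p1: "p \<ge> 1" and p0: "p > 0" using p by auto
  define s :: "nat \<Rightarrow> real" where "s n = 1 - (1/2) ^ n" for n
  have s: "0 \<le> s n" "s n < s (Suc n)" "s n < 1" for n
    by (auto simp: s_def power_le_one)
  \<comment> \<open>A state consists of a solution with its derivative, its D-valued part and its right-hand side; \<open>n\<close> slots have been filled.\<close>
  define P where "P n x = (case x of (u, g, v, f) \<Rightarrow>
      MR_triple j p 0 1 u g v \<and> u 0 = 0 \<and> Lp_fun p 0 1 f \<and>
      (AE t in lebesgue_on {0..1}. g t + A0 (v t) = f t) \<and>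
      (\<forall>t\<ge>s n. f t = 0) \<and> Lp_norm p 0 1 f \<le> 2 - 2 * (1/2) ^ n)" for n and x :: "(real \<Rightarrow> 'x) \<times> (real \<Rightarrow> 'x) \<times> (real \<Rightarrow> 'd) \<times> (real \<Rightarrow> 'x)"
  define Q where "Q n x y = (case x of (u, g, v, f) \<Rightarrow> case y of (u', g', v', f') \<Rightarrow>
      (\<forall>t\<le>s n. f' t = f t) \<and> Lp_norm p (s n) (s (Suc n)) v' \<ge> real n)" for n and x y :: "(real \<Rightarrow> 'x) \<times> (real \<Rightarrow> 'x) \<times> (real \<Rightarrow> 'd) \<times> (real \<Rightarrow> 'x)"
  have "\<exists>y. P (Suc n) y \<and> Q n x y" if "P n x" for x n
  proof -
    obtain u g v f where x: "x = (u, g, v, f)" by (cases x)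
    have *: "MR_triple j p 0 1 u g v" "u 0 = 0" "Lp_fun p 0 1 f"
        "AE t in lebesgue_on {0..1}. g t + A0 (v t) = f t"
        "\<And>t. t \<ge> s n \<Longrightarrow> f t = 0" "Lp_norm p 0 1 f \<le> 2 - 2 * (1/2) ^ n"
      using that by (auto simp: P_def x)
    \<comment> \<open>Large enough to outweigh what the earlier slots contribute to this one.\<close>
    define K where "K = real n + 1 + Lp_norm p (s n) (s (Suc n)) v"
    have "K > 0" using Lp_norm_nonneg[of p "s n" "s (Suc n)" v] by (simp add: K_def add_pos_nonneg)
    from steep_solution_on_slot[where e = "(1/2) ^ n", OF j p A no s(1) s(2) less_imp_le[OF s(3)] _ this, of n] obtain u1 g1 v1 f1 where
      **: "MR_triple j p 0 1 u1 g1 v1" "u1 0 = 0" "Lp_fun p 0 1 f1"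
        "AE t in lebesgue_on {0..1}. g1 t + A0 (v1 t) = f1 t"
        "\<forall>t. t \<le> s n \<or> t \<ge> s (Suc n) \<longrightarrow> f1 t = 0" "Lp_norm p 0 1 f1 \<le> (1/2) ^ n"
        "Lp_norm p (s n) (s (Suc n)) v1 \<ge> K"
      by (auto simp del: power_Suc)
    have v': "Lp_fun p (s n) (s (Suc n)) v" "Lp_fun p (s n) (s (Suc n)) v1"
      using Lp_fun_subinterval[OF MR_tripleD(3)] *(1) **(1) s(1)[of n] s(3)[of "Suc n"] less_imp_le by metis+
    have "Lp_norm p (s n) (s (Suc n)) (\<lambda>t. (v t + v1 t) - v t)
        \<le> Lp_norm p (s n) (s (Suc n)) (\<lambda>t. v t + v1 t) + Lp_norm p (s n) (s (Suc n)) v"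
      by (intro Lp_fun_diff p1 v' Lp_fun_add)
    then have large: "Lp_norm p (s n) (s (Suc n)) (\<lambda>t. v t + v1 t) \<ge> real n"
      using **(7) by (simp add: K_def)
    have eq: "AE t in lebesgue_on {0..1}. (g t + g1 t) + A0 (v t + v1 t) = f t + f1 t"
      using *(4) **(4) by eventually_elim (simp add: blinfun.add_right algebra_simps)
    have small: "Lp_norm p 0 1 (\<lambda>t. f t + f1 t) \<le> 2 - 2 * (1/2) ^ Suc n"
      using Lp_fun_add(2)[OF p1 *(3) **(3)] *(6) **(6) by simp
    have zero: "\<forall>t\<ge>s (Suc n). f t + f1 t = 0" and same: "\<forall>t\<le>s n. f t + f1 t = f t"
      using *(5) **(5) s(2)[of n] by auto
    have start: "u 0 + u1 0 = 0" using *(2) **(2) by simp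
    have "P (Suc n) (\<lambda>t. u t + u1 t, \<lambda>t. g t + g1 t, \<lambda>t. v t + v1 t, \<lambda>t. f t + f1 t)"
      unfolding P_def prod.case
      by (intro conjI MR_triple_add[OF p1 *(1) **(1)] start Lp_fun_add(1)[OF p1 *(3) **(3)] eq zero small)
    moreover have "Q n x (\<lambda>t. u t + u1 t, \<lambda>t. g t + g1 t, \<lambda>t. v t + v1 t, \<lambda>t. f t + f1 t)"
      unfolding Q_def x prod.case by (intro conjI same large)
    ultimately show ?thesis by blast
  qed
  moreover have "P 0 (\<lambda>_. 0, \<lambda>_. 0, \<lambda>_. 0, \<lambda>_. 0)"
    unfolding P_def using MR_triple_const[of 0 1 0 j 0] p0
    by (auto simp: blinfun.zero_right Lp_fun_zero Lp_norm_zero)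
  ultimately obtain X where X: "\<And>n. P n (X n)" "\<And>n. Q n (X n) (X (Suc n))"
    using dependent_nat_choice[of P Q] by blast
  define U G V F where "U n = fst (X n)" and "G n = fst (snd (X n))" and "V n = fst (snd (snd (X n)))"
    and "F n = snd (snd (snd (X n)))" for n
  have sol: "MR_triple j p 0 1 (U n) (G n) (V n)" "U n 0 = 0" "Lp_fun p 0 1 (F n)"
      "AE t in lebesgue_on {0..1}. G n t + A0 (V n t) = F n t"
      "\<And>t. t \<ge> s n \<Longrightarrow> F n t = 0" "Lp_norm p 0 1 (F n) \<le> 2" for n
    using X(1)[of n] unfolding P_def U_def G_def V_def F_def
    by (auto simp: case_prod_unfold intro: order_trans)
  have step: "\<And>t. t \<le> s n \<Longrightarrow> F (Suc n) t = F n t" "Lp_norm p (s n) (s (Suc n)) (V (Suc n)) \<ge> real n" for n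
    using X(2)[of n] unfolding Q_def V_def F_def by (auto simp: case_prod_unfold)
  have smono: "s n \<le> s m" if "n \<le> m" for n m
    using that by (rule lift_Suc_mono_le[of s, rotated]) (use s(2) less_imp_le in auto)
  have stable: "F m t = F n t" if "t \<le> s n" "n \<le> m" for m n t
    using that(2)
  proof (induction m rule: dec_induct)
    case (step m)
    then show ?case using \<open>\<And>n t. t \<le> s n \<Longrightarrow> F (Suc n) t = F n t\<close> smono[of n m] that(1) by auto
  qed simp
  have slim: "s \<longlonglongrightarrow> 1" unfolding s_def
    using tendsto_diff[OF tendsto_const LIMSEQ_power_zero[of "1/2::real"], of 1] by simp
  \<comment> \<open>The sequence is eventually constant at every point.\<close>
  define f where "f t = lim (\<lambda>n. F n t)" for t
  have f_eq: "f t = F n t" if "t \<le> s n" for n t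
  proof -
    have "(\<lambda>m. F m t) \<longlonglongrightarrow> F n t"
      by (rule tendsto_eventually, rule eventually_mono[OF eventually_ge_at_top[of n]], rule stable[OF that])
    then show ?thesis unfolding f_def by (rule limI)
  qed
  have f_lim: "(\<lambda>n. F n t) \<longlonglongrightarrow> f t" for t
  proof (cases "t < 1")
    case True
    then obtain n where "t < s n"
      using eventually_happens[OF order_tendstoD(1)[OF slim, of t]] by auto
    then have "F m t = f t" if "n \<le> m" for m
      using stable[OF _ that, of t] f_eq[of t n] by simp
    then show ?thesis
      by (rule tendsto_eventually[OF eventually_mono[OF eventually_ge_at_top[of n]]])
  next
    case False
    then have "F n t = 0" for n using sol(5)[of n t] s(3)[of n] by simp
    then have "(\<lambda>n. F n t) \<longlonglongrightarrow> 0" by simp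
    then show ?thesis unfolding f_def by (simp add: limI)
  qed
  have "(\<lambda>t. norm (f t) powr p) integrable_on {0..1} \<and>
      (\<lambda>k. integral {0..1} (\<lambda>t. norm (F k t) powr p)) \<longlonglongrightarrow> integral {0..1} (\<lambda>t. norm (f t) powr p)"
  proof (rule monotone_convergence_increasing)
    show "(\<lambda>t. norm (F k t) powr p) integrable_on {0..1}" for k using sol(3) by (simp add: Lp_fun_iff)
    show "norm (F k t) powr p \<le> norm (F (Suc k) t) powr p" for k t
      using step(1)[of t k] sol(5)[of k t] by (cases "t \<le> s k") auto
    show "(\<lambda>k. norm (F k t) powr p) \<longlonglongrightarrow> norm (f t) powr p" for t
      using f_lim[of t] p0 by (intro tendsto_powr' tendsto_norm) auto
    have "Lp_mass p 0 1 (F k) \<le> 2 powr p" for k using sol(6)[of k] p0 by (simp add: Lp_norm_le_iff)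
    then show "bounded (range (\<lambda>k. integral {0..1} (\<lambda>t. norm (F k t) powr p)))"
      unfolding Lp_mass_def[symmetric] by (auto intro!: boundedI)
  qed
  moreover have "strongly_measurable (lebesgue_on {0..1}) f"
    by (rule strongly_measurable_LIMSEQ[where f = F, OF lebesgue_on_complete Lp_fun_sm[OF sol(3)]]) (use f_lim in auto)
  ultimately have "Lp_fun p 0 1 f" by (simp add: Lp_fun_iff)
  then obtain u g v where u: "MR_triple j p 0 1 u g v" "u 0 = 0" "AE t in lebesgue_on {0..1}. g t + A0 (v t) = f t"
    using maximal_regularity_exists[OF j p1 A zero_less_one] by metis
  have "real n \<le> Lp_norm p 0 1 v" for n
  proof -
    let ?b = "s (Suc n)"
    have b: "0 < ?b" "?b \<le> 1" using s(1)[of n] s(2)[of n] s(3)[of "Suc n"] by auto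
    have "AE t in lebesgue_on {0..?b}. t \<in> {0..?b}" by (rule AE_I2) simp
    moreover have "AE t in lebesgue_on {0..?b}. g t + A0 (v t) = f t"
      by (rule AE_lebesgue_on_subset[OF u(3)]) (use b in auto)
    moreover have "AE t in lebesgue_on {0..?b}. G (Suc n) t + A0 (V (Suc n) t) = F (Suc n) t"
      by (rule AE_lebesgue_on_subset[OF sol(4)]) (use b in auto)
    ultimately have "AE t in lebesgue_on {0..?b}. g t + A0 (v t) = G (Suc n) t + A0 (V (Suc n) t)"
      by eventually_elim (auto simp: f_eq[of _ "Suc n"])
    then have "AE t in lebesgue_on {0..?b}. v t = V (Suc n) t"
      using maximal_regularity_unique(2)[OF j p1 A b(1) MR_triple_subinterval[OF u(1), of 0 ?b]
          MR_triple_subinterval[OF sol(1)[of "Suc n"], of 0 ?b]] u(2) sol(2) b by auto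
    then have "AE t in lebesgue_on {s n..?b}. v t = V (Suc n) t"
      by (rule AE_lebesgue_on_subset) (use s(1)[of n] in auto)
    then have "Lp_norm p (s n) ?b (V (Suc n)) = Lp_norm p (s n) ?b v"
      using Lp_fun_AE_cong(2)[of p "s n" ?b v "V (Suc n)"] Lp_fun_subinterval[OF MR_tripleD(3)[OF u(1)], of "s n" ?b]
        s(1)[of n] b p1 by simp
    moreover have "Lp_norm p (s n) ?b v \<le> Lp_norm p 0 1 v"
      by (rule Lp_norm_mono[OF MR_tripleD(3)[OF u(1)]]) (use s(1)[of n] b p0 in auto)
    ultimately show ?thesis using step(2)[of n] by linarith
  qed
  then show False using reals_Archimedean2 not_less by metis
qed

section \<open>The uniform regularity bound\<close>

text \<open>\<open>MR_triple_growth\<close> with \<open>l\<close> slightly above the norm of \<open>g\<close>, the slack covering the case of norm zero.\<close>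

lemma MR_triple_sup_bound:
  assumes p: "p \<ge> 1" and M: "MR_triple j p a b u g v" and t: "t \<in> {a..b}" and "b - a \<le> 1"
  shows "norm (u t - u a) \<le> 2 * Lp_norm p a b g"
proof (rule field_le_epsilon)
  fix e :: real assume "e > 0"
  define l where "l = Lp_norm p a b g + e / 2"
  have l: "l > 0" "Lp_norm p a b g \<le> l" using \<open>e > 0\<close> Lp_norm_nonneg[of p a b g] by (auto simp: l_def add_nonneg_pos)
  have "norm (u t - u a) \<le> l * (b - a) + l powr (1 - p) * Lp_mass p a b g"
    by (rule MR_triple_growth[OF p M t l(1)])
  also have "\<dots> \<le> l * 1 + l powr (1 - p) * l powr p"
    using Lp_norm_le_iff[of p l a b g] l p assms(4) by (intro add_mono mult_left_mono) auto
  also have "\<dots> = 2 * l" using l by (simp flip: powr_add)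
  finally show "norm (u t - u a) \<le> 2 * Lp_norm p a b g + e" by (simp add: l_def)
qed

lemma regularity_bound_mono:
  "regularity_bound j p A a b M \<Longrightarrow> M \<le> M' \<Longrightarrow> regularity_bound j p A a b M'"
  unfolding regularity_bound_def by (meson Lp_norm_nonneg mult_right_mono order_trans)

text \<open>Perturbation: replacing \<open>A t\<close> by a fixed operator changes the right-hand side by at most \<open>\<epsilon>\<close> times the
  norm of the solution in D, which can be absorbed, plus \<open>\<eta>\<close> times its norm in X. The latter is
  small on a short interval, since the solution starts at zero and its derivative is under control.\<close>

lemma frozen_regularity_bound:
  assumes p: "p > 1" and ab: "0 \<le> a" "a < b" "b \<le> \<tau>" "b - a \<le> 1"
    and A: "strongly_measurable_bounded_on \<tau> A" and K: "\<And>t. t \<in> {0..\<tau>} \<Longrightarrow> norm (A t) \<le> K" "K \<ge> 0"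
    and frozen: "regularity_bound j p (\<lambda>_. B) a b M" "M \<ge> 0"
    and close: "\<And>t x. t \<in> {a..b} \<Longrightarrow> norm (B x - A t x) \<le> \<epsilon> * norm x + \<eta> * norm (j x)" "\<epsilon> \<ge> 0" "\<eta> \<ge> 0"
    and small: "M * \<epsilon> \<le> 1/4" "M * (2 * \<eta> * (b - a) powr (1 / p) * (K + 1)) \<le> 1/4"
  shows "regularity_bound j p A a b (2 * M + 1)"
  unfolding regularity_bound_def
proof (intro allI impI)
  fix u g v assume tr: "MR_triple j p a b u g v" and ua: "u a = 0"
  have p1: "p \<ge> 1" and p0: "p > 0" using p by auto
  define f where "f t = g t + A t (v t)" for t
  define N where "N = Lp_norm p a b v"
  define \<Phi> where "\<Phi> = Lp_norm p a b f"
  have N0: "N \<ge> 0" "\<Phi> \<ge> 0" by (auto simp: N_def \<Phi>_def)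
  note gv = MR_tripleD(2,3)[OF tr]
  note Av = Lp_fun_operator[OF p1 A ab(1,3) K gv(2)]
  have f: "Lp_fun p a b f" unfolding f_def[abs_def] by (rule Lp_fun_add(1)[OF p1 gv(1) Av(1)])
  \<comment> \<open>The derivative is controlled through the equation, and \<open>u\<close> through its derivative.\<close>
  have "Lp_norm p a b (\<lambda>t. f t - A t (v t)) \<le> \<Phi> + K * N"
    using Lp_fun_diff(2)[OF p1 f Av(1)] Av(2) by (simp add: \<Phi>_def N_def)
  then have gN: "Lp_norm p a b g \<le> \<Phi> + K * N" by (simp add: f_def)
  have "norm (u t) \<le> 2 * (\<Phi> + K * N)" if "t \<in> {a..b}" for t
    using MR_triple_sup_bound[OF p1 tr that ab(4)] gN ua by simp
  then have "AE t in lebesgue_on {a..b}. norm (u t) \<le> 2 * (\<Phi> + K * N)"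
    by (auto intro!: AE_I2)
  then have uN: "Lp_norm p a b u \<le> 2 * (\<Phi> + K * N) * (b - a) powr (1 / p)"
    using Lp_fun_bounded(2)[OF p1 Lp_fun_sm[OF MR_tripleD(1)[OF tr]]] N0 K(2) ab by simp
  \<comment> \<open>The error made by freezing the operator at \<open>B\<close>.\<close>
  have sm: "strongly_measurable (lebesgue_on {a..b}) (\<lambda>t. B (v t) - A t (v t))"
    by (rule Lp_fun_sm[OF Lp_fun_diff(1)[OF p1 Lp_fun_blinfun(1)[OF p1 gv(2)] Av(1)]])
  have "AE t in lebesgue_on {a..b}. t \<in> {a..b}" by (rule AE_I2) simp
  then have "AE t in lebesgue_on {a..b}. norm (B (v t) - A t (v t)) \<le> norm (\<epsilon> *\<^sub>R v t) + norm (\<eta> *\<^sub>R u t)"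
    using MR_tripleD(4)[OF tr]
  proof eventually_elim
    fix t assume "t \<in> {a..b}" "j (v t) = u t"
    then show "norm (B (v t) - A t (v t)) \<le> norm (\<epsilon> *\<^sub>R v t) + norm (\<eta> *\<^sub>R u t)"
      using close(1)[of t "v t"] close(2,3) by simp
  qed
  from Lp_fun_triangle[OF p1 sm Lp_fun_scaleR[OF gv(2)] Lp_fun_scaleR[OF MR_tripleD(1)[OF tr]] this]
  have err: "Lp_fun p a b (\<lambda>t. B (v t) - A t (v t))"
    "Lp_norm p a b (\<lambda>t. B (v t) - A t (v t)) \<le> \<epsilon> * N + \<eta> * Lp_norm p a b u"
    using close(2,3) p0 by (auto simp: Lp_norm_scaleR N_def)
  have "N \<le> M * Lp_norm p a b (\<lambda>t. g t + B (v t))"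
    using frozen(1) tr ua unfolding regularity_bound_def N_def by blast
  also have "(\<lambda>t. g t + B (v t)) = (\<lambda>t. f t + (B (v t) - A t (v t)))" by (simp add: f_def fun_eq_iff)
  also have "M * Lp_norm p a b \<dots> \<le> M * (\<Phi> + (\<epsilon> * N + \<eta> * (2 * (\<Phi> + K * N) * (b - a) powr (1 / p))))"
    using Lp_fun_add(2)[OF p1 f err(1)] err(2) mult_left_mono[OF uN close(3)]
    by (intro mult_left_mono frozen(2)) (simp add: \<Phi>_def)
  also have "\<dots> = M * \<Phi> + M * \<epsilon> * N + M * (2 * \<eta> * (b - a) powr (1 / p)) * (\<Phi> + K * N)"
    by (simp add: algebra_simps)
  also have "\<dots> \<le> M * \<Phi> + 1/4 * N + M * (2 * \<eta> * (b - a) powr (1 / p)) * ((K + 1) * (\<Phi> + N))"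
    using small(1) N0 K(2) frozen(2) close(3)
    by (intro add_mono mult_right_mono mult_left_mono) (auto simp: algebra_simps)
  also have "\<dots> \<le> M * \<Phi> + 1/4 * N + 1/4 * (\<Phi> + N)"
    using mult_right_mono[OF small(2), of "\<Phi> + N"] N0 by (simp add: algebra_simps)
  finally have "N \<le> (2 * M + 1/2) * \<Phi>"
    by (simp only: distrib_right distrib_left mult.assoc)
  also have "\<dots> \<le> (2 * M + 1) * \<Phi>" using N0 by (intro mult_right_mono) auto
  finally show "Lp_norm p a b v \<le> (2 * M + 1) * Lp_norm p a b (\<lambda>t. g t + A t (v t))"
    by (simp add: N_def \<Phi>_def f_def[abs_def])
qed

lemma strongly_measurable_bounded_onE:
  assumes "strongly_measurable_bounded_on \<tau> A"
  obtains K where "\<And>t. t \<in> {0..\<tau>} \<Longrightarrow> norm (A t) \<le> K" "K \<ge> 0"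
proof -
  obtain K where "K > 0" "\<forall>t\<in>{0..\<tau>}. norm (A t) \<le> K"
    using assms unfolding strongly_measurable_bounded_on_def bounded_pos by auto
  then show thesis by (intro that[of K]) auto
qed

lemma local_regularity_bound:
  assumes j: "inj (blinfun_apply j)" and p: "p > 1"
    and A: "strongly_measurable_bounded_on \<tau> A" and Dini: "relative_Dini j \<tau> \<nu> A"
    and t0: "t0 \<in> {0..\<tau>}" and MR: "maximal_Lp_regularity j p (A t0)"
  shows "\<exists>\<delta>>0. \<exists>M\<ge>0. \<forall>a b. 0 \<le> a \<and> a < b \<and> b \<le> \<tau> \<and> \<bar>a - t0\<bar> < \<delta> \<and> \<bar>b - t0\<bar> < \<delta> \<longrightarrow> regularity_bound j p A a b M"
proof -
  obtain K where K: "\<And>t. t \<in> {0..\<tau>} \<Longrightarrow> norm (A t) \<le> K" "K \<ge> 0"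
    using strongly_measurable_bounded_onE[OF A] by blast
  obtain h M where h: "h > 0" "M \<ge> 0" and frozen: "\<And>a b. a < b \<Longrightarrow> b - a \<le> h \<Longrightarrow> regularity_bound j p (\<lambda>_. A t0) a b M"
    using autonomous_regularity_bound[OF j p MR] by blast
  obtain \<eta> \<omega> where \<omega>: "\<eta> \<ge> 0" "continuous_on {0..\<tau>} \<omega>" "\<omega> 0 = 0"
    and close: "\<And>x s t. s \<in> {0..\<tau>} \<Longrightarrow> t \<in> {0..\<tau>} \<Longrightarrow>
        norm (A t x - A s x) \<le> \<omega> \<bar>t - s\<bar> * norm x + \<eta> * norm (j x)"
    using Dini unfolding relative_Dini_def by blast
  define \<epsilon> where "\<epsilon> = 1 / (4 * (M + 1))"
  have \<epsilon>: "\<epsilon> > 0" "M * \<epsilon> \<le> 1/4" using h by (auto simp: \<epsilon>_def field_simps)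
  have "0 \<in> {0..\<tau>}" using t0 by auto
  then have "\<exists>d>0. \<forall>r\<in>{0..\<tau>}. dist r 0 < d \<longrightarrow> dist (\<omega> r) (\<omega> 0) < \<epsilon>"
    using \<omega>(2) \<epsilon>(1) unfolding continuous_on_iff by blast
  then obtain d where d: "d > 0" "\<And>r. r \<in> {0..\<tau>} \<Longrightarrow> \<bar>r\<bar> < d \<Longrightarrow> \<bar>\<omega> r\<bar> < \<epsilon>"
    using \<omega>(3) by (auto simp: dist_real_def)
  define C where "C = M * (2 * \<eta> * (K + 1)) + 1"
  have C: "C > 0" using h \<omega>(1) K(2) by (simp add: C_def add_nonneg_pos)
  define k where "k = (1 / (4 * C)) powr p"
  have k: "k > 0" using C by (simp add: k_def)
  define \<delta> where "\<delta> = min (min (h / 2) d) (min (1 / 2) (k / 2))"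
  have "\<delta> > 0" using h d k by (simp add: \<delta>_def)
  moreover have "regularity_bound j p A a b (2 * M + 1)"
    if ab: "0 \<le> a" "a < b" "b \<le> \<tau>" "\<bar>a - t0\<bar> < \<delta>" "\<bar>b - t0\<bar> < \<delta>" for a b
  proof (rule frozen_regularity_bound[OF p ab(1-3) _ A K _ h(2), where B = "A t0" and \<epsilon> = \<epsilon> and \<eta> = \<eta>])
    have len: "b - a \<le> 2 * \<delta>" using ab by linarith
    then show "b - a \<le> 1" "regularity_bound j p (\<lambda>_. A t0) a b M"
      using frozen[OF ab(2)] by (auto simp: \<delta>_def)
    show "norm (A t0 x - A t x) \<le> \<epsilon> * norm x + \<eta> * norm (j x)" if t: "t \<in> {a..b}" for t x
    proof -
      have "\<bar>t - t0\<bar> < \<delta>" using t ab by auto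
      then have "\<bar>t0 - t\<bar> < d" by (simp add: \<delta>_def abs_minus_commute)
      moreover have "\<bar>t0 - t\<bar> \<in> {0..\<tau>}" using t t0 ab by auto
      ultimately have "\<omega> \<bar>t0 - t\<bar> \<le> \<epsilon>" using d(2)[of "\<bar>t0 - t\<bar>"] by linarith
      then show ?thesis
        using close[of t t0 x] t t0 ab by (smt (verit, best) atLeastAtMost_iff mult_right_mono norm_ge_zero)
    qed
    have "(b - a) powr (1 / p) \<le> k powr (1 / p)"
      by (rule powr_mono2) (use p ab len in \<open>auto simp: \<delta>_def\<close>)
    also have "\<dots> = 1 / (4 * C)" using p C by (simp add: k_def powr_powr)
    finally have "C * (b - a) powr (1 / p) \<le> C * (1 / (4 * C))" using C by (intro mult_left_mono) auto
    also have "\<dots> = 1/4" using C by simp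
    finally have "C * (b - a) powr (1 / p) \<le> 1/4" .
    moreover have "M * (2 * \<eta> * (b - a) powr (1 / p) * (K + 1)) \<le> C * (b - a) powr (1 / p)"
      by (simp add: C_def algebra_simps)
    ultimately show "M * (2 * \<eta> * (b - a) powr (1 / p) * (K + 1)) \<le> 1/4" by linarith
  qed (use \<epsilon> \<omega> in auto)
  ultimately show ?thesis using h(2) by (intro exI[of _ \<delta>] conjI exI[of _ "2 * M + 1"]) auto
qed

text \<open>The local bounds are turned into a uniform one by compactness of the interval: intervals on which the
  bound fails with larger and larger constants would accumulate at some point.\<close>

lemma uniform_regularity_bound:
  assumes j: "inj (blinfun_apply j)" and p: "p > 1"
    and A: "strongly_measurable_bounded_on \<tau> A" and Dini: "relative_Dini j \<tau> \<nu> A"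
    and MR: "\<And>t. t \<in> {0..\<tau>} \<Longrightarrow> maximal_Lp_regularity j p (A t)"
  obtains h M where "h > 0" "M \<ge> 0"
    "\<And>a b. 0 \<le> a \<Longrightarrow> a < b \<Longrightarrow> b \<le> \<tau> \<Longrightarrow> b - a \<le> h \<Longrightarrow> regularity_bound j p A a b M"
proof -
  have "\<exists>n::nat. \<forall>a b. 0 \<le> a \<and> a < b \<and> b \<le> \<tau> \<and> b - a \<le> 1 / (real n + 1) \<longrightarrow> regularity_bound j p A a b (real n)"
  proof (rule ccontr)
    assume "\<not> ?thesis"
    then obtain a b where ab: "\<And>n::nat. 0 \<le> a n" "\<And>n. a n < b n" "\<And>n. b n \<le> \<tau>"
        "\<And>n. b n - a n \<le> 1 / (real n + 1)" "\<And>n. \<not> regularity_bound j p A (a n) (b n) (real n)"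
      by metis
    have "\<forall>n. a n \<in> {0..\<tau>}" using ab(1-3) by (meson atLeastAtMost_iff less_imp_le order_trans)
    then obtain l r where l: "l \<in> {0..\<tau>}" "strict_mono (r :: nat \<Rightarrow> nat)" "(a \<circ> r) \<longlonglongrightarrow> l"
      using compact_Icc[of 0 \<tau>] unfolding compact_def by metis
    obtain \<delta> M where loc: "\<delta> > 0" "\<And>a b. 0 \<le> a \<Longrightarrow> a < b \<Longrightarrow> b \<le> \<tau> \<Longrightarrow> \<bar>a - l\<bar> < \<delta> \<Longrightarrow> \<bar>b - l\<bar> < \<delta> \<Longrightarrow> regularity_bound j p A a b M"
      using local_regularity_bound[OF j p A Dini l(1) MR[OF l(1)]] by blast
    have "(\<lambda>n. 1 / (real n + 1)) \<longlonglongrightarrow> 0"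
      using LIMSEQ_inverse_real_of_nat by (simp add: inverse_eq_divide add.commute)
    then have "(\<lambda>n. 1 / (real (r n) + 1)) \<longlonglongrightarrow> 0"
      using LIMSEQ_subseq_LIMSEQ[OF _ l(2)] by (auto simp: comp_def)
    then have "\<forall>\<^sub>F n in sequentially. 1 / (real (r n) + 1) < \<delta> / 2"
      by (rule order_tendstoD(2)) (use loc(1) in simp)
    moreover have "\<forall>\<^sub>F n in sequentially. \<bar>a (r n) - l\<bar> < \<delta> / 2"
      using tendstoD[OF l(3), of "\<delta> / 2"] loc(1) by (simp add: dist_real_def)
    moreover have "\<forall>\<^sub>F n in sequentially. n \<ge> nat \<lceil>M\<rceil>" by (rule eventually_ge_at_top)
    ultimately have "\<forall>\<^sub>F n in sequentially. False"
    proof eventually_elim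
      fix n assume n: "1 / (real (r n) + 1) < \<delta> / 2" "\<bar>a (r n) - l\<bar> < \<delta> / 2" "n \<ge> nat \<lceil>M\<rceil>"
      have "M \<le> real (r n)" using n(3) seq_suble[OF l(2), of n] by linarith
      moreover have "\<bar>b (r n) - l\<bar> < \<delta>" using n(1,2) ab(2)[of "r n"] ab(4)[of "r n"] by linarith
      ultimately show False
        using loc(2)[OF ab(1-3), of "r n"] n(2) loc(1) regularity_bound_mono ab(5)[of "r n"] by fastforce
    qed
    then show False by simp
  qed
  then obtain n :: nat where "\<And>a b. 0 \<le> a \<Longrightarrow> a < b \<Longrightarrow> b \<le> \<tau> \<Longrightarrow> b - a \<le> 1 / (real n + 1) \<Longrightarrow> regularity_bound j p A a b (real n)"
    by blast
  then show thesis by (intro that[of "1 / (real n + 1)" "real n"]) auto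
qed

section \<open>Observation of orbits\<close>

text \<open>After normalisation by \<open>N\<close> the inequality \<open>x\<^sup>p \<le> 1 + x\<^sup>\<mu>\<close> is all that is needed; it costs the length of
  the interval.\<close>

lemma observation_bound_lower_exponent:
  assumes p: "1 < p" "p \<le> \<mu>" and ab: "a < b" "b - a \<le> \<tau>" and f: "Lp_fun p a b f" and "c > 0" "N \<ge> 0"
    and int: "integrable (lebesgue_on {a..b}) (\<lambda>t. norm (f t) powr \<mu>)"
    and le: "(integral\<^sup>L (lebesgue_on {a..b}) (\<lambda>t. norm (f t) powr \<mu>)) powr (1 / \<mu>) \<le> c * N"
  shows "Lp_norm p a b f \<le> (\<tau> + c powr \<mu>) powr (1 / p) * N"
proof -
  have p0: "p > 0" and \<mu>0: "\<mu> > 0" using p by auto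
  let ?C = "(\<tau> + c powr \<mu>) powr (1 / p)"
  have I: "integral {a..b} (\<lambda>t. norm (f t) powr \<mu>) = integral\<^sup>L (lebesgue_on {a..b}) (\<lambda>t. norm (f t) powr \<mu>)"
    using lebesgue_integral_eq_integral[OF int] by simp
  have hk: "(\<lambda>t. norm (f t) powr \<mu>) integrable_on {a..b}" using integrable_on_lebesgue_on[OF int] by simp
  have I0: "integral {a..b} (\<lambda>t. norm (f t) powr \<mu>) \<ge> 0" by (rule integral_nonneg[OF hk]) simp
  have "((integral {a..b} (\<lambda>t. norm (f t) powr \<mu>)) powr (1 / \<mu>)) powr \<mu> \<le> (c * N) powr \<mu>"
    unfolding I by (rule powr_mono2) (use \<mu>0 le in auto)
  then have mass: "integral {a..b} (\<lambda>t. norm (f t) powr \<mu>) \<le> (c * N) powr \<mu>"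
    using \<mu>0 I0 by (simp add: powr_powr)
  \<comment> \<open>Dividing by some \<open>n > 0\<close> above \<open>N\<close> covers the case \<open>N = 0\<close>.\<close>
  have bound: "Lp_norm p a b f \<le> ?C * n" if n: "n \<ge> N" "n > 0" for n
  proof -
    define \<phi> where "\<phi> t = 1 + n powr (- \<mu>) * norm (f t) powr \<mu>" for t
    have \<phi>: "integrable (lebesgue_on {a..b}) \<phi>"
      unfolding \<phi>_def by (intro Bochner_Integration.integrable_add integrable_mult_right int) simp
    have "norm ((1 / n) *\<^sub>R f t) powr p \<le> \<phi> t" for t
    proof -
      define x where "x = norm (f t) / n"
      have x: "x \<ge> 0" using n by (simp add: x_def)
      have "x powr p \<le> 1 + x powr \<mu>"
      proof (cases "x \<le> 1")
        case True
        then have "x powr p \<le> 1" using x p0 powr_mono2[of p x 1] by simp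
        then show ?thesis by (simp add: add_increasing2)
      next
        case False
        then have "x powr p \<le> x powr \<mu>" by (intro powr_mono) (use p in auto)
        then show ?thesis by simp
      qed
      moreover have "x powr \<mu> = n powr (- \<mu>) * norm (f t) powr \<mu>"
        using n by (simp add: x_def powr_divide powr_minus field_simps)
      ultimately show ?thesis using n by (simp add: \<phi>_def x_def)
    qed
    then have "AE t in lebesgue_on {a..b}. norm ((1 / n) *\<^sub>R f t) powr p \<le> \<phi> t" by simp
    from Lp_fun_dominated(2)[OF p0 Lp_fun_sm[OF Lp_fun_scaleR[OF f]] \<phi> this]
    have "Lp_mass p a b (\<lambda>t. (1 / n) *\<^sub>R f t) \<le> integral {a..b} \<phi>" .
    also have "\<dots> = (b - a) + n powr (- \<mu>) * integral {a..b} (\<lambda>t. norm (f t) powr \<mu>)"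
      unfolding \<phi>_def using hk ab by (subst integral_add) (auto intro!: integrable_on_mult_right integrable_const_ivl)
    also have "\<dots> \<le> \<tau> + n powr (- \<mu>) * (c * n) powr \<mu>"
    proof (intro add_mono mult_left_mono)
      have "(c * N) powr \<mu> \<le> (c * n) powr \<mu>"
        by (rule powr_mono2) (use n \<open>c > 0\<close> \<open>N \<ge> 0\<close> \<mu>0 in auto)
      then show "integral {a..b} (\<lambda>t. norm (f t) powr \<mu>) \<le> (c * n) powr \<mu>" using mass by linarith
    qed (use ab in auto)
    also have "\<dots> = \<tau> + c powr \<mu>" using n by (simp add: powr_mult powr_minus)
    also have "\<dots> = ?C powr p" using p0 ab by (simp add: powr_powr)
    finally have "Lp_norm p a b (\<lambda>t. (1 / n) *\<^sub>R f t) \<le> ?C" using p0 by (simp add: Lp_norm_le_iff)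
    then show ?thesis using n p0 by (simp add: Lp_norm_scaleR field_simps)
  qed
  show ?thesis
  proof (rule field_le_epsilon)
    fix e :: real assume "e > 0"
    have "\<tau> + c powr \<mu> > 0" using \<open>c > 0\<close> ab by (simp add: add_pos_pos)
    then have C: "?C > 0" by (simp only: powr_gt_zero)
    show "Lp_norm p a b f \<le> ?C * N + e"
      using bound[of "N + e / ?C"] \<open>N \<ge> 0\<close> \<open>e > 0\<close> C by (simp add: distrib_left add_nonneg_pos)
  qed
qed

text \<open>The observation estimate is assumed for initial values in D and for intervals ending before \<open>\<tau>\<close>. An orbit
  that is in D at almost every time can be restarted at times \<open>q\<close> arbitrarily close to \<open>r\<close>, so the estimate extends
  to its initial value \<open>d\<close>, and up to \<open>\<tau>\<close>.\<close>

lemma observation_bound_trace: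
  assumes U: "evolution_family \<tau> U" and L: "\<And>t s. 0 \<le> s \<Longrightarrow> s \<le> t \<Longrightarrow> t \<le> \<tau> \<Longrightarrow> norm (U t s) \<le> L"
    and P: "strongly_measurable_bounded_on \<tau> P" and p: "p \<ge> 1"
    and adm: "\<And>s b x v. 0 \<le> s \<Longrightarrow> s < b \<Longrightarrow> b < \<tau> \<Longrightarrow> Lp_fun p s b v \<Longrightarrow>
      (AE t in lebesgue_on {s..b}. j (v t) = U t s (j x)) \<Longrightarrow> Lp_norm p s b (\<lambda>t. P t (v t)) \<le> c * norm (j x)"
    and r: "0 \<le> r" "r < \<tau>" and "c \<ge> 0" and v: "Lp_fun p r \<tau> v" "AE t in lebesgue_on {r..\<tau>}. j (v t) = U t r d"
  shows "Lp_norm p r \<tau> (\<lambda>t. P t (v t)) \<le> c * L * norm d"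
proof -
  have p0: "p > 0" using p by simp
  obtain KP where KP: "\<And>t. t \<in> {0..\<tau>} \<Longrightarrow> norm (P t) \<le> KP" "KP \<ge> 0" using strongly_measurable_bounded_onE[OF P] by blast
  have Pv: "Lp_fun p r \<tau> (\<lambda>t. P t (v t))" by (rule Lp_fun_operator(1)[OF p P r(1) _ KP v(1)]) auto
  show ?thesis
  proof (rule Lp_norm_limit_right[OF Pv r(2) p0])
    fix b assume b: "r < b" "b < \<tau>"
    have Pvb: "Lp_fun p r b (\<lambda>t. P t (v t))" by (rule Lp_fun_subinterval[OF Pv]) (use b in auto)
    show "Lp_norm p r b (\<lambda>t. P t (v t)) \<le> c * L * norm d"
    proof (rule Lp_norm_limit_left[OF Pvb b(1) p0])
      have "AE t in lebesgue_on {r..b}. t \<in> {r..b}" by (rule AE_I2) simp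
      moreover have "AE t in lebesgue_on {r..b}. j (v t) = U t r d"
        by (rule AE_lebesgue_on_subset[OF v(2)]) (use b in auto)
      ultimately show "AE q in lebesgue_on {r..b}. Lp_norm p q b (\<lambda>t. P t (v t)) \<le> c * L * norm d"
        using AE_lebesgue_on_neq[where a = r and b = b and c = b]
      proof eventually_elim
        fix q assume q: "q \<in> {r..b}" "j (v q) = U q r d" "q \<noteq> b"
        have "AE t in lebesgue_on {q..b}. t \<in> {q..b}" by (rule AE_I2) simp
        moreover have "AE t in lebesgue_on {q..b}. j (v t) = U t r d"
          by (rule AE_lebesgue_on_subset[OF v(2)]) (use b q in auto)
        ultimately have "AE t in lebesgue_on {q..b}. j (v t) = U t q (j (v q))"
        proof eventually_elim
          fix t assume t: "t \<in> {q..b}" "j (v t) = U t r d"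
          have "U t r = U t q o\<^sub>L U q r"
            using U q t b r unfolding evolution_family_def by auto
          then show "j (v t) = U t q (j (v q))" using t q by simp
        qed
        then have "Lp_norm p q b (\<lambda>t. P t (v t)) \<le> c * norm (j (v q))"
          using q r b by (intro adm Lp_fun_subinterval[OF v(1)]) auto
        also have "\<dots> \<le> c * (L * norm d)"
        proof (rule mult_left_mono[OF _ \<open>c \<ge> 0\<close>])
          have "norm (U q r d) \<le> norm (U q r) * norm d" by (rule norm_blinfun)
          also have "\<dots> \<le> L * norm d" by (rule mult_right_mono) (use L q r b in auto)
          finally show "norm (j (v q)) \<le> L * norm d" using q by simp
        qed
        finally show "Lp_norm p q b (\<lambda>t. P t (v t)) \<le> c * L * norm d" by (simp add: mult.assoc)
      qed
    qed
  qed
qed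

section \<open>Approximation on short intervals\<close>

lemma simple_function_integrable_on:
  fixes F :: "real \<Rightarrow> 'b::banach"
  assumes "simple_function (lebesgue_on {a..b}) F"
  shows "F integrable_on {a..b}"
proof -
  let ?R = "F ` {a..b}" and ?B = "\<lambda>y. F -` {y} \<inter> {a..b}"
  have fin: "finite ?R" using simple_functionD(1)[OF assms] by simp
  have "?B y \<in> lmeasurable" for y
  proof -
    have "?B y \<in> sets (lebesgue_on {a..b})" using simple_functionD(2)[OF assms, of "{y}"] by simp
    then have "?B y \<in> sets lebesgue" by (simp add: sets_restrict_space_iff)
    then show ?thesis by (rule lmeasurable_cbox[of a b, unfolded cbox_interval, THEN fmeasurableI2, rotated]) auto
  qed
  then have "(indicator (?B y) :: real \<Rightarrow> real) integrable_on UNIV" for y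
    by (simp only: lmeasurable_iff_has_integral) (rule has_integral_integrable)
  then have "(indicator (?B y) :: real \<Rightarrow> real) integrable_on {a..b}" for y
    by (rule integrable_on_subcbox[of _ UNIV a b, unfolded box_real]) simp
  then have ind: "(\<lambda>t. indicator (?B y) t *\<^sub>R y) integrable_on {a..b}" for y
    by (rule integrable_on_scaleR_left)
  have "(\<lambda>t. \<Sum>y\<in>?R. indicator (?B y) t *\<^sub>R y) integrable_on {a..b}"
    by (rule integrable_sum[OF fin ind])
  moreover have "(\<Sum>y\<in>?R. indicator (?B y) t *\<^sub>R y) = F t" if "t \<in> {a..b}" for t
  proof -
    have "(\<Sum>y\<in>?R. indicator (?B y) t *\<^sub>R y) = (\<Sum>y\<in>?R. if y = F t then y else 0)"
      using that by (intro sum.cong) (auto simp: indicator_def)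
    then show ?thesis using fin that by (simp add: sum.delta)
  qed
  ultimately show ?thesis by (rule integrable_eq)
qed

text \<open>Simple functions are dense in \<open>L\<^sup>p\<close>, and each of the finitely many values of a simple function may be
  moved into the dense subspace D.\<close>

lemma dense_simple_approximation:
  fixes j :: "'d::banach \<Rightarrow>\<^sub>L 'x::banach"
  assumes j: "dense_embedding j" and p: "p > 1" and f: "Lp_fun p a b f" and "a < b" and e: "e > 0"
  obtains F S where "simple_function (lebesgue_on {a..b}) F" "\<And>t. t \<in> {a..b} \<Longrightarrow> norm (F t) \<le> S" "S \<ge> 0"
    "Lp_norm p a b (\<lambda>t. f t - j (F t)) \<le> e"
proof -
  let ?M = "lebesgue_on {a..b}"
  have p1: "p \<ge> 1" and p0: "p > 0" using p by auto
  obtain s where s: "\<And>n. simple_function ?M (s n)" "AE t in ?M. (\<lambda>n. s n t) \<longlonglongrightarrow> f t"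
    using Lp_fun_sm[OF f] unfolding strongly_measurable_def by auto
  \<comment> \<open>Truncation makes the approximants dominated by \<open>2 * norm (f t)\<close>.\<close>
  define s' where "s' n t = (if norm (s n t - f t) \<le> norm (f t) then s n t else 0)" for n t
  have s': "simple_function ?M (s' n)" for n
    unfolding s'_def
  proof (rule simple_function_If[OF s(1)])
    have "strongly_measurable ?M (\<lambda>t. s n t - f t)"
      by (rule strongly_measurable_diff[OF strongly_measurable_simple[OF s(1)] Lp_fun_sm[OF f]])
    then have "(\<lambda>t. norm (s n t - f t)) \<in> borel_measurable ?M"
      by (rule strongly_measurable_imp_borel[OF lebesgue_on_complete, rotated]) (auto intro!: continuous_intros)
    moreover have "(\<lambda>t. norm (f t)) \<in> borel_measurable ?M"
      by (rule strongly_measurable_imp_borel[OF lebesgue_on_complete Lp_fun_sm[OF f]]) (auto intro!: continuous_intros)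
    ultimately show "{t \<in> space ?M. norm (s n t - f t) \<le> norm (f t)} \<in> sets ?M" by (rule borel_measurable_le)
  qed simp
  have dom: "norm (f t - s' n t) \<le> norm (f t)" for n t by (auto simp: s'_def norm_minus_commute)
  have lim: "AE t in ?M. (\<lambda>n. norm (f t - s' n t) powr p) \<longlonglongrightarrow> 0"
    using s(2)
  proof eventually_elim
    fix t assume t: "(\<lambda>n. s n t) \<longlonglongrightarrow> f t"
    have "(\<lambda>n. norm (f t - s' n t)) \<longlonglongrightarrow> 0"
    proof (cases "f t = 0")
      case True
      then have "norm (f t - s' n t) = 0" for n using dom[of t n] by simp
      then show ?thesis by simp
    next
      case False
      have t': "(\<lambda>n. norm (s n t - f t)) \<longlonglongrightarrow> 0" using t by (simp add: tendsto_norm_zero LIM_zero)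
      then have "\<forall>\<^sub>F n in sequentially. norm (s n t - f t) < norm (f t)"
        by (rule order_tendstoD(2)) (use False in simp)
      then have "\<forall>\<^sub>F n in sequentially. norm (s n t - f t) = norm (f t - s' n t)"
        by eventually_elim (auto simp: s'_def norm_minus_commute)
      then show ?thesis by (rule Lim_transform_eventually[OF t'])
    qed
    then have "(\<lambda>n. norm (f t - s' n t) powr p) \<longlonglongrightarrow> 0 powr p"
      using p0 by (intro tendsto_powr' tendsto_const) auto
    then show "(\<lambda>n. norm (f t - s' n t) powr p) \<longlonglongrightarrow> 0" using p0 by simp
  qed
  have sm: "strongly_measurable ?M (\<lambda>t. f t - s' n t)" for n
    by (rule strongly_measurable_diff[OF Lp_fun_sm[OF f] strongly_measurable_simple[OF s']])
  have Lp: "Lp_fun p a b (\<lambda>t. f t - s' n t)" for n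
    using Lp_fun_le(1)[OF p1 sm f, of 1] dom by simp
  have "(\<lambda>n. integral\<^sup>L ?M (\<lambda>t. norm (f t - s' n t) powr p)) \<longlonglongrightarrow> integral\<^sup>L ?M (\<lambda>t. 0)"
  proof (rule integral_dominated_convergence[OF _ _ _ lim])
    show "integrable ?M (\<lambda>t. norm (f t) powr p)" using f by (simp add: Lp_fun_def)
    show "AE t in ?M. norm (norm (f t - s' n t) powr p) \<le> norm (f t) powr p" for n
      using dom p0 by (auto intro!: powr_mono2)
    show "(\<lambda>t. norm (f t - s' n t) powr p) \<in> borel_measurable ?M" for n
      by (rule sm_norm_powr_measurable[OF sm p0])
  qed simp
  then have "(\<lambda>n. Lp_mass p a b (\<lambda>t. f t - s' n t)) \<longlonglongrightarrow> 0"
    by (simp add: Lp_mass_lebesgue[OF Lp])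
  then have "\<forall>\<^sub>F n in sequentially. Lp_mass p a b (\<lambda>t. f t - s' n t) < (e / 2) powr p"
    by (rule order_tendstoD(2)) (use e in simp)
  then obtain n where "Lp_mass p a b (\<lambda>t. f t - s' n t) < (e / 2) powr p" by (auto dest: eventually_happens)
  then have n: "Lp_norm p a b (\<lambda>t. f t - s' n t) \<le> e / 2"
    by (subst Lp_norm_le_iff) (use e p0 in auto)
  define k where "k = e / (2 * (b - a) powr (1 / p))"
  have k: "k > 0" using e \<open>a < b\<close> by (simp add: k_def)
  have "\<exists>x. norm (y - j x) \<le> k" for y
  proof -
    have "y \<in> closure (range (blinfun_apply j))" using j by (simp add: dense_embedding_def)
    then obtain z where "z \<in> range (blinfun_apply j)" "dist z y < k" using k unfolding closure_approachable by blast
    then show ?thesis by (auto simp: dist_norm norm_minus_commute intro!: less_imp_le)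
  qed
  then obtain q where q: "\<And>y. norm (y - j (q y)) \<le> k" by metis
  define F where "F t = q (s' n t)" for t
  have F: "simple_function ?M F" unfolding F_def by (rule simple_function_compose1[OF s'])
  have "finite (F ` {a..b})" using simple_functionD(1)[OF F] by simp
  then have "bounded (F ` {a..b})" by (rule finite_imp_bounded)
  then obtain S where S: "S > 0" "\<forall>x\<in>F ` {a..b}. norm x \<le> S" unfolding bounded_pos by auto
  have smF: "strongly_measurable ?M (\<lambda>t. s' n t - j (F t))"
    by (intro strongly_measurable_diff strongly_measurable_blinfun strongly_measurable_simple s' F)
  have "AE t in ?M. norm (s' n t - j (F t)) \<le> k" using q by (simp add: F_def)
  note close = Lp_fun_bounded[OF p1 smF less_imp_le[OF k] less_imp_le[OF \<open>a < b\<close>] this]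
  have "k * (b - a) powr (1 / p) = e / 2" using \<open>a < b\<close> by (simp add: k_def)
  then have "Lp_norm p a b (\<lambda>t. (f t - s' n t) + (s' n t - j (F t))) \<le> e"
    using Lp_fun_add(2)[OF p1 Lp[of n] close(1)] close(2) n by linarith
  then show thesis using that[OF F, of S] S by simp
qed

text \<open>If the right-hand side is close to \<open>j F\<close> with F simple and D-valued, the solution is close to the primitive W
  of F, which is of the order of the length of the interval in D: the difference \<open>z - j W\<close> starts at zero and has
  the right-hand side \<open>f - j F - A W\<close>, where \<open>f = g + A v\<close>.\<close>

lemma short_interval_remainder:
  assumes p: "p > 1" and ab: "0 \<le> a" "a < b" "b \<le> \<tau>"
    and A: "strongly_measurable_bounded_on \<tau> A" and K: "\<And>t. t \<in> {0..\<tau>} \<Longrightarrow> norm (A t) \<le> K" "K \<ge> 0"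
    and reg: "regularity_bound j p A a b M" and M: "M \<ge> 0"
    and tr: "MR_triple j p a b z g v" and za: "z a = 0"
    and F: "simple_function (lebesgue_on {a..b}) F" "\<And>t. t \<in> {a..b} \<Longrightarrow> norm (F t) \<le> S" "S \<ge> 0"
  shows "Lp_norm p a b v \<le> M * Lp_norm p a b (\<lambda>t. g t + A t (v t) - j (F t))
    + (M * K + 1) * (S * (b - a)) * (b - a) powr (1 / p)"
proof -
  have p1: "p \<ge> 1" using p by simp
  define W where "W t = integral {a..t} F" for t
  have Fint: "F integrable_on {a..b}" by (rule simple_function_integrable_on[OF F(1)])
  then have FW: "(F has_integral W t) {a..t}" if "t \<in> {a..b}" for t
    unfolding W_def using that integrable_subinterval_real[OF Fint, of a t] by (auto intro: integrable_integral)
  have "continuous_on {a..b} W" unfolding W_def by (rule indefinite_integral_continuous_1[OF Fint])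
  then have Wsm: "strongly_measurable (lebesgue_on {a..b}) W" by (rule continuous_on_strongly_measurable)
  have WS: "norm (W t) \<le> S * (b - a)" if t: "t \<in> {a..b}" for t
  proof -
    have "norm (W t) \<le> S * (t - a)"
      using has_integral_bound_real[OF F(3) finite.emptyI FW[OF t]] F(2) t by auto
    also have "\<dots> \<le> S * (b - a)" by (rule mult_left_mono) (use t F(3) in auto)
    finally show ?thesis .
  qed
  then have "AE t in lebesgue_on {a..b}. norm (W t) \<le> S * (b - a)" by (auto intro!: AE_I2)
  note WLp = Lp_fun_bounded[OF p1 Wsm _ _ this]
  have "AE t in lebesgue_on {a..b}. norm (F t) \<le> S" using F(2) by (auto intro!: AE_I2)
  note FLp = Lp_fun_bounded(1)[OF p1 strongly_measurable_simple[OF F(1)] F(3) _ this]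
  have trW: "MR_triple j p a b (\<lambda>t. j (W t)) (\<lambda>t. j (F t)) W"
    unfolding MR_triple_def W1p_deriv_def
  proof (intro conjI ballI)
    show "Lp_fun p a b W" "Lp_fun p a b (\<lambda>t. j (W t))" "Lp_fun p a b (\<lambda>t. j (F t))"
      using WLp(1) FLp ab F(3) by (auto intro!: Lp_fun_blinfun(1)[OF p1])
    show "((\<lambda>t. j (F t)) has_integral j (W t) - j (W a)) {a..t}" if "t \<in> {a..b}" for t
      using has_integral_linear[OF FW[OF that] blinfun.bounded_linear_right[of j]]
      by (simp add: comp_def W_def blinfun.zero_right)
  qed simp
  have Av: "Lp_fun p a b (\<lambda>t. A t (x t))" "Lp_norm p a b (\<lambda>t. A t (x t)) \<le> K * Lp_norm p a b x"
    if "Lp_fun p a b x" for x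
    using Lp_fun_operator[OF p1 A ab(1,3) K that] by auto
  have vLp: "Lp_fun p a b v" "Lp_fun p a b g" using MR_tripleD(2,3)[OF tr] by auto
  have WL: "Lp_fun p a b W" "Lp_norm p a b W \<le> S * (b - a) * (b - a) powr (1 / p)"
    using WLp ab F(3) by auto
  let ?h = "\<lambda>t. g t + A t (v t) - j (F t)"
  have hLp: "Lp_fun p a b ?h"
    by (intro Lp_fun_diff(1)[OF p1] Lp_fun_add(1)[OF p1] vLp Av(1) Lp_fun_blinfun(1)[OF p1] FLp) (use ab in auto)
  have "Lp_norm p a b (\<lambda>t. v t - W t) \<le> M * Lp_norm p a b (\<lambda>t. (g t - j (F t)) + A t (v t - W t))"
    using reg MR_triple_diff[OF p1 tr trW] za unfolding regularity_bound_def
    by (auto simp: W_def blinfun.zero_right)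
  also have "(\<lambda>t. (g t - j (F t)) + A t (v t - W t)) = (\<lambda>t. ?h t - A t (W t))"
    by (simp add: fun_eq_iff blinfun.diff_right)
  also have "M * Lp_norm p a b \<dots> \<le> M * (Lp_norm p a b ?h + K * (S * (b - a) * (b - a) powr (1 / p)))"
    using Lp_fun_diff(2)[OF p1 hLp Av(1)[OF WL(1)]] Av(2)[OF WL(1)] mult_left_mono[OF WL(2) K(2)]
    by (intro mult_left_mono M) linarith
  finally have "Lp_norm p a b (\<lambda>t. v t - W t) \<le> M * (Lp_norm p a b ?h + K * (S * (b - a) * (b - a) powr (1 / p)))" .
  moreover have "Lp_norm p a b (\<lambda>t. (v t - W t) + W t) \<le> Lp_norm p a b (\<lambda>t. v t - W t) + Lp_norm p a b W"
    by (rule Lp_fun_add(2)[OF p1 Lp_fun_diff(1)[OF p1 vLp(1) WL(1)] WL(1)])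
  ultimately show ?thesis using WL(2) by (simp add: algebra_simps)
qed

text \<open>The \<open>\<rho> k\<close> combine like norms of functions with disjoint supports, whereas the \<open>D k\<close> are added. This is
  the bookkeeping of the telescoping over a grid.\<close>

lemma powr_recursion_bound:
  fixes X \<rho> D :: "nat \<Rightarrow> real"
  assumes p: "p \<ge> 1" and nn: "\<And>k. X k \<ge> 0" "\<And>k. \<rho> k \<ge> 0" "\<And>k. D k \<ge> 0" and XN: "X N = 0"
    and rec: "\<And>k. k < N \<Longrightarrow> X k powr p \<le> \<rho> k powr p + (X (Suc k) + D k) powr p"
  shows "X 0 \<le> (\<Sum>k<N. \<rho> k powr p) powr (1 / p) + (\<Sum>k<N. D k)"
proof -
  have "X k \<le> (\<Sum>i=k..<N. \<rho> i powr p) powr (1 / p) + (\<Sum>i=k..<N. D i)" if "k \<le> N" for k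
    using that
  proof (induction k rule: inc_induct)
    case base
    then show ?case using XN by simp
  next
    case (step k)
    let ?Q = "(\<Sum>i=Suc k..<N. \<rho> i powr p) powr (1 / p)" and ?E = "\<Sum>i=Suc k..<N. D i"
    have sum0: "(\<Sum>i=Suc k..<N. \<rho> i powr p) \<ge> 0" by (rule sum_nonneg) simp
    have E0: "?E \<ge> 0" by (rule sum_nonneg) (rule nn)
    have "X k powr p \<le> \<rho> k powr p + (X (Suc k) + D k) powr p" by (rule rec[OF step(2)])
    also have "\<dots> \<le> \<rho> k powr p + (?Q + (?E + D k)) powr p"
      using step(3) nn(1)[of "Suc k"] nn(3)[of k] p by (intro add_left_mono powr_mono2) auto
    also have "\<dots> \<le> ((\<rho> k powr p + ?Q powr p) powr (1 / p) + (?E + D k)) powr p"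
      by (rule powr_add_le_powr_sum) (use p nn E0 in auto)
    also have "?Q powr p = (\<Sum>i=Suc k..<N. \<rho> i powr p)" using p sum0 by (simp add: powr_powr)
    finally have "X k powr p \<le> ((\<rho> k powr p + (\<Sum>i=Suc k..<N. \<rho> i powr p)) powr (1 / p) + (?E + D k)) powr p" .
    then have "X k \<le> (\<rho> k powr p + (\<Sum>i=Suc k..<N. \<rho> i powr p)) powr (1 / p) + (?E + D k)"
    proof (rule contrapos_pp)
      assume "\<not> ?thesis"
      then show "\<not> X k powr p \<le> ((\<rho> k powr p + (\<Sum>i=Suc k..<N. \<rho> i powr p)) powr (1 / p) + (?E + D k)) powr p"
        using powr_less_mono2[of p "(\<rho> k powr p + (\<Sum>i=Suc k..<N. \<rho> i powr p)) powr (1 / p) + (?E + D k)" "X k"] p E0 nn(3)[of k]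
        by (simp add: not_le)
    qed
    then show ?case using step(2) by (simp add: sum.atLeast_Suc_lessThan algebra_simps)
  qed
  from this[of 0] show ?thesis by (simp add: atLeast0LessThan)
qed

lemma Lp_mass_grid:
  assumes f: "Lp_fun p a b f" and "a \<le> b" and r: "\<And>k. r k = a + real k * ((b - a) / real N)" and "N > 0"
  shows "(\<Sum>k<N. Lp_mass p (r k) (r (Suc k)) f) = Lp_mass p a b f"
proof -
  let ?\<delta> = "(b - a) / real N"
  have \<delta>: "?\<delta> \<ge> 0" using assms by simp
  have rb: "r n \<le> b" "a \<le> r n" if "n \<le> N" for n
  proof -
    have "real n * ?\<delta> \<le> real N * ?\<delta>" by (rule mult_right_mono[OF _ \<delta>]) (use that in simp)
    then show "r n \<le> b" unfolding r using \<open>N > 0\<close> by simp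
    show "a \<le> r n" unfolding r using mult_nonneg_nonneg[OF _ \<delta>, of "real n"] by simp
  qed
  have "(\<Sum>k<n. Lp_mass p (r k) (r (Suc k)) f) = Lp_mass p a (r n) f" if "n \<le> N" for n
    using that
  proof (induction n)
    case 0
    then show ?case by (simp add: r Lp_mass_def)
  next
    case (Suc n)
    have step: "r n \<le> r (Suc n)" unfolding r by (intro add_left_mono mult_right_mono \<delta>) simp
    have "Lp_mass p a (r n) f + Lp_mass p (r n) (r (Suc n)) f = Lp_mass p a (r (Suc n)) f"
      by (rule Lp_mass_combine[OF Lp_fun_subinterval[OF f]]) (use rb Suc.prems step in auto)
    then show ?case using Suc by simp
  qed
  from this[of N] show ?thesis using \<open>N > 0\<close> by (simp add: r)
qed

section \<open>Observation of solutions of the inhomogeneous problem\<close>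

lemma solves_homogeneousD:
  assumes "inj (blinfun_apply j)" "p \<ge> 1" "solves_homogeneous j \<tau> p A U" "r \<in> {0..<\<tau>}" "d \<in> trace_space j p r \<tau>"
  shows "\<exists>g v. MR_triple j p r \<tau> (\<lambda>t. U t r d) g v \<and> (AE t in lebesgue_on {r..\<tau>}. g t + A t (v t) = 0)"
proof -
  have "cauchy_solution j p r \<tau> A (\<lambda>_. 0) d (\<lambda>t. U t r d)"
    using assms(3-5) unfolding solves_homogeneous_def unique_cauchy_solution_def by blast
  then show ?thesis unfolding cauchy_solution_iff[OF assms(1,2)] by blast
qed

lemma add_powr_le_two_powr:
  fixes x y p :: real
  assumes "p \<ge> 1" "x \<ge> 0" "y \<ge> 0"
  shows "(x + y) powr p \<le> 2 powr p * (x powr p + y powr p)"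
proof -
  have "(x + y) powr p \<le> 2 powr p * (1/2 * x powr p + 1/2 * y powr p)"
    using add_powr_le[OF assms, of 1 1] by simp
  also have "\<dots> \<le> 2 powr p * (x powr p + y powr p)" by (intro mult_left_mono add_mono) auto
  finally show ?thesis .
qed

text \<open>By the variation of constants formula w is the superposition of the orbits that start from the values of \<open>f = g + A v\<close>,
  so the bound C for observing an orbit should give C times the integral of the norm of f. The formula itself is
  avoided by comparing, on a grid with N intervals, the functions \<open>z q = w - U(\<cdot>,q)w(q)\<close> for consecutive grid points
  \<open>q < q'\<close>: after \<open>q'\<close> they differ by the orbit of the increment \<open>z q q'\<close>, which is estimated
  through the regularity bound (\<open>increment\<close>, \<open>telescope\<close>). What remains are the contributions of \<open>z q\<close> on \<open>[q,q']\<close>,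
  which vanish as N tends to infinity by \<open>short_interval_remainder\<close>. The parameter \<open>l\<close> is that of
  \<open>norm_integrable_Lp\<close>, to be chosen later.\<close>

lemma observation_of_inhomogeneous_solution:
  fixes j :: "'d::banach \<Rightarrow>\<^sub>L 'x::banach"
  assumes dj: "dense_embedding j" and p: "p > 1"
    and A: "strongly_measurable_bounded_on \<tau> A" and KA: "\<And>t. t \<in> {0..\<tau>} \<Longrightarrow> norm (A t) \<le> KA" "KA \<ge> 0"
    and P: "strongly_measurable_bounded_on \<tau> P"
    and reg: "\<And>a b. 0 \<le> a \<Longrightarrow> a < b \<Longrightarrow> b \<le> \<tau> \<Longrightarrow> b - a \<le> h \<Longrightarrow> regularity_bound j p A a b M" and M: "M \<ge> 0"
    and U: "evolution_family \<tau> U" and solves: "solves_homogeneous j \<tau> p A U"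
    and obs: "\<And>r d v. 0 \<le> r \<Longrightarrow> r < \<tau> \<Longrightarrow> Lp_fun p r \<tau> v \<Longrightarrow>
      (AE t in lebesgue_on {r..\<tau>}. j (v t) = U t r d) \<Longrightarrow> Lp_norm p r \<tau> (\<lambda>t. P t (v t)) \<le> C * norm d"
    and C: "C \<ge> 0"
    and sb: "0 \<le> s" "s < b" "b \<le> \<tau>" "b - s \<le> h"
    and w: "MR_triple j p s \<tau> w g v" "w s = 0" and l: "l > 0"
  shows "Lp_norm p s b (\<lambda>t. P t (v t)) \<le>
    C * (l * (b - s) + l powr (1 - p) * ((1 + KA * M) powr p * Lp_mass p s b (\<lambda>t. g t + A t (v t))))"
proof -
  have p1: "p \<ge> 1" and p0: "p > 0" using p by auto
  have j: "inj (blinfun_apply j)" using dj by (simp add: dense_embedding_def)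
  obtain KP where KP: "\<And>t. t \<in> {0..\<tau>} \<Longrightarrow> norm (P t) \<le> KP" "KP \<ge> 0" using strongly_measurable_bounded_onE[OF P] by blast
  have opA: "Lp_fun p a c (\<lambda>t. A t (x t))" "Lp_norm p a c (\<lambda>t. A t (x t)) \<le> KA * Lp_norm p a c x"
    if "0 \<le> a" "c \<le> \<tau>" "Lp_fun p a c x" for a c x
    using Lp_fun_operator[OF p1 A that(1,2) KA that(3)] by auto
  have opP: "Lp_fun p a c (\<lambda>t. P t (x t))" "Lp_norm p a c (\<lambda>t. P t (x t)) \<le> KP * Lp_norm p a c x"
    if "0 \<le> a" "c \<le> \<tau>" "Lp_fun p a c x" for a c x
    using Lp_fun_operator[OF p1 P that(1,2) KP that(3)] by auto
  define f where "f t = g t + A t (v t)" for t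
  have fLp: "Lp_fun p s \<tau> f"
    unfolding f_def[abs_def] using MR_tripleD(2,3)[OF w(1)] sb by (intro Lp_fun_add(1)[OF p1] opA) auto
  then have fb: "Lp_fun p s b f" by (rule Lp_fun_subinterval) (use sb in auto)
  \<comment> \<open>\<open>z q\<close> is the part of \<open>w\<close> that the right-hand side has created after time \<open>q\<close>.\<close>
  have "\<forall>q\<in>{s..<\<tau>}. \<exists>g v. MR_triple j p q \<tau> (\<lambda>t. U t q (w q)) g v \<and> (AE t in lebesgue_on {q..\<tau>}. g t + A t (v t) = 0)"
    using solves_homogeneousD[OF j p1 solves] MR_triple_start_in_trace_space[OF j p1 w(1)] sb by auto
  then obtain gU vU where "\<forall>q\<in>{s..<\<tau>}. MR_triple j p q \<tau> (\<lambda>t. U t q (w q)) (gU q) (vU q) \<and>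
      (AE t in lebesgue_on {q..\<tau>}. gU q t + A t (vU q t) = 0)"
    unfolding bchoice_iff by (elim exE)
  then have hom: "MR_triple j p q \<tau> (\<lambda>t. U t q (w q)) (gU q) (vU q)"
      "AE t in lebesgue_on {q..\<tau>}. gU q t + A t (vU q t) = 0" if "q \<in> {s..<\<tau>}" for q
    using that by (simp_all only: Ball_def)
  define z gz vz where "z q t = w t - U t q (w q)" and "gz q t = g t - gU q t" and "vz q t = v t - vU q t" for q t
  have ztr: "MR_triple j p q \<tau> (z q) (gz q) (vz q)" if "q \<in> {s..<\<tau>}" for q
    unfolding z_def[abs_def] gz_def[abs_def] vz_def[abs_def]
    by (rule MR_triple_diff[OF p1 MR_triple_subinterval[OF w(1)] hom(1)[OF that]]) (use that in auto)
  have zq: "z q q = 0" if "q \<in> {s..<\<tau>}" for q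
    using U that sb(1) by (auto simp: z_def evolution_family_def)
  have zeq: "AE t in lebesgue_on {q..\<tau>}. gz q t + A t (vz q t) = f t" if "q \<in> {s..<\<tau>}" for q
    using hom(2)[OF that] by eventually_elim (simp add: gz_def vz_def f_def blinfun.diff_right algebra_simps)
  have zshort: "MR_triple j p q q' (z q) (gz q) (vz q)"
      "AE t in lebesgue_on {q..q'}. gz q t + A t (vz q t) = f t"
      "Lp_fun p q q' (vz q)" "Lp_fun p q q' f"
    if "q \<in> {s..<\<tau>}" "q < q'" "q' \<le> \<tau>" for q q'
  proof -
    show "MR_triple j p q q' (z q) (gz q) (vz q)" by (rule MR_triple_subinterval[OF ztr[OF that(1)]]) (use that in auto)
    then show "Lp_fun p q q' (vz q)" by (rule MR_tripleD(3))
    show "AE t in lebesgue_on {q..q'}. gz q t + A t (vz q t) = f t"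
      by (rule AE_lebesgue_on_subset[OF zeq[OF that(1)]]) (use that in auto)
    show "Lp_fun p q q' f" by (rule Lp_fun_subinterval[OF fLp]) (use that in auto)
  qed
  have increment: "norm (z q q') \<le> l * (q' - q) + l powr (1 - p) * ((1 + KA * M) powr p * Lp_mass p q q' f)"
    if q: "q \<in> {s..<\<tau>}" "q < q'" "q' \<le> \<tau>" "q' - q \<le> h" for q q'
  proof -
    note zs = zshort[OF q(1-3)]
    have q0: "0 \<le> q" using q sb by auto
    have "Lp_norm p q q' (vz q) \<le> M * Lp_norm p q q' (\<lambda>t. gz q t + A t (vz q t))"
      using reg[OF q0 q(2,3,4)] zs(1) zq[OF q(1)] unfolding regularity_bound_def by blast
    also have "Lp_norm p q q' (\<lambda>t. gz q t + A t (vz q t)) = Lp_norm p q q' f"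
      by (rule Lp_fun_AE_cong(2)[OF zs(4) _ p1]) (use zs(2) in \<open>auto elim: eventually_mono\<close>)
    finally have vM: "Lp_norm p q q' (vz q) \<le> M * Lp_norm p q q' f" .
    have Av: "Lp_fun p q q' (\<lambda>t. A t (vz q t))" "Lp_norm p q q' (\<lambda>t. A t (vz q t)) \<le> KA * Lp_norm p q q' (vz q)"
      using opA[OF q0 q(3) zs(3)] by auto
    have "AE t in lebesgue_on {q..q'}. f t - A t (vz q t) = gz q t"
      using zs(2) by eventually_elim (simp add: algebra_simps)
    then have "Lp_norm p q q' (gz q) = Lp_norm p q q' (\<lambda>t. f t - A t (vz q t))"
      by (rule Lp_fun_AE_cong(2)[OF Lp_fun_diff(1)[OF p1 zs(4) Av(1)] _ p1])
    also have "\<dots> \<le> Lp_norm p q q' f + KA * (M * Lp_norm p q q' f)"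
      using Lp_fun_diff(2)[OF p1 zs(4) Av(1)] Av(2) mult_left_mono[OF vM KA(2)] by linarith
    finally have "Lp_norm p q q' (gz q) \<le> (1 + KA * M) * Lp_norm p q q' f" by (simp add: algebra_simps)
    then have "Lp_mass p q q' (gz q) \<le> ((1 + KA * M) * Lp_norm p q q' f) powr p"
      using KA(2) M by (subst Lp_norm_le_iff[OF p0, symmetric]) auto
    then have mass: "Lp_mass p q q' (gz q) \<le> (1 + KA * M) powr p * Lp_mass p q q' f"
      using p0 by (simp add: powr_mult Lp_norm_powr)
    have "norm (z q q') \<le> l * (q' - q) + l powr (1 - p) * Lp_mass p q q' (gz q)"
      using MR_triple_growth[OF p1 zs(1) _ l, of q'] zq[OF q(1)] q(2) by simp
    also have "\<dots> \<le> l * (q' - q) + l powr (1 - p) * ((1 + KA * M) powr p * Lp_mass p q q' f)"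
      by (intro add_left_mono mult_left_mono mass) simp
    finally show ?thesis .
  qed
  have telescope: "Lp_norm p q' b (\<lambda>t. P t (vz q t)) \<le> Lp_norm p q' b (\<lambda>t. P t (vz q' t)) + C * norm (z q q')"
    if q: "q \<in> {s..<\<tau>}" "q < q'" "q' < b" for q q'
  proof -
    have q': "q' \<in> {s..<\<tau>}" "0 \<le> q'" "0 \<le> q" using q sb by auto
    define y where "y t = vz q t - vz q' t" for t
    have zq': "MR_triple j p q' \<tau> (z q) (gz q) (vz q)"
      by (rule MR_triple_subinterval[OF ztr[OF q(1)]]) (use q sb in auto)
    have yLp: "Lp_fun p q' \<tau> y"
      unfolding y_def[abs_def] by (rule Lp_fun_diff(1)[OF p1 MR_tripleD(3)[OF zq'] MR_tripleD(3)[OF ztr[OF q'(1)]]])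
    have "AE t in lebesgue_on {q'..\<tau>}. t \<in> {q'..\<tau>}" by (rule AE_I2) simp
    then have "AE t in lebesgue_on {q'..\<tau>}. j (y t) = U t q' (z q q')"
      using MR_tripleD(4)[OF zq'] MR_tripleD(4)[OF ztr[OF q'(1)]]
    proof eventually_elim
      fix t assume t: "t \<in> {q'..\<tau>}" "j (vz q t) = z q t" "j (vz q' t) = z q' t"
      have "U t q = U t q' o\<^sub>L U q' q"
        using U t q q' unfolding evolution_family_def by auto
      then show "j (y t) = U t q' (z q q')"
        using t(2,3) by (simp add: y_def z_def blinfun.diff_right)
    qed
    from obs[OF q'(2) _ yLp this] have "Lp_norm p q' \<tau> (\<lambda>t. P t (y t)) \<le> C * norm (z q q')" using q' by simp
    moreover have "Lp_norm p q' b (\<lambda>t. P t (y t)) \<le> Lp_norm p q' \<tau> (\<lambda>t. P t (y t))"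
      by (rule Lp_norm_mono[OF opP(1)[OF q'(2) _ yLp]]) (use sb p0 in auto)
    ultimately have yC: "Lp_norm p q' b (\<lambda>t. P t (y t)) \<le> C * norm (z q q')" by linarith
    have Lps: "Lp_fun p q' b y" "Lp_fun p q' b (vz q')"
      using Lp_fun_subinterval[OF yLp] Lp_fun_subinterval[OF MR_tripleD(3)[OF ztr[OF q'(1)]]] sb by auto
    have "Lp_norm p q' b (\<lambda>t. P t (vz q' t) + P t (y t)) \<le> Lp_norm p q' b (\<lambda>t. P t (vz q' t)) + Lp_norm p q' b (\<lambda>t. P t (y t))"
      by (rule Lp_fun_add(2)[OF p1 opP(1) opP(1)]) (use q' sb Lps in auto)
    moreover have "(\<lambda>t. P t (vz q' t) + P t (y t)) = (\<lambda>t. P t (vz q t))"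
      by (simp add: y_def fun_eq_iff blinfun.diff_right)
    ultimately show ?thesis using yC by simp
  qed
  define E where "E = C * (l * (b - s) + l powr (1 - p) * ((1 + KA * M) powr p * Lp_mass p s b f))"
  have grid: "Lp_norm p s b (\<lambda>t. P t (v t)) \<le>
      ((2 * KP) powr p * (M powr p * \<epsilon> powr p + ((M * KA + 1) * S * (b - s) / real N) powr p * (b - s))) powr (1 / p) + E"
    if F: "simple_function (lebesgue_on {s..b}) F" "\<And>t. t \<in> {s..b} \<Longrightarrow> norm (F t) \<le> S" "S \<ge> 0"
      "Lp_norm p s b (\<lambda>t. f t - j (F t)) \<le> \<epsilon>" "\<epsilon> \<ge> 0" and N: "N > 0" for F S \<epsilon> and N :: nat
  proof -
    define \<delta> where "\<delta> = (b - s) / real N"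
    have \<delta>: "\<delta> > 0" "real N * \<delta> = b - s" using sb N by (auto simp: \<delta>_def)
    define r where "r k = s + real k * \<delta>" for k
    have rS: "r (Suc k) = r k + \<delta>" for k by (simp add: r_def algebra_simps)
    have rb: "s \<le> r k" "r k < b" "r (Suc k) \<le> b" if "k < N" for k
    proof -
      have "real k * \<delta> < real N * \<delta>" "real (Suc k) * \<delta> \<le> real N * \<delta>"
        using that \<delta>(1) by (intro mult_strict_right_mono mult_right_mono; simp)+
      then show "s \<le> r k" "r k < b" "r (Suc k) \<le> b" using \<delta> by (auto simp: r_def)
    qed
    have rin: "r k \<in> {s..<\<tau>}" "0 \<le> r k" "r k < r (Suc k)" "r (Suc k) \<le> \<tau>" "r (Suc k) - r k \<le> h" if "k < N" for k
    proof -
      have "\<delta> \<le> b - s" using rb[OF N] rS[of 0] by (simp add: r_def)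
      then show "r k \<in> {s..<\<tau>}" "0 \<le> r k" "r k < r (Suc k)" "r (Suc k) \<le> \<tau>" "r (Suc k) - r k \<le> h"
        using rb[OF that] \<delta> sb by (auto simp: rS)
    qed
    have rgrid: "r k = s + real k * ((b - s) / real N)" for k by (simp add: r_def \<delta>_def)
    define e where "e t = f t - j (F t)" for t
    have jF: "Lp_fun p s b (\<lambda>t. j (F t))"
    proof (rule Lp_fun_blinfun(1)[OF p1 Lp_fun_bounded(1)[OF p1 strongly_measurable_simple[OF F(1)] F(3)]])
      show "AE t in lebesgue_on {s..b}. norm (F t) \<le> S" using F(2) by (auto intro!: AE_I2)
    qed (use sb in simp)
    have eLp: "Lp_fun p s b e" unfolding e_def[abs_def] by (rule Lp_fun_diff(1)[OF p1 fb jF])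
    define B where "B = (M * KA + 1) * S"
    have B: "B \<ge> 0" using M KA(2) F(3) by (simp add: B_def)
    \<comment> \<open>\<open>X k\<close> observes \<open>z (r k)\<close> on all of \<open>[r k, b]\<close>, \<open>\<rho> k\<close> on the first grid interval only.\<close>
    define X where "X k = (if k < N then Lp_norm p (r k) b (\<lambda>t. P t (vz (r k) t)) else 0)" for k
    define \<rho> where "\<rho> k = Lp_norm p (r k) (r (Suc k)) (\<lambda>t. P t (vz (r k) t))" for k
    define D where "D k = C * norm (z (r k) (r (Suc k)))" for k
    \<comment> \<open>Nothing is left to observe after the last grid point, so \<open>X N\<close> is zero.\<close>
    have "X 0 \<le> (\<Sum>k<N. \<rho> k powr p) powr (1 / p) + (\<Sum>k<N. D k)"
    proof (rule powr_recursion_bound[OF p1])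
      fix k assume k: "k < N"
      note rk = rb[OF k] rin[OF k]
      have Pv: "Lp_fun p (r k) b (\<lambda>t. P t (vz (r k) t))"
        using zshort(3)[OF rk(4) rk(2) sb(3)] rk sb by (intro opP) auto
      have "Lp_norm p (r (Suc k)) b (\<lambda>t. P t (vz (r k) t)) \<le> X (Suc k) + D k"
      proof (cases "Suc k < N")
        case True
        then show ?thesis using telescope[OF rk(4,6) rb(2)[OF True]] by (simp add: X_def D_def)
      next
        case False
        then have "Suc k = N" using k by simp
        then have "r (Suc k) = b" using \<delta> by (simp add: r_def)
        then show ?thesis using C False by (simp add: X_def D_def Lp_norm_def Lp_mass_def)
      qed
      then have "Lp_mass p (r (Suc k)) b (\<lambda>t. P t (vz (r k) t)) \<le> (X (Suc k) + D k) powr p"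
        using p0 Lp_norm_nonneg order_trans by (metis Lp_norm_le_iff)
      moreover have "X k powr p = \<rho> k powr p + Lp_mass p (r (Suc k)) b (\<lambda>t. P t (vz (r k) t))"
        using Lp_mass_combine[OF Pv, of "r (Suc k)"] rk k p0 by (simp add: X_def \<rho>_def Lp_norm_powr)
      ultimately show "X k powr p \<le> \<rho> k powr p + (X (Suc k) + D k) powr p" by linarith
    qed (use C in \<open>auto simp: X_def \<rho>_def D_def\<close>)
    moreover have "(\<Sum>k<N. D k) \<le> E"
    proof -
      have "(\<Sum>k<N. D k) \<le> (\<Sum>k<N. C * (l * \<delta> + l powr (1 - p) * ((1 + KA * M) powr p * Lp_mass p (r k) (r (Suc k)) f)))"
        unfolding D_def using increment[OF rin(1) rin(3) rin(4) rin(5)] by (intro sum_mono mult_left_mono C) (simp add: rS)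
      also have "\<dots> = C * (l * (real N * \<delta>) + l powr (1 - p) * ((1 + KA * M) powr p * (\<Sum>k<N. Lp_mass p (r k) (r (Suc k)) f)))"
        by (simp add: sum_distrib_left sum.distrib algebra_simps)
      also have "\<dots> = E" unfolding Lp_mass_grid[OF fb less_imp_le[OF sb(2)] rgrid N] \<delta>(2) E_def ..
      finally show ?thesis .
    qed
    moreover have "(\<Sum>k<N. \<rho> k powr p) \<le> (2 * KP) powr p * (M powr p * \<epsilon> powr p + (B * \<delta>) powr p * (b - s))"
    proof -
      have \<rho>: "\<rho> k powr p \<le> (2 * KP) powr p * (M powr p * Lp_mass p (r k) (r (Suc k)) e + (B * \<delta>) powr p * \<delta>)" if k: "k < N" for k
      proof -
        note rk = rb[OF k] rin[OF k]
        note zs = zshort[OF rk(4,6,7)]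
        have F': "simple_function (lebesgue_on {r k..r (Suc k)}) F"
        proof -
          have "simple_function lebesgue (\<lambda>t. indicator {s..b} t *\<^sub>R F t)"
            using F(1) simple_function_restrict_space[of "{s..b}" lebesgue F] by simp
          then have "simple_function lebesgue (\<lambda>t. indicator {r k..r (Suc k)} t *\<^sub>R (indicator {s..b} t *\<^sub>R F t))"
            by (rule simple_function_compose2[rotated]) (rule simple_function_indicator, simp)
          moreover have "(\<lambda>t. indicator {r k..r (Suc k)} t *\<^sub>R (indicator {s..b} t *\<^sub>R F t)) = (\<lambda>t. indicator {r k..r (Suc k)} t *\<^sub>R F t)"
            using rk by (auto simp: indicator_def fun_eq_iff)
          ultimately show ?thesis using simple_function_restrict_space[of "{r k..r (Suc k)}" lebesgue F] by simp
        qed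
        have "Lp_norm p (r k) (r (Suc k)) (vz (r k)) \<le> M * Lp_norm p (r k) (r (Suc k)) (\<lambda>t. gz (r k) t + A t (vz (r k) t) - j (F t))
            + (M * KA + 1) * (S * (r (Suc k) - r k)) * (r (Suc k) - r k) powr (1 / p)"
          by (rule short_interval_remainder[OF p rk(5,6,7) A KA reg[OF rk(5,6,7,8)] M zs(1) zq[OF rk(4)] F' F(2,3)])
             (use rk in auto)
        also have "Lp_norm p (r k) (r (Suc k)) (\<lambda>t. gz (r k) t + A t (vz (r k) t) - j (F t)) = Lp_norm p (r k) (r (Suc k)) e"
          by (rule Lp_fun_AE_cong(2)[OF Lp_fun_subinterval[OF eLp] _ p1])
             (use zs(2) rk in \<open>auto simp: e_def elim: eventually_mono\<close>)
        also have "(M * KA + 1) * (S * (r (Suc k) - r k)) * (r (Suc k) - r k) powr (1 / p) = B * \<delta> * \<delta> powr (1 / p)"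
          by (simp add: rS B_def)
        finally have vB: "Lp_norm p (r k) (r (Suc k)) (vz (r k)) \<le> M * Lp_norm p (r k) (r (Suc k)) e + B * \<delta> * \<delta> powr (1 / p)" .
        have "\<rho> k \<le> KP * (M * Lp_norm p (r k) (r (Suc k)) e + B * \<delta> * \<delta> powr (1 / p))"
          unfolding \<rho>_def using opP(2)[OF rk(5,7) zs(3)] mult_left_mono[OF vB KP(2)] by linarith
        then have "\<rho> k powr p \<le> (KP * (M * Lp_norm p (r k) (r (Suc k)) e + B * \<delta> * \<delta> powr (1 / p))) powr p"
          by (intro powr_mono2) (use p0 in \<open>auto simp: \<rho>_def\<close>)
        also have "\<dots> \<le> KP powr p * (2 powr p * ((M * Lp_norm p (r k) (r (Suc k)) e) powr p + (B * \<delta> * \<delta> powr (1 / p)) powr p))"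
          unfolding powr_mult[of KP] using M B \<delta>(1) by (intro mult_left_mono add_powr_le_two_powr p1) auto
        also have "\<dots> = (2 * KP) powr p * (M powr p * Lp_mass p (r k) (r (Suc k)) e + (B * \<delta>) powr p * \<delta>)"
          using p0 \<delta>(1) by (simp add: powr_mult powr_powr Lp_norm_powr algebra_simps)
        finally show ?thesis .
      qed
      have "(\<Sum>k<N. \<rho> k powr p) \<le> (\<Sum>k<N. (2 * KP) powr p * (M powr p * Lp_mass p (r k) (r (Suc k)) e + (B * \<delta>) powr p * \<delta>))"
        by (rule sum_mono) (use \<rho> in auto)
      also have "\<dots> = (2 * KP) powr p * (M powr p * (\<Sum>k<N. Lp_mass p (r k) (r (Suc k)) e) + (B * \<delta>) powr p * (real N * \<delta>))"
        by (simp add: sum_distrib_left sum.distrib algebra_simps)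
      also have "\<dots> = (2 * KP) powr p * (M powr p * Lp_mass p s b e + (B * \<delta>) powr p * (b - s))"
        unfolding Lp_mass_grid[OF eLp less_imp_le[OF sb(2)] rgrid N] \<delta>(2) ..
      also have "\<dots> \<le> (2 * KP) powr p * (M powr p * \<epsilon> powr p + (B * \<delta>) powr p * (b - s))"
        using F(4,5) p0 unfolding e_def[abs_def]
        by (intro mult_left_mono add_right_mono) (auto simp: Lp_norm_le_iff)
      finally show ?thesis .
    qed
    then have "(\<Sum>k<N. \<rho> k powr p) powr (1 / p) \<le> ((2 * KP) powr p * (M powr p * \<epsilon> powr p + (B * \<delta>) powr p * (b - s))) powr (1 / p)"
      by (intro powr_mono2) (use p0 in \<open>auto intro: sum_nonneg\<close>)
    moreover have "X 0 = Lp_norm p s b (\<lambda>t. P t (v t))"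
    proof -
      have s: "s \<in> {s..<\<tau>}" using sb by simp
      have "AE t in lebesgue_on {s..\<tau>}. P t (v t) = P t (vz s t)"
        using MR_tripleD(4)[OF hom(1)[OF s]]
      proof eventually_elim
        fix t assume "j (vU s t) = U t s (w s)"
        then have "j (vU s t) = j 0" using w(2) by (simp add: blinfun.zero_right)
        then have "vU s t = 0" by (rule injD[OF j])
        then show "P t (v t) = P t (vz s t)" by (simp add: vz_def)
      qed
      then have "AE t in lebesgue_on {s..b}. P t (v t) = P t (vz s t)"
        by (rule AE_lebesgue_on_subset) (use sb in auto)
      moreover have "Lp_fun p s b (\<lambda>t. P t (v t))"
        by (rule opP(1)[OF sb(1,3) Lp_fun_subinterval[OF MR_tripleD(3)[OF w(1)]]]) (use sb in auto)
      ultimately have "Lp_norm p s b (\<lambda>t. P t (vz s t)) = Lp_norm p s b (\<lambda>t. P t (v t))"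
        by (intro Lp_fun_AE_cong(2) p1)
      then show ?thesis using N by (simp add: X_def r_def)
    qed
    ultimately show ?thesis by (simp add: B_def \<delta>_def)
  qed
  have "Lp_norm p s b (\<lambda>t. P t (v t)) \<le> E + e" if e: "e > 0" for e
  proof -
    \<comment> \<open>First the approximation is fixed so that its contribution is less than \<open>e\<close>, then the grid is refined.\<close>
    define \<epsilon> where "\<epsilon> = e / (2 * (2 * KP * M + 1))"
    define T where "T = 2 * KP * M"
    have T: "T \<ge> 0" using KP(2) M by (simp add: T_def)
    have \<epsilon>T: "\<epsilon> = e / (2 * (T + 1))" by (simp add: \<epsilon>_def T_def)
    have "T * e < 2 * (T + 1) * e" by (rule mult_strict_right_mono[OF _ e]) (use T in simp)
    then have \<epsilon>: "\<epsilon> > 0" "2 * KP * M * \<epsilon> < e"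
      using e T unfolding T_def[symmetric] \<epsilon>T by (simp_all add: divide_less_eq mult.commute)
    obtain F S where F: "simple_function (lebesgue_on {s..b}) F" "\<And>t. t \<in> {s..b} \<Longrightarrow> norm (F t) \<le> S" "S \<ge> 0"
        "Lp_norm p s b (\<lambda>t. f t - j (F t)) \<le> \<epsilon>"
      using dense_simple_approximation[OF dj p fb sb(2) \<epsilon>(1)] by blast
    let ?G = "\<lambda>N. (2 * KP) powr p * (M powr p * \<epsilon> powr p + ((M * KA + 1) * S * (b - s) / real N) powr p * (b - s))"
    have "(\<lambda>N. (M * KA + 1) * S * (b - s) / real N) \<longlonglongrightarrow> 0" by (rule lim_const_over_n)
    moreover have "(M * KA + 1) * S * (b - s) / real N \<ge> 0" for N
      using M KA(2) F(3) sb by simp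
    ultimately have "(\<lambda>N. ((M * KA + 1) * S * (b - s) / real N) powr p) \<longlonglongrightarrow> 0 powr p"
      using p0 by (intro tendsto_powr' tendsto_const) simp_all
    then have "?G \<longlonglongrightarrow> (2 * KP) powr p * (M powr p * \<epsilon> powr p + 0 powr p * (b - s))"
      by (intro tendsto_mult tendsto_add tendsto_const)
    moreover have "(2 * KP) powr p * (M powr p * \<epsilon> powr p + 0 powr p * (b - s)) = (2 * KP * M * \<epsilon>) powr p"
      using p0 by (simp add: powr_mult)
    moreover have "(2 * KP * M * \<epsilon>) powr p < e powr p"
      by (rule powr_less_mono2) (use \<epsilon> KP(2) M p0 in auto)
    ultimately have "\<forall>\<^sub>F N in sequentially. ?G N < e powr p" by (simp add: order_tendstoD(2))
    then have "\<forall>\<^sub>F N in sequentially. ?G N < e powr p \<and> N > 0"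
      using eventually_gt_at_top[of 0] by eventually_elim simp
    then obtain N where N: "?G N < e powr p" "N > 0" by (auto dest: eventually_happens)
    have "?G N powr (1 / p) \<le> (e powr p) powr (1 / p)"
      by (rule powr_mono2) (use N p0 sb in \<open>auto intro!: mult_nonneg_nonneg add_nonneg_nonneg\<close>)
    also have "\<dots> = e" using p0 e by (simp add: powr_powr)
    finally have "?G N powr (1 / p) \<le> e" .
    then show ?thesis using grid[OF F less_imp_le[OF \<epsilon>(1)] N(2)] by linarith
  qed
  then have "Lp_norm p s b (\<lambda>t. P t (v t)) \<le> E" by (rule field_le_epsilon)
  then show ?thesis by (simp add: E_def f_def[abs_def])
qed

text \<open>The previous estimate with \<open>l\<close> equal to a constant \<open>k\<close> times the norm of the right-hand side.\<close>

lemma observation_half_bound: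
  fixes j :: "'d::banach \<Rightarrow>\<^sub>L 'x::banach"
  assumes dj: "dense_embedding j" and p: "p > 1"
    and A: "strongly_measurable_bounded_on \<tau> A" and P: "strongly_measurable_bounded_on \<tau> P"
    and reg: "\<And>a b. 0 \<le> a \<Longrightarrow> a < b \<Longrightarrow> b \<le> \<tau> \<Longrightarrow> b - a \<le> h0 \<Longrightarrow> regularity_bound j p A a b M" and M: "M \<ge> 0" "h0 > 0"
    and U: "evolution_family \<tau> U" and solves: "solves_homogeneous j \<tau> p A U"
    and obs: "\<And>r d v. 0 \<le> r \<Longrightarrow> r < \<tau> \<Longrightarrow> Lp_fun p r \<tau> v \<Longrightarrow>
      (AE t in lebesgue_on {r..\<tau>}. j (v t) = U t r d) \<Longrightarrow> Lp_norm p r \<tau> (\<lambda>t. P t (v t)) \<le> C * norm d"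
    and C: "C \<ge> 0"
  obtains h where "h > 0" "h \<le> h0"
    "\<And>s b w g v. 0 \<le> s \<Longrightarrow> s < b \<Longrightarrow> b \<le> \<tau> \<Longrightarrow> b - s \<le> h \<Longrightarrow> MR_triple j p s \<tau> w g v \<Longrightarrow> w s = 0 \<Longrightarrow>
      Lp_norm p s b (\<lambda>t. P t (v t)) \<le> 1 / 2 * Lp_norm p s b (\<lambda>t. g t + A t (v t))"
proof -
  obtain KA where KA: "\<And>t. t \<in> {0..\<tau>} \<Longrightarrow> norm (A t) \<le> KA" "KA \<ge> 0" using strongly_measurable_bounded_onE[OF A] by blast
  define B where "B = (1 + KA * M) powr p"
  have "1 + KA * M > 0" using KA(2) M(1) by (simp add: add_pos_nonneg)
  then have B: "B > 0" by (simp add: B_def)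
  \<comment> \<open>The weight makes the second term of the estimate small; the length of the interval then does so for the first.\<close>
  define k where "k = (4 * (C + 1) * B) powr (1 / (p - 1))"
  have k: "k > 0" using B C by (simp add: k_def)
  have "k powr (1 - p) = (4 * (C + 1) * B) powr (- 1)"
    using p unfolding k_def powr_powr by (intro arg_cong2[where f = "(powr)"]) (auto simp: field_simps)
  also have "\<dots> = 1 / (4 * (C + 1) * B)" using B C by (simp add: powr_minus_divide)
  finally have "C * (k powr (1 - p) * B) = C / (4 * (C + 1))" using B by simp
  also have "\<dots> \<le> 1/4" using C by (simp add: field_simps)
  finally have k1: "C * (k powr (1 - p) * B) \<le> 1/4" .
  define h where "h = min h0 (1 / (4 * (C + 1) * k))"
  have h: "h > 0" "h \<le> h0" using M(2) C k by (auto simp: h_def)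
  have "C * (k * h) \<le> C * (k * (1 / (4 * (C + 1) * k)))" using C k by (intro mult_left_mono) (auto simp: h_def)
  also have "\<dots> = C / (4 * (C + 1))" using k by simp
  also have "\<dots> \<le> 1/4" using C by (simp add: field_simps)
  finally have k2: "C * (k * h) \<le> 1/4" .
  have "Lp_norm p s b (\<lambda>t. P t (v t)) \<le> 1 / 2 * Lp_norm p s b (\<lambda>t. g t + A t (v t))"
    if sb: "0 \<le> s" "s < b" "b \<le> \<tau>" "b - s \<le> h" and w: "MR_triple j p s \<tau> w g v" "w s = 0" for s b w g v
  proof (rule field_le_epsilon)
    fix e :: real assume e: "e > 0"
    let ?f = "\<lambda>t. g t + A t (v t)"
    define G where "G = Lp_norm p s b ?f + e"
    have G: "G > 0" "Lp_mass p s b ?f \<le> G powr p"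
      using e Lp_norm_nonneg[of p s b ?f] Lp_norm_le_iff[of p G s b ?f] p by (auto simp: G_def add_nonneg_pos)
    have "Lp_norm p s b (\<lambda>t. P t (v t)) \<le>
        C * ((k * G) * (b - s) + (k * G) powr (1 - p) * ((1 + KA * M) powr p * Lp_mass p s b ?f))"
      by (rule observation_of_inhomogeneous_solution[OF dj p A KA P reg M(1) U solves obs C sb(1-3) _ w])
         (use h sb k G in auto)
    also have "\<dots> \<le> C * ((k * G) * h + (k * G) powr (1 - p) * (B * G powr p))"
      using C k G B sb unfolding B_def[symmetric] by (intro mult_left_mono add_mono) auto
    also have "\<dots> = C * (k * h) * G + C * (k powr (1 - p) * B) * (G powr (1 - p) * G powr p)"
      by (simp add: powr_mult algebra_simps)
    also have "G powr (1 - p) * G powr p = G" using G(1) by (simp flip: powr_add)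
    also have "C * (k * h) * G + C * (k powr (1 - p) * B) * G \<le> 1/4 * G + 1/4 * G"
      using k1 k2 G(1) by (intro add_mono mult_right_mono) auto
    also have "\<dots> \<le> 1 / 2 * Lp_norm p s b ?f + e" using e by (simp add: G_def)
    finally show "Lp_norm p s b (\<lambda>t. P t (v t)) \<le> 1 / 2 * Lp_norm p s b ?f + e" .
  qed
  then show thesis using that[OF h] by blast
qed

section \<open>Invariance of the admissible observation operators\<close>

text \<open>Admissibility only concerns short time intervals, and C is bounded on D, so two evolution families whose
  orbits are close in \<open>L\<^sup>p(D)\<close> on short intervals can be interchanged.\<close>

lemma admissible_ops_subset:
  fixes j :: "'d::banach \<Rightarrow>\<^sub>L 'x::banach" and U V :: "real \<Rightarrow> real \<Rightarrow> ('x \<Rightarrow>\<^sub>L 'x)"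
  assumes j: "inj (blinfun_apply j)" and p: "p > 1" and h: "h > 0" "K \<ge> 0"
    and close: "\<And>s x. s \<in> {0..<\<tau>} \<Longrightarrow> \<exists>u v. Lp_fun p s \<tau> u \<and> Lp_fun p s \<tau> v \<and>
        (AE t in lebesgue_on {s..\<tau>}. j (u t) = U t s (j x)) \<and> (AE t in lebesgue_on {s..\<tau>}. j (v t) = V t s (j x)) \<and>
        (\<forall>b. s < b \<and> b \<le> \<tau> \<and> b - s \<le> h \<longrightarrow> Lp_norm p s b (\<lambda>t. v t - u t) \<le> K * norm (j x))"
  shows "(admissible_ops j \<tau> p U :: ('d \<Rightarrow>\<^sub>L 'y::banach) set) \<subseteq> admissible_ops j \<tau> p V"
proof
  fix C :: "'d \<Rightarrow>\<^sub>L 'y" assume "C \<in> admissible_ops j \<tau> p U"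
  then obtain \<gamma> \<alpha> where \<gamma>: "\<gamma> > 0" "\<alpha> > 0" and adm: "\<And>s x. s \<in> {0..<\<tau>} \<Longrightarrow>
      (integral\<^sup>L (lebesgue_on {s..min (s + \<alpha>) \<tau>}) (\<lambda>t. norm (C (inv (blinfun_apply j) (U t s (j x)))) powr p)) powr (1 / p)
          \<le> \<gamma> * norm (j x)"
    unfolding admissible_ops_def by blast
  have p1: "p \<ge> 1" using p by simp
  have obs: "Lp_fun p s b (\<lambda>t. C (inv (blinfun_apply j) (y t))) \<and>
      Lp_norm p s b (\<lambda>t. C (inv (blinfun_apply j) (y t))) = Lp_norm p s b (\<lambda>t. C (u t))"
    if u: "Lp_fun p s \<tau> u" "AE t in lebesgue_on {s..\<tau>}. j (u t) = y t" and b: "b \<le> \<tau>"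
    for s b u and y :: "real \<Rightarrow> 'x"
  proof -
    have "AE t in lebesgue_on {s..b}. j (u t) = y t"
      by (rule AE_lebesgue_on_subset[OF u(2)]) (use b in auto)
    then have "AE t in lebesgue_on {s..b}. C (u t) = C (inv (blinfun_apply j) (y t))"
    proof eventually_elim
      fix t assume "j (u t) = y t"
      then show "C (u t) = C (inv (blinfun_apply j) (y t))" by (metis j inv_f_f)
    qed
    from Lp_fun_AE_cong[OF Lp_fun_blinfun(1)[OF p1 Lp_fun_subinterval[OF u(1)]] this p1] b
    show ?thesis by auto
  qed
  define \<alpha>' where "\<alpha>' = min \<alpha> h"
  define \<gamma>' where "\<gamma>' = \<gamma> + norm C * K"
  have "\<alpha>' > 0" "\<gamma>' > 0" using \<gamma> h by (auto simp: \<alpha>'_def \<gamma>'_def add_pos_nonneg)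
  moreover have "integrable (lebesgue_on {s..min (s + \<alpha>') \<tau>}) (\<lambda>t. norm (C (inv (blinfun_apply j) (V t s (j x)))) powr p) \<and>
      (integral\<^sup>L (lebesgue_on {s..min (s + \<alpha>') \<tau>}) (\<lambda>t. norm (C (inv (blinfun_apply j) (V t s (j x)))) powr p)) powr (1 / p)
          \<le> \<gamma>' * norm (j x)" if s: "s \<in> {0..<\<tau>}" for s x
  proof -
    obtain u v where uv: "Lp_fun p s \<tau> u" "Lp_fun p s \<tau> v"
      "AE t in lebesgue_on {s..\<tau>}. j (u t) = U t s (j x)" "AE t in lebesgue_on {s..\<tau>}. j (v t) = V t s (j x)"
      "\<And>b. s < b \<Longrightarrow> b \<le> \<tau> \<Longrightarrow> b - s \<le> h \<Longrightarrow> Lp_norm p s b (\<lambda>t. v t - u t) \<le> K * norm (j x)"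
      using close[OF s, of x] by blast
    define b where "b = min (s + \<alpha>') \<tau>"
    define b' where "b' = min (s + \<alpha>) \<tau>"
    have b: "s < b" "b \<le> b'" "b' \<le> \<tau>" "b \<le> \<tau>" "b - s \<le> h"
      using s \<open>\<alpha>' > 0\<close> by (auto simp: b_def b'_def \<alpha>'_def)
    have ub: "Lp_fun p s b u" "Lp_fun p s b v" "Lp_fun p s b' u"
      using uv(1,2) b by (auto intro: Lp_fun_subinterval)
    have "Lp_norm p s b' (\<lambda>t. C (u t)) \<le> \<gamma> * norm (j x)"
      using adm[OF s, of x] obs[OF uv(1,3) b(3)] unfolding b'_def[symmetric]
      by (metis Lp_mass_lebesgue Lp_norm_def)
    moreover have "Lp_norm p s b (\<lambda>t. C (u t)) \<le> Lp_norm p s b' (\<lambda>t. C (u t))"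
      by (rule Lp_norm_mono[OF Lp_fun_blinfun(1)[OF p1 ub(3)]]) (use b p in auto)
    moreover have vu: "Lp_fun p s b (\<lambda>t. v t - u t)" by (rule Lp_fun_diff(1)[OF p1 ub(2,1)])
    have "Lp_norm p s b (\<lambda>t. C (v t - u t)) \<le> norm C * (K * norm (j x))"
      using Lp_fun_blinfun(2)[OF p1 vu, of C] mult_left_mono[OF uv(5)[OF b(1,4,5)] norm_ge_zero[of C]] by linarith
    moreover have "Lp_norm p s b (\<lambda>t. C (u t) + C (v t - u t)) \<le> Lp_norm p s b (\<lambda>t. C (u t)) + Lp_norm p s b (\<lambda>t. C (v t - u t))"
      by (intro Lp_fun_add(2)[OF p1] Lp_fun_blinfun(1)[OF p1] ub vu)
    moreover have "(\<lambda>t. C (u t) + C (v t - u t)) = (\<lambda>t. C (v t))"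
      by (simp add: fun_eq_iff blinfun.diff_right)
    ultimately have "Lp_norm p s b (\<lambda>t. C (v t)) \<le> \<gamma>' * norm (j x)"
      by (simp add: \<gamma>'_def algebra_simps)
    then show ?thesis
      using obs[OF uv(2,4) b(4)] unfolding b_def[symmetric]
      by (metis Lp_mass_lebesgue Lp_norm_def Lp_fun_def)
  qed
  ultimately show "C \<in> admissible_ops j \<tau> p V" unfolding admissible_ops_def by blast
qed

theorem theorem4p6:
  fixes j :: "'d::banach \<Rightarrow>\<^sub>L 'x::banach"
    and A P :: "real \<Rightarrow> ('d \<Rightarrow>\<^sub>L 'x)"
    and U V :: "real \<Rightarrow> real \<Rightarrow> ('x \<Rightarrow>\<^sub>L 'x)"
    and \<tau> \<nu> \<mu> c :: real
  assumes "dense_embedding j"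
    and "\<tau> > 0"
    and "strongly_measurable_bounded_on \<tau> A"
    and "\<forall>t\<in>{0..\<tau>}. A t \<in> MR_ops j"
    and "\<nu> > 1" and "relative_Dini j \<tau> \<nu> A"
    and "associated_evolution_family j \<tau> A U"
    and "strongly_measurable_bounded_on \<tau> P"
    and "\<mu> > 1" and "c > 0"
    and "\<forall>s \<tau>' x. 0 \<le> s \<and> s < \<tau>' \<and> \<tau>' < \<tau> \<longrightarrow>
      integrable (lebesgue_on {s..\<tau>'})
        (\<lambda>t. norm (P t (inv (blinfun_apply j) (U t s (j x)))) powr \<mu>) \<and>
      (integral\<^sup>L (lebesgue_on {s..\<tau>'})
        (\<lambda>t. norm (P t (inv (blinfun_apply j) (U t s (j x)))) powr \<mu>)) powr (1 / \<mu>)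
        \<le> c * norm (j x)"
    and "associated_evolution_family_upto j \<tau> \<mu> (\<lambda>t. A t + P t) V"
  shows "\<forall>\<theta>. 1 < \<theta> \<and> \<theta> \<le> \<mu> \<longrightarrow>
    (admissible_ops j \<tau> \<theta> U :: ('d \<Rightarrow>\<^sub>L 'y::banach) set) = admissible_ops j \<tau> \<theta> V"
proof (intro allI impI)
  fix \<theta> :: real assume \<theta>: "1 < \<theta> \<and> \<theta> \<le> \<mu>"
  then have p: "\<theta> > 1" "\<theta> \<le> \<mu>" and p1: "\<theta> \<ge> 1" and p0: "\<theta> > 0" and \<mu>0: "\<mu> > 0" by auto
  note dj = assms(1) and A = assms(3) and P = assms(8)
  have j: "inj (blinfun_apply j)" using dj by (simp add: dense_embedding_def)
  have evU: "evolution_family \<tau> U" and bdU: "bounded {U t s | s t. 0 \<le> s \<and> s \<le> t \<and> t \<le> \<tau>}"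
    and solU: "solves_homogeneous j \<tau> \<theta> A U"
    using assms(7) p by (auto simp: associated_evolution_family_def)
  have evV: "evolution_family \<tau> V" and solV: "solves_homogeneous j \<tau> \<theta> (\<lambda>t. A t + P t) V"
    using assms(12) p by (auto simp: associated_evolution_family_upto_def)
  obtain L where L: "L > 0" "\<And>t s. 0 \<le> s \<Longrightarrow> s \<le> t \<Longrightarrow> t \<le> \<tau> \<Longrightarrow> norm (U t s) \<le> L"
    using bdU unfolding bounded_pos by blast
  have MRA: "maximal_Lp_regularity j \<theta> (A t)" if "t \<in> {0..\<tau>}" for t
    using assms(4) that p by (auto simp: MR_ops_def)
  obtain h0 M where M: "h0 > 0" "M \<ge> 0"
    "\<And>a b. 0 \<le> a \<Longrightarrow> a < b \<Longrightarrow> b \<le> \<tau> \<Longrightarrow> b - a \<le> h0 \<Longrightarrow> regularity_bound j \<theta> A a b M"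
    using uniform_regularity_bound[OF j p(1) A assms(6) MRA] by blast
  obtain KP where KP: "\<And>t. t \<in> {0..\<tau>} \<Longrightarrow> norm (P t) \<le> KP" "KP \<ge> 0" using strongly_measurable_bounded_onE[OF P] by blast
  define c' where "c' = (\<tau> + c powr \<mu>) powr (1 / \<theta>)"
  have c': "c' \<ge> 0" by (simp add: c'_def)
  have adm: "Lp_norm \<theta> s b (\<lambda>t. P t (v t)) \<le> c' * norm (j x)"
    if sb: "0 \<le> s" "s < b" "b < \<tau>" and v: "Lp_fun \<theta> s b v" "AE t in lebesgue_on {s..b}. j (v t) = U t s (j x)"
    for s b x v
  proof -
    let ?f = "\<lambda>t. norm (P t (v t)) powr \<mu>" and ?g = "\<lambda>t. norm (P t (inv (blinfun_apply j) (U t s (j x)))) powr \<mu>"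
    have hyp: "integrable (lebesgue_on {s..b}) ?g" "(integral\<^sup>L (lebesgue_on {s..b}) ?g) powr (1 / \<mu>) \<le> c * norm (j x)"
      using assms(11) sb by auto
    have PvLp: "Lp_fun \<theta> s b (\<lambda>t. P t (v t))" by (rule Lp_fun_operator(1)[OF p1 P sb(1) _ KP v(1)]) (use sb in auto)
    have meas: "?f \<in> borel_measurable (lebesgue_on {s..b})" by (rule sm_norm_powr_measurable[OF Lp_fun_sm[OF PvLp] \<mu>0])
    have eq: "AE t in lebesgue_on {s..b}. ?g t = ?f t"
      using v(2)
    proof eventually_elim
      fix t assume "j (v t) = U t s (j x)"
      then have "inv (blinfun_apply j) (U t s (j x)) = v t" by (metis j inv_f_f)
      then show "?g t = ?f t" by simp
    qed
    have "integrable (lebesgue_on {s..b}) ?f" by (rule integrable_cong_AE_imp[OF hyp(1) meas eq])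
    moreover have "integral\<^sup>L (lebesgue_on {s..b}) ?g = integral\<^sup>L (lebesgue_on {s..b}) ?f"
      by (rule integral_cong_AE[OF borel_measurable_integrable[OF hyp(1)] meas eq])
    ultimately show ?thesis
      unfolding c'_def using observation_bound_lower_exponent[OF p sb(2) _ PvLp assms(10), of \<tau> "norm (j x)"] hyp(2) sb by simp
  qed
  have obs: "Lp_norm \<theta> r \<tau> (\<lambda>t. P t (v t)) \<le> (c' * L) * norm d"
    if "0 \<le> r" "r < \<tau>" "Lp_fun \<theta> r \<tau> v" "AE t in lebesgue_on {r..\<tau>}. j (v t) = U t r d" for r d v
    by (rule observation_bound_trace[OF evU L(2) P p1 adm that(1,2) c' that(3,4)])
  have C: "c' * L \<ge> 0" using c' L(1) by simp
  obtain h where h: "h > 0" "h \<le> h0" and small: "\<And>s b w g v. 0 \<le> s \<Longrightarrow> s < b \<Longrightarrow> b \<le> \<tau> \<Longrightarrow> b - s \<le> h \<Longrightarrow>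
      MR_triple j \<theta> s \<tau> w g v \<Longrightarrow> w s = 0 \<Longrightarrow>
      Lp_norm \<theta> s b (\<lambda>t. P t (v t)) \<le> 1 / 2 * Lp_norm \<theta> s b (\<lambda>t. g t + A t (v t))"
    using observation_half_bound[OF dj p(1) A P M(3,2,1) evU solU obs C] by blast
  define K where "K = 2 * M * (c' * L)"
  have K: "K \<ge> 0" using M C by (simp add: K_def)
  have close: "\<exists>u v. Lp_fun \<theta> s \<tau> u \<and> Lp_fun \<theta> s \<tau> v \<and>
        (AE t in lebesgue_on {s..\<tau>}. j (u t) = U t s (j x)) \<and> (AE t in lebesgue_on {s..\<tau>}. j (v t) = V t s (j x)) \<and>
        (\<forall>b. s < b \<and> b \<le> \<tau> \<and> b - s \<le> h \<longrightarrow> Lp_norm \<theta> s b (\<lambda>t. v t - u t) \<le> K * norm (j x))"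
    if s: "s \<in> {0..<\<tau>}" for s x
  proof -
    have "j x \<in> trace_space j \<theta> s \<tau>"
      using MR_triple_start_in_trace_space[OF j p1 MR_triple_const[of s \<tau> "j x" j x \<theta>], of s] s by auto
    then obtain gU u gV v where
      u: "MR_triple j \<theta> s \<tau> (\<lambda>t. U t s (j x)) gU u" "AE t in lebesgue_on {s..\<tau>}. gU t + A t (u t) = 0" and
      v: "MR_triple j \<theta> s \<tau> (\<lambda>t. V t s (j x)) gV v" "AE t in lebesgue_on {s..\<tau>}. gV t + (A t + P t) (v t) = 0"
      using solves_homogeneousD[OF j p1 solU s] solves_homogeneousD[OF j p1 solV s] by blast
    \<comment> \<open>The difference of the orbits solves the unperturbed equation with right-hand side \<open>- P v\<close>.\<close>
    have w: "MR_triple j \<theta> s \<tau> (\<lambda>t. V t s (j x) - U t s (j x)) (\<lambda>t. gV t - gU t) (\<lambda>t. v t - u t)"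
      by (rule MR_triple_diff[OF p1 v(1) u(1)])
    have ws: "V s s (j x) - U s s (j x) = 0"
      using evU evV s by (simp add: evolution_family_def)
    have weq: "AE t in lebesgue_on {s..\<tau>}. (-1) *\<^sub>R P t (v t) = (gV t - gU t) + A t (v t - u t)"
      using u(2) v(2)
    proof eventually_elim
      fix t assume t: "gU t + A t (u t) = 0" "gV t + (A t + P t) (v t) = 0"
      have "gV t + A t (v t) + P t (v t) = 0" using t(2) by (simp add: blinfun.add_left add.assoc)
      then have "gV t + A t (v t) = - P t (v t)" by (rule eq_neg_iff_add_eq_0[THEN iffD2])
      moreover have "(gV t - gU t) + A t (v t - u t) = (gV t + A t (v t)) - (gU t + A t (u t))"
        by (simp add: blinfun.diff_right)
      ultimately show "(-1) *\<^sub>R P t (v t) = (gV t - gU t) + A t (v t - u t)" using t(1) by simp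
    qed
    have "Lp_norm \<theta> s b (\<lambda>t. v t - u t) \<le> K * norm (j x)" if b: "s < b" "b \<le> \<tau>" "b - s \<le> h" for b
    proof -
      have s0: "0 \<le> s" "s < \<tau>" using s by auto
      have Lps: "Lp_fun \<theta> s b u" "Lp_fun \<theta> s b v" "Lp_fun \<theta> s b (\<lambda>t. v t - u t)"
        using Lp_fun_subinterval[OF MR_tripleD(3)[OF u(1)]] Lp_fun_subinterval[OF MR_tripleD(3)[OF v(1)]]
          Lp_fun_subinterval[OF MR_tripleD(3)[OF w]] b by auto
      have opP: "Lp_fun \<theta> s c (\<lambda>t. P t (y t))" if "c \<le> \<tau>" "Lp_fun \<theta> s c y" for c y
        using Lp_fun_operator(1)[OF p1 P s0(1) that(1) KP that(2)] by auto
      let ?N = "Lp_norm \<theta> s b (\<lambda>t. P t (v t))"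
      have "AE t in lebesgue_on {s..b}. (-1) *\<^sub>R P t (v t) = (gV t - gU t) + A t (v t - u t)"
        by (rule AE_lebesgue_on_subset[OF weq]) (use b in auto)
      from Lp_fun_AE_cong(2)[OF Lp_fun_scaleR[OF opP[OF b(2) Lps(2)]] this p1]
      have f: "Lp_norm \<theta> s b (\<lambda>t. (gV t - gU t) + A t (v t - u t)) = ?N"
        using Lp_norm_scaleR[OF p0, of s b "-1" "\<lambda>t. P t (v t)"] by simp
      \<comment> \<open>Half of the observation of \<open>v\<close> is absorbed into the left-hand side.\<close>
      have "?N = Lp_norm \<theta> s b (\<lambda>t. P t (u t) + P t (v t - u t))"
        by (simp add: blinfun.diff_right)
      also have "\<dots> \<le> Lp_norm \<theta> s b (\<lambda>t. P t (u t)) + Lp_norm \<theta> s b (\<lambda>t. P t (v t - u t))"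
        by (rule Lp_fun_add(2)[OF p1 opP[OF b(2) Lps(1)] opP[OF b(2) Lps(3)]])
      also have "Lp_norm \<theta> s b (\<lambda>t. P t (v t - u t)) \<le> 1 / 2 * ?N"
        using small[OF s0(1) b w ws] unfolding f .
      finally have "?N \<le> 2 * Lp_norm \<theta> s b (\<lambda>t. P t (u t))" by simp
      also have "Lp_norm \<theta> s b (\<lambda>t. P t (u t)) \<le> Lp_norm \<theta> s \<tau> (\<lambda>t. P t (u t))"
        by (rule Lp_norm_mono[OF opP[OF order_refl MR_tripleD(3)[OF u(1)]]]) (use b p0 in auto)
      also have "\<dots> \<le> (c' * L) * norm (j x)" by (rule obs[OF s0 MR_tripleD(3,4)[OF u(1)]])
      finally have N: "?N \<le> 2 * ((c' * L) * norm (j x))" by simp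
      have "regularity_bound j \<theta> A s b M" by (rule M(3)) (use s0 b h in auto)
      then have "Lp_norm \<theta> s b (\<lambda>t. v t - u t) \<le> M * ?N"
        using MR_triple_subinterval[OF w, of s b] ws b f unfolding regularity_bound_def by fastforce
      also have "\<dots> \<le> M * (2 * ((c' * L) * norm (j x)))" by (rule mult_left_mono[OF N M(2)])
      finally show ?thesis by (simp add: K_def algebra_simps)
    qed
    then show ?thesis using MR_tripleD(3,4)[OF u(1)] MR_tripleD(3,4)[OF v(1)] by blast
  qed
  show "(admissible_ops j \<tau> \<theta> U :: ('d \<Rightarrow>\<^sub>L 'y) set) = admissible_ops j \<tau> \<theta> V"
  proof
    show "(admissible_ops j \<tau> \<theta> U :: ('d \<Rightarrow>\<^sub>L 'y) set) \<subseteq> admissible_ops j \<tau> \<theta> V"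
      by (rule admissible_ops_subset[OF j p(1) h(1) K close])
    show "(admissible_ops j \<tau> \<theta> V :: ('d \<Rightarrow>\<^sub>L 'y) set) \<subseteq> admissible_ops j \<tau> \<theta> U"
    proof (rule admissible_ops_subset[OF j p(1) h(1) K])
      fix s x assume s: "s \<in> {0..<\<tau>}"
      have sym: "Lp_norm \<theta> s b (\<lambda>t. u t - v t) = Lp_norm \<theta> s b (\<lambda>t. v t - u t)" for b and u v :: "real \<Rightarrow> 'd"
        using Lp_norm_scaleR[OF p0, of s b "-1" "\<lambda>t. v t - u t"] by simp
      obtain u v where "Lp_fun \<theta> s \<tau> u" "Lp_fun \<theta> s \<tau> v"
        "AE t in lebesgue_on {s..\<tau>}. j (u t) = U t s (j x)" "AE t in lebesgue_on {s..\<tau>}. j (v t) = V t s (j x)"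
        "\<forall>b. s < b \<and> b \<le> \<tau> \<and> b - s \<le> h \<longrightarrow> Lp_norm \<theta> s b (\<lambda>t. v t - u t) \<le> K * norm (j x)"
        using close[OF s, of x] by blast
      then show "\<exists>u v. Lp_fun \<theta> s \<tau> u \<and> Lp_fun \<theta> s \<tau> v \<and>
        (AE t in lebesgue_on {s..\<tau>}. j (u t) = V t s (j x)) \<and> (AE t in lebesgue_on {s..\<tau>}. j (v t) = U t s (j x)) \<and>
        (\<forall>b. s < b \<and> b \<le> \<tau> \<and> b - s \<le> h \<longrightarrow> Lp_norm \<theta> s b (\<lambda>t. v t - u t) \<le> K * norm (j x))"
        by (intro exI[of _ v] exI[of _ u]) (simp add: sym[of _ u v])
    qed
  qed
qed

end
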